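(* Let $\mathcal D=\{(a,p):0<a<1,\ 1-a^2-p^2>0\}$. Fix a positive $\ell_1\in C^\infty(\mathbb R)$, $c\ne0$, $\varepsilon>0$, $\sigma\in\{-1,1\}$, $t_0\in\mathbb R$, and $(a_0,p_0)\in\mathcal D$. There is a unique smooth magnitude function $a$ on $\mathbb R$ with $a(t_0)=a_0$, $a'(t_0)=p_0$ and $(a,a')\in\mathcal D$ on $\mathbb R$, whose reconstruction (with parameters $c,\varepsilon,\sigma$) has the prescribed first warp $\ell_1$. The second warp is positive and smooth, and the phases are unique up to additive constants. The resulting source metric is complete if both factors $(M_1,g_1)$, $(M_2,g_2)$ are complete.
   Context: Setting. For $i=1,2$, $(M_i,g_i)$ is a Riemannian manifold of dimension $k_i>0$, and $f_i:(M_i,g_i)\to\mathbb S^{2n_i+1}\subset\mathbb C^{n_i+1}$ (unit round sphere) is an eigenmap: $\Delta f_i=-d_if_i$ with $d_i=|df_i|^2>0$ constant. Reconstruction. Given $c\in\mathbb R$, $\varepsilon>0$, $\sigma\in\{\pm1\}$ and a smooth $a:\mathbb R\to(0,1)$ with $R:=1-a^2-(a')^2>0$, set $Q=1+(c^2-1)a^2$, $b=\sqrt{1-a^2}$, $F=\sqrt{\varepsilon Q/(a^2R)}$, $T=\frac1{a^2Q}-\frac{a+a''}{aR}$; let $(\ell_1,\ell_2)$ be the unique pair of positive functions with $\ell_1^{k_1}\ell_2^{k_2}=F$ and $d_2/\ell_2^2-d_1/\ell_1^2=T$ (first and second warp); and choose phases with $s_1'=\sigma\sqrt\varepsilon/(Fa^2)$,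 $s_2'=\sigma c\sqrt\varepsilon/(Fb^2)$. The reconstruction is the map $G=(ae^{is_1}f_1,be^{is_2}f_2)$ together with the source metric $g=dt^2+\ell_1^2g_1+\ell_2^2g_2$ on $\mathbb R\times M_1\times M_2$; $G$ is harmonic for $g$ and its profile $(ae^{is_1},be^{is_2})$ has unit speed. *)

theory Defs
  imports "HOL-Analysis.Analysis"
begin

section \<open>Smooth maps between Euclidean spaces\<close>

text \<open>Meant for open sets \<open>S\<close>. The derivatives of order \<open>\<le> n\<close> are iterated directional
  derivatives, each required to be (Frechet) differentiable before it is differentiated again.\<close>

primrec k_differentiable_on ::
  "nat \<Rightarrow> 'e::euclidean_space set \<Rightarrow> ('e \<Rightarrow> 'f::real_normed_vector) \<Rightarrow> bool" where
  "k_differentiable_on 0 S f \<longleftrightarrow> continuous_on S f"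
| "k_differentiable_on (Suc n) S f \<longleftrightarrow>
     (\<forall>x\<in>S. f differentiable (at x)) \<and>
     (\<forall>v. k_differentiable_on n S (\<lambda>x. frechet_derivative f (at x) v))"

definition smooth_on :: "'e::euclidean_space set \<Rightarrow> ('e \<Rightarrow> 'f::real_normed_vector) \<Rightarrow> bool" where
  "smooth_on S f \<longleftrightarrow> (\<forall>n. k_differentiable_on n S f)"


section \<open>Riemannian manifolds\<close>

text \<open>A Riemannian manifold is a Hausdorff, second countable type \<open>'a\<close> together with an atlas
  modelled on the Euclidean space \<open>'e\<close> (so its dimension is \<open>DIM('e)\<close>). The metric tensor is
  recorded by its components: each chart \<open>c\<close> carries, for every point \<open>y\<close> of its image, the inner
  product \<open>chart_metric c y\<close> of tangent vectors written in the coordinates of \<open>c\<close>. That these local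
  expressions define one tensor field is the transformation law in \<open>riemannian_manifold\<close>.
  The atlas need not be maximal, and the manifold need not be connected.\<close>

record ('a, 'e) rchart =
  chart_dom :: "'a set"
  chart_map :: "'a \<Rightarrow> 'e"
  chart_metric :: "'e \<Rightarrow> 'e \<Rightarrow> 'e \<Rightarrow> real"

definition chart_im :: "('a, 'e) rchart \<Rightarrow> 'e set" where
  "chart_im c = chart_map c ` chart_dom c"

definition chart_inv :: "('a, 'e) rchart \<Rightarrow> 'e \<Rightarrow> 'a" where
  "chart_inv c = inv_into (chart_dom c) (chart_map c)"

definition transition :: "('a, 'e) rchart \<Rightarrow> ('a, 'e) rchart \<Rightarrow> 'e \<Rightarrow> 'e" where
  "transition c c' = chart_map c' \<circ> chart_inv c"

definition riemannian_manifold ::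
  "('a::{t2_space,second_countable_topology}, 'e::euclidean_space) rchart set \<Rightarrow> bool" where
  "riemannian_manifold A \<longleftrightarrow>
     (\<Union>c\<in>A. chart_dom c) = UNIV \<and>
     (\<forall>c\<in>A. open (chart_dom c) \<and> open (chart_im c) \<and>
        homeomorphism (chart_dom c) (chart_im c) (chart_map c) (chart_inv c)) \<and>
     (\<forall>c\<in>A. \<forall>c'\<in>A. smooth_on (chart_map c ` (chart_dom c \<inter> chart_dom c')) (transition c c')) \<and>
     (\<forall>c\<in>A. (\<forall>v w. smooth_on (chart_im c) (\<lambda>y. chart_metric c y v w)) \<and>
        (\<forall>y\<in>chart_im c. bilinear (chart_metric c y) \<and>
           (\<forall>v w. chart_metric c y v w = chart_metric c y w v) \<and>
           (\<forall>v. v \<noteq> 0 \<longrightarrow> chart_metric c y v v > 0))) \<and>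
     (\<forall>c\<in>A. \<forall>c'\<in>A. \<forall>y\<in>chart_map c ` (chart_dom c \<inter> chart_dom c'). \<forall>v w.
        chart_metric c y v w =
          chart_metric c' (transition c c' y)
            (frechet_derivative (transition c c') (at y) v)
            (frechet_derivative (transition c c') (at y) w))"


subsection \<open>Riemannian distance and completeness\<close>

text \<open>As in the library's \<open>piecewise_C1_differentiable_on\<close>, a piecewise \<open>C1\<close> curve is continuous
  and is \<open>C1\<close> off a finite set of parameters (which may contain the endpoints).\<close>

definition piecewise_C1_curve ::
  "('a::topological_space, 'e::real_normed_vector) rchart set \<Rightarrow> (real \<Rightarrow> 'a) \<Rightarrow> bool" where
  "piecewise_C1_curve A \<gamma> \<longleftrightarrow> path \<gamma> \<and>
     (\<exists>S. finite S \<and>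
        (\<forall>c\<in>A. (chart_map c \<circ> \<gamma>) C1_differentiable_on ({0..1} \<inter> \<gamma> -` chart_dom c - S)))"

text \<open>By the transformation law, the speed does not depend on the chart that is selected.\<close>

definition curve_speed :: "('a, 'e::real_normed_vector) rchart set \<Rightarrow> (real \<Rightarrow> 'a) \<Rightarrow> real \<Rightarrow> real" where
  "curve_speed A \<gamma> t =
     (let c = (SOME c. c \<in> A \<and> \<gamma> t \<in> chart_dom c);
          v = vector_derivative (chart_map c \<circ> \<gamma>) (at t)
      in sqrt (chart_metric c (chart_map c (\<gamma> t)) v v))"

definition curve_length :: "('a, 'e::real_normed_vector) rchart set \<Rightarrow> (real \<Rightarrow> 'a) \<Rightarrow> ennreal" where
  "curve_length A \<gamma> = (\<integral>\<^sup>+t\<in>{0..1}. ennreal (curve_speed A \<gamma> t) \<partial>lborel)"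

text \<open>Infinite when the points lie in different components.\<close>

definition riemannian_dist ::
  "('a::topological_space, 'e::real_normed_vector) rchart set \<Rightarrow> 'a \<Rightarrow> 'a \<Rightarrow> ennreal" where
  "riemannian_dist A x y =
     (INF \<gamma>\<in>{\<gamma>. piecewise_C1_curve A \<gamma> \<and> pathstart \<gamma> = x \<and> pathfinish \<gamma> = y}. curve_length A \<gamma>)"

definition riemannian_complete ::
  "('a::topological_space, 'e::real_normed_vector) rchart set \<Rightarrow> bool" where
  "riemannian_complete A \<longleftrightarrow>
     (\<forall>X :: nat \<Rightarrow> 'a.
        (\<forall>e>0. \<exists>N. \<forall>m\<ge>N. \<forall>n\<ge>N. riemannian_dist A (X m) (X n) < e) \<longrightarrow>
        (\<exists>x. (\<lambda>n. riemannian_dist A (X n) x) \<longlonglongrightarrow> 0))"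


subsection \<open>Eigenmaps into spheres\<close>

definition gram :: "('a, real^'k) rchart \<Rightarrow> real^'k \<Rightarrow> real^'k^'k" where
  "gram c y = (\<chi> i j. chart_metric c y (axis i 1) (axis j 1))"

definition partial_deriv :: "'k \<Rightarrow> (real^'k \<Rightarrow> 'v::real_normed_vector) \<Rightarrow> real^'k \<Rightarrow> 'v" where
  "partial_deriv i u y = frechet_derivative u (at y) (axis i 1)"

text \<open>The Laplace-Beltrami operator
  \<open>1/sqrt(det g) * sum i. d_i (sqrt(det g) * sum j. g^ij * d_j f)\<close>
  (sign convention: nonpositive operator), acting componentwise on vector-valued functions.\<close>

definition laplacian ::
  "('a, real^'k) rchart \<Rightarrow> ('a \<Rightarrow> 'v::real_normed_vector) \<Rightarrow> 'a \<Rightarrow> 'v" where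
  "laplacian c f x =
     (let y = chart_map c x; u = f \<circ> chart_inv c; vol = (\<lambda>z. sqrt (det (gram c z)))
      in (1 / vol y) *\<^sub>R
           (\<Sum>i\<in>UNIV. partial_deriv i
              (\<lambda>z. vol z *\<^sub>R (\<Sum>j\<in>UNIV. (matrix_inv (gram c z) $ i $ j) *\<^sub>R partial_deriv j u z)) y))"

text \<open>The squared norm \<open>|df|^2\<close> (the trace of the pulled back inner product).\<close>

definition energy_density ::
  "('a, real^'k) rchart \<Rightarrow> ('a \<Rightarrow> 'v::real_inner) \<Rightarrow> 'a \<Rightarrow> real" where
  "energy_density c f x =
     (let y = chart_map c x; u = f \<circ> chart_inv c
      in \<Sum>i\<in>UNIV. \<Sum>j\<in>UNIV.
           (matrix_inv (gram c y) $ i $ j) * (partial_deriv i u y \<bullet> partial_deriv j u y))"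

text \<open>The target is the unit sphere of \<open>complex^'n\<close>, i.e. the sphere of dimension
  \<open>2 * CARD('n) - 1\<close>.\<close>

definition eigenmap :: "('a, real^'k) rchart set \<Rightarrow> ('a \<Rightarrow> complex^'n) \<Rightarrow> real \<Rightarrow> bool" where
  "eigenmap A f d \<longleftrightarrow>
     0 < d \<and> range f \<subseteq> sphere 0 1 \<and>
     (\<forall>c\<in>A. smooth_on (chart_im c) (f \<circ> chart_inv c) \<and>
        (\<forall>x\<in>chart_dom c. laplacian c f x = - d *\<^sub>R f x \<and> energy_density c f x = d))"


section \<open>The reconstruction\<close>

definition profile_domain :: "(real \<times> real) set" where
  "profile_domain = {(a, p). 0 < a \<and> a < 1 \<and> 1 - a\<^sup>2 - p\<^sup>2 > 0}"

definition rec_R :: "(real \<Rightarrow> real) \<Rightarrow> real \<Rightarrow> real" where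
  "rec_R a t = 1 - (a t)\<^sup>2 - (deriv a t)\<^sup>2"

definition rec_Q :: "real \<Rightarrow> (real \<Rightarrow> real) \<Rightarrow> real \<Rightarrow> real" where
  "rec_Q c a t = 1 + (c\<^sup>2 - 1) * (a t)\<^sup>2"

definition rec_b :: "(real \<Rightarrow> real) \<Rightarrow> real \<Rightarrow> real" where
  "rec_b a t = sqrt (1 - (a t)\<^sup>2)"

definition rec_F :: "real \<Rightarrow> real \<Rightarrow> (real \<Rightarrow> real) \<Rightarrow> real \<Rightarrow> real" where
  "rec_F c \<epsilon> a t = sqrt (\<epsilon> * rec_Q c a t / ((a t)\<^sup>2 * rec_R a t))"

definition rec_T :: "real \<Rightarrow> (real \<Rightarrow> real) \<Rightarrow> real \<Rightarrow> real" where
  "rec_T c a t =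
     1 / ((a t)\<^sup>2 * rec_Q c a t) - (a t + deriv (deriv a) t) / (a t * rec_R a t)"

definition warp_pair ::
  "nat \<Rightarrow> nat \<Rightarrow> real \<Rightarrow> real \<Rightarrow> (real \<Rightarrow> real) \<Rightarrow> (real \<Rightarrow> real) \<Rightarrow>
   (real \<Rightarrow> real) \<times> (real \<Rightarrow> real) \<Rightarrow> bool" where
  "warp_pair k\<^sub>1 k\<^sub>2 d\<^sub>1 d\<^sub>2 F T = (\<lambda>(l\<^sub>1, l\<^sub>2). \<forall>t.
     0 < l\<^sub>1 t \<and> 0 < l\<^sub>2 t \<and> l\<^sub>1 t ^ k\<^sub>1 * l\<^sub>2 t ^ k\<^sub>2 = F t \<and>
     d\<^sub>2 / (l\<^sub>2 t)\<^sup>2 - d\<^sub>1 / (l\<^sub>1 t)\<^sup>2 = T t)"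

text \<open>The description below is meaningful whenever \<open>F\<close> is positive; see \<open>ex1_warp_pair\<close>.\<close>

definition warps ::
  "nat \<Rightarrow> nat \<Rightarrow> real \<Rightarrow> real \<Rightarrow> real \<Rightarrow> real \<Rightarrow> (real \<Rightarrow> real) \<Rightarrow>
   (real \<Rightarrow> real) \<times> (real \<Rightarrow> real)" where
  "warps k\<^sub>1 k\<^sub>2 d\<^sub>1 d\<^sub>2 c \<epsilon> a = (THE l. warp_pair k\<^sub>1 k\<^sub>2 d\<^sub>1 d\<^sub>2 (rec_F c \<epsilon> a) (rec_T c a) l)"

definition first_warp ::
  "nat \<Rightarrow> nat \<Rightarrow> real \<Rightarrow> real \<Rightarrow> real \<Rightarrow> real \<Rightarrow> (real \<Rightarrow> real) \<Rightarrow> real \<Rightarrow> real" where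
  "first_warp k\<^sub>1 k\<^sub>2 d\<^sub>1 d\<^sub>2 c \<epsilon> a = fst (warps k\<^sub>1 k\<^sub>2 d\<^sub>1 d\<^sub>2 c \<epsilon> a)"

definition second_warp ::
  "nat \<Rightarrow> nat \<Rightarrow> real \<Rightarrow> real \<Rightarrow> real \<Rightarrow> real \<Rightarrow> (real \<Rightarrow> real) \<Rightarrow> real \<Rightarrow> real" where
  "second_warp k\<^sub>1 k\<^sub>2 d\<^sub>1 d\<^sub>2 c \<epsilon> a = snd (warps k\<^sub>1 k\<^sub>2 d\<^sub>1 d\<^sub>2 c \<epsilon> a)"

definition phases ::
  "real \<Rightarrow> real \<Rightarrow> real \<Rightarrow> (real \<Rightarrow> real) \<Rightarrow> (real \<Rightarrow> real) \<Rightarrow> (real \<Rightarrow> real) \<Rightarrow> bool" where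
  "phases c \<epsilon> \<sigma> a s\<^sub>1 s\<^sub>2 \<longleftrightarrow> (\<forall>t.
     (s\<^sub>1 has_real_derivative \<sigma> * sqrt \<epsilon> / (rec_F c \<epsilon> a t * (a t)\<^sup>2)) (at t) \<and>
     (s\<^sub>2 has_real_derivative \<sigma> * c * sqrt \<epsilon> / (rec_F c \<epsilon> a t * (rec_b a t)\<^sup>2)) (at t))"

definition join_map ::
  "(real \<Rightarrow> real) \<Rightarrow> (real \<Rightarrow> real) \<Rightarrow> (real \<Rightarrow> real) \<Rightarrow> ('a \<Rightarrow> complex^'n) \<Rightarrow> ('b \<Rightarrow> complex^'m) \<Rightarrow>
   real \<times> 'a \<times> 'b \<Rightarrow> (complex^'n) \<times> (complex^'m)" where
  "join_map a s\<^sub>1 s\<^sub>2 f\<^sub>1 f\<^sub>2 = (\<lambda>(t, x\<^sub>1, x\<^sub>2).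
     ((complex_of_real (a t) * exp (\<i> * complex_of_real (s\<^sub>1 t))) *s f\<^sub>1 x\<^sub>1,
      (complex_of_real (rec_b a t) * exp (\<i> * complex_of_real (s\<^sub>2 t))) *s f\<^sub>2 x\<^sub>2))"

text \<open>The metric \<open>dt^2 + l1(t)^2 g1 + l2(t)^2 g2\<close>, written in products of charts.\<close>

definition warped_chart ::
  "(real \<Rightarrow> real) \<Rightarrow> (real \<Rightarrow> real) \<Rightarrow> ('a, 'e) rchart \<Rightarrow> ('b, 'f) rchart \<Rightarrow>
   (real \<times> 'a \<times> 'b, real \<times> 'e \<times> 'f) rchart" where
  "warped_chart l\<^sub>1 l\<^sub>2 c\<^sub>1 c\<^sub>2 =
     \<lparr>chart_dom = UNIV \<times> chart_dom c\<^sub>1 \<times> chart_dom c\<^sub>2,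
      chart_map = (\<lambda>(t, x\<^sub>1, x\<^sub>2). (t, chart_map c\<^sub>1 x\<^sub>1, chart_map c\<^sub>2 x\<^sub>2)),
      chart_metric = (\<lambda>(t, y\<^sub>1, y\<^sub>2) (\<tau>, v\<^sub>1, v\<^sub>2) (\<tau>', w\<^sub>1, w\<^sub>2).
        \<tau> * \<tau>' + (l\<^sub>1 t)\<^sup>2 * chart_metric c\<^sub>1 y\<^sub>1 v\<^sub>1 w\<^sub>1 + (l\<^sub>2 t)\<^sup>2 * chart_metric c\<^sub>2 y\<^sub>2 v\<^sub>2 w\<^sub>2)\<rparr>"

definition warped_metric ::
  "(real \<Rightarrow> real) \<Rightarrow> (real \<Rightarrow> real) \<Rightarrow> ('a, 'e) rchart set \<Rightarrow> ('b, 'f) rchart set \<Rightarrow>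
   (real \<times> 'a \<times> 'b, real \<times> 'e \<times> 'f) rchart set" where
  "warped_metric l\<^sub>1 l\<^sub>2 A\<^sub>1 A\<^sub>2 = {warped_chart l\<^sub>1 l\<^sub>2 c\<^sub>1 c\<^sub>2 | c\<^sub>1 c\<^sub>2. c\<^sub>1 \<in> A\<^sub>1 \<and> c\<^sub>2 \<in> A\<^sub>2}"

text \<open>All pairs (map, source metric) obtained from the magnitude function \<open>a\<close>, one for each
  choice of phases.\<close>

definition reconstructions ::
  "('a, real^'k) rchart set \<Rightarrow> ('a \<Rightarrow> complex^'n) \<Rightarrow> real \<Rightarrow>
   ('b, real^'l) rchart set \<Rightarrow> ('b \<Rightarrow> complex^'m) \<Rightarrow> real \<Rightarrow>
   real \<Rightarrow> real \<Rightarrow> real \<Rightarrow> (real \<Rightarrow> real) \<Rightarrow>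
   ((real \<times> 'a \<times> 'b \<Rightarrow> (complex^'n) \<times> (complex^'m)) \<times>
    (real \<times> 'a \<times> 'b, real \<times> (real^'k) \<times> (real^'l)) rchart set) set" where
  "reconstructions A\<^sub>1 f\<^sub>1 d\<^sub>1 A\<^sub>2 f\<^sub>2 d\<^sub>2 c \<epsilon> \<sigma> a =
     {(join_map a s\<^sub>1 s\<^sub>2 f\<^sub>1 f\<^sub>2,
       warped_metric (first_warp CARD('k) CARD('l) d\<^sub>1 d\<^sub>2 c \<epsilon> a)
         (second_warp CARD('k) CARD('l) d\<^sub>1 d\<^sub>2 c \<epsilon> a) A\<^sub>1 A\<^sub>2) | s\<^sub>1 s\<^sub>2. phases c \<epsilon> \<sigma> a s\<^sub>1 s\<^sub>2}"


subsection \<open>Well-definedness of the warps\<close>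

lemma ex_warp_values:
  fixes d1 d2 F T :: real
  assumes "0 < k1" "0 < k2" "0 < d1" "0 < d2" "0 < F"
  shows "\<exists>x y. 0 < x \<and> 0 < y \<and> x ^ k1 * y ^ k2 = F \<and> d2 / y\<^sup>2 - d1 / x\<^sup>2 = T"
proof -
  define \<alpha> where "\<alpha> = 2 * real k1 / real k2"
  define \<beta> where "\<beta> = 2 * ln F / real k2"
  define h where "h u = d2 * exp (\<alpha> * u - \<beta>) - d1 * exp (- 2 * u)" for u :: real
  have \<alpha>: "\<alpha> > 0" using assms by (simp add: \<alpha>_def)
  define u1 where "u1 = max 0 (((T + d1) / d2 + \<beta>) / \<alpha>)"
  define w where "w = max 0 ((d2 * exp (- \<beta>) - T) / (2 * d1))"
  have up: "T \<le> h u1"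
  proof -
    have "((T + d1) / d2 + \<beta>) / \<alpha> \<le> u1" by (simp add: u1_def)
    then have "(T + d1) / d2 \<le> \<alpha> * u1 - \<beta>" using \<alpha> by (simp add: field_simps)
    also have "\<dots> \<le> exp (\<alpha> * u1 - \<beta>)" using exp_ge_add_one_self[of "\<alpha> * u1 - \<beta>"] by linarith
    finally have "T + d1 \<le> d2 * exp (\<alpha> * u1 - \<beta>)" using assms by (simp add: field_simps)
    moreover have "d1 * exp (- 2 * u1) \<le> d1" using assms by (simp add: u1_def)
    ultimately show ?thesis by (simp add: h_def)
  qed
  have lo: "h (- w) \<le> T"
  proof -
    have w0: "0 \<le> w" by (simp add: w_def)
    have "(d2 * exp (- \<beta>) - T) / (2 * d1) \<le> w" by (simp add: w_def)
    then have "d2 * exp (- \<beta>) - T \<le> d1 * (2 * w)" using assms by (simp add: field_simps)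
    also have "\<dots> \<le> d1 * exp (2 * w)"
      using exp_ge_add_one_self[of "2 * w"] assms by (intro mult_left_mono) linarith+
    finally have "d2 * exp (- \<beta>) - T \<le> d1 * exp (2 * w)" .
    moreover have "d2 * exp (\<alpha> * (- w) - \<beta>) \<le> d2 * exp (- \<beta>)" using assms w0 \<alpha> by simp
    ultimately show ?thesis by (simp add: h_def)
  qed
  have "- w \<le> u1" by (simp add: w_def u1_def)
  moreover have "continuous_on {- w..u1} h" unfolding h_def by (intro continuous_intros)
  ultimately obtain u where u: "h u = T" using IVT'[of h "- w" T u1] lo up by blast
  define x where "x = exp u"
  define y where "y = exp ((ln F - real k1 * u) / real k2)"
  have "x ^ k1 * y ^ k2 = exp (real k1 * u + real k2 * ((ln F - real k1 * u) / real k2))"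
    by (simp only: x_def y_def exp_add exp_of_nat_mult)
  also have "\<dots> = F" using assms by simp
  finally have 1: "x ^ k1 * y ^ k2 = F" .
  have "1 / y\<^sup>2 = exp (\<alpha> * u - \<beta>)"
  proof -
    have "1 / y\<^sup>2 = exp (- (2 * ((ln F - real k1 * u) / real k2)))"
      unfolding y_def exp_minus exp_double by (simp only: inverse_eq_divide)
    also have "- (2 * ((ln F - real k1 * u) / real k2)) = \<alpha> * u - \<beta>"
      using assms by (simp add: \<alpha>_def \<beta>_def field_simps)
    finally show ?thesis .
  qed
  moreover have "1 / x\<^sup>2 = exp (- 2 * u)"
    by (simp add: x_def exp_double exp_minus inverse_eq_divide)
  ultimately have "d2 / y\<^sup>2 - d1 / x\<^sup>2 = h u"
    unfolding h_def by (simp only: divide_inverse mult_1_left)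
  with 1 u show ?thesis by (intro exI[of _ x] exI[of _ y]) (simp add: x_def y_def)
qed

lemma warp_values_le:
  fixes d1 d2 F T :: real
  assumes "0 < k2" "0 < d1" "0 < d2"
    and "0 < x" "0 < y" "x ^ k1 * y ^ k2 = F" "d2 / y\<^sup>2 - d1 / x\<^sup>2 = T"
    and "0 < x'" "0 < y'" "x' ^ k1 * y' ^ k2 = F" "d2 / y'\<^sup>2 - d1 / x'\<^sup>2 = T"
  shows "x' \<le> x"
proof (rule ccontr)
  assume "\<not> x' \<le> x"
  then have x: "x < x'" by simp
  have "y' \<le> y"
  proof (rule ccontr)
    assume "\<not> y' \<le> y"
    then have "y ^ k2 < y' ^ k2" using assms by (simp add: power_strict_mono)
    moreover have "x ^ k1 \<le> x' ^ k1" using assms x by (simp add: power_mono)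
    ultimately have "x ^ k1 * y ^ k2 < x' ^ k1 * y' ^ k2"
      using assms by (intro mult_le_less_imp_less) auto
    then show False using assms by simp
  qed
  then have "d2 / y\<^sup>2 \<le> d2 / y'\<^sup>2" using assms by (simp add: frac_le power_mono)
  moreover have "d1 / x'\<^sup>2 < d1 / x\<^sup>2"
    using assms x by (simp add: divide_strict_left_mono power_strict_mono)
  ultimately show False using assms by linarith
qed

lemma ex1_warp_pair:
  assumes "0 < k1" "0 < k2" "0 < d1" "0 < d2" "\<And>t. 0 < F t"
  shows "\<exists>!l. warp_pair k1 k2 d1 d2 F T l"
proof -
  have "\<forall>t. \<exists>x y. 0 < x \<and> 0 < y \<and> x ^ k1 * y ^ k2 = F t \<and> d2 / y\<^sup>2 - d1 / x\<^sup>2 = T t"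
    using ex_warp_values assms by blast
  then obtain l1 l2 where "\<forall>t. 0 < l1 t \<and> 0 < l2 t \<and> l1 t ^ k1 * l2 t ^ k2 = F t \<and>
      d2 / (l2 t)\<^sup>2 - d1 / (l1 t)\<^sup>2 = T t"
    by metis
  then have l: "warp_pair k1 k2 d1 d2 F T (l1, l2)" by (simp add: warp_pair_def)
  moreover have "l' = (l1, l2)" if l': "warp_pair k1 k2 d1 d2 F T l'" for l'
  proof -
    obtain m1 m2 where m: "l' = (m1, m2)" by fastforce
    have eq: "m1 t = l1 t" for t
    proof (rule antisym)
      show "m1 t \<le> l1 t"
        using warp_values_le[of k2 d1 d2 "l1 t" "l2 t" k1 "F t" "T t" "m1 t" "m2 t"] assms l l'
        by (simp add: warp_pair_def m)
      show "l1 t \<le> m1 t"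
        using warp_values_le[of k2 d1 d2 "m1 t" "m2 t" k1 "F t" "T t" "l1 t" "l2 t"] assms l l'
        by (simp add: warp_pair_def m)
    qed
    have "m2 t = l2 t" for t
    proof -
      have "l1 t ^ k1 * m2 t ^ k2 = l1 t ^ k1 * l2 t ^ k2" "0 < l1 t" "0 < l2 t" "0 < m2 t"
        using l l' by (auto simp: warp_pair_def m simp flip: eq)
      then have "m2 t ^ k2 = l2 t ^ k2" by simp
      then show ?thesis
        using power_eq_imp_eq_base[of "m2 t" k2 "l2 t"] \<open>0 < l2 t\<close> \<open>0 < m2 t\<close> assms by simp
    qed
    with eq show ?thesis by (auto simp: m)
  qed
  ultimately show ?thesis by blast
qed

end

theory Submission
  imports Defs
begin

text \<open>With \<open>l1\<close> prescribed, the product equation for the warps gives \<open>l2\<close> in terms of \<open>(a, a')\<close>, and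
  the difference equation becomes a second order equation for \<open>a\<close>, locally Lipschitz on \<open>profile_domain\<close>.
  Put \<open>W = a^2 R / Q = \<epsilon> / F^2\<close>. Along solutions
  \<open>(ln W)' = - 2 a a' (d1 / l1^2 - d2 / l2^2)\<close>, where \<open>1 / l2^2\<close> is an increasing function of \<open>W\<close>
  and \<open>W\<close> is bounded because \<open>c \<noteq> 0\<close>. Hence \<open>ln W\<close> changes at a bounded rate on bounded time
  intervals; as \<open>W \<longrightarrow> 0\<close> at the boundary of \<open>profile_domain\<close>, solutions stay in compact subsets and
  are global. For completeness, a curve that is short in the warped metric stays where \<open>l1\<close> and \<open>l2\<close>
  are bounded below, so Cauchy sequences project to Cauchy sequences in \<open>\<real>\<close> and in both factors.\<close>

section \<open>Global solutions of ordinary differential equations\<close>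

text \<open>The field cannot be extended past \<open>profile_domain\<close>: it contains
  \<open>R / (a * Q)\<close>, unbounded as \<open>a\<close> tends to 0, and \<open>1 / l2^2\<close>
  is a time dependent multiple of the \<open>k2\<close>-th root of \<open>W\<close>, not Lipschitz
  at \<open>W = 0\<close> once \<open>k2 > 1\<close>. What makes \<open>W\<close> the right quantity
  is that the singular term \<open>R / (a * Q)\<close> drops out of \<open>(ln W)'\<close>, so that
  only the two warp terms are left to estimate. The condition on \<open>c\<close> enters through
  \<open>Q\<close>, a convex combination of 1 and \<open>c^2\<close> and hence at least
  \<open>min 1 (c^2)\<close>. For \<open>c = 0\<close> one would have \<open>Q = 1 - a^2\<close>,
  and \<open>W\<close> would not tend to 0 at the boundary point \<open>(1, 0)\<close>. Global
  existence avoids maximal intervals: the field is modified outside a compact set by closest point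
  projection, the modified equation is solved for all times, and the a priori bound shows that the
  modification was never seen. Projection needs convexity, which is not evident for the sets
  \<open>W \<ge> \<omega>\<close>. They are therefore enclosed in discs cut by a half plane.\<close>

lemma antiderivative_exists:
  fixes f :: "real \<Rightarrow> 'a::euclidean_space"
  assumes "continuous_on UNIV f"
  shows "\<exists>G. G t0 = 0 \<and> (\<forall>t. (G has_vector_derivative f t) (at t))"
proof (intro exI[of _ "\<lambda>u::real. LBINT y=t0..u. f y"] conjI allI)
  let ?G = "\<lambda>u::real. LBINT y=t0..u. f y"
  show "?G t0 = 0" by simp
  fix t
  \<comment> \<open>The margin 1 puts \<open>t\<close> in the interior of the interval, so that the
    derivative within it is the full derivative.\<close>
  define a b where "a = min t t0 - 1" and "b = max t t0 + 1"
  have "(?G has_vector_derivative f t) (at t within {a..b})"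
    by (rule interval_integral_FTC2)
      (auto simp: a_def b_def intro: continuous_on_subset[OF assms])
  moreover have "at t within {a..b} = at t"
    by (rule at_within_interior) (auto simp: a_def b_def)
  ultimately show "(?G has_vector_derivative f t) (at t)" by simp
qed

text \<open>Integrating the exponential weight gains a factor \<open>1 / k\<close>. With
  \<open>k = 2 * L\<close> this becomes the contraction constant 1/2 of the Picard operator below,
  and it also keeps the image of that operator bounded in the weighted norm.\<close>

lemma norm_le_exp_of_deriv:
  fixes G :: "real \<Rightarrow> 'a::real_normed_vector"
  assumes G: "\<And>t. (G has_vector_derivative g t) (at t)" "G t0 = 0"
    and g: "\<And>t. norm (g t) \<le> C * exp (k * \<bar>t - t0\<bar>)" and k: "0 < k"
  shows "norm (G t) \<le> C / k * exp (k * \<bar>t - t0\<bar>)"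
proof -
  have C: "0 \<le> C" using order_trans[OF norm_ge_zero g[of t0]] by simp
  have cG: "continuous_on S G" for S
    using G(1) by (meson continuous_at_imp_continuous_on has_vector_derivative_continuous)
  consider "t = t0" | "t0 < t" | "t < t0" by linarith
  then show ?thesis
  proof cases
    case 1
    then show ?thesis using C k G by simp
  next
    case 2
    define \<phi> where "\<phi> s = C / k * exp (k * (s - t0))" for s
    have d: "(\<phi> has_vector_derivative C * exp (k * (s - t0))) (at s)" for s
      unfolding \<phi>_def has_real_derivative_iff_has_vector_derivative[symmetric]
      using k by (auto intro!: derivative_eq_intros)
    have "norm (G t - G t0) \<le> \<phi> t - \<phi> t0"
    proof (rule differentiable_bound_general[OF 2 cG _ G(1) d])
      show "continuous_on {t0..t} \<phi>" unfolding \<phi>_def by (intro continuous_intros)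
      show "norm (g s) \<le> C * exp (k * (s - t0))" if "t0 < s" for s
        using g[of s] that by simp
    qed
    also have "\<dots> \<le> \<phi> t" using C k by (simp add: \<phi>_def)
    finally show ?thesis using 2 G(2) by (simp add: \<phi>_def)
  next
    case 3
    \<comment> \<open>To the left of \<open>t0\<close> the weight decreases in \<open>s\<close>, so
      the primitive of the bound carries a minus sign.\<close>
    define \<phi> where "\<phi> s = - (C / k * exp (k * (t0 - s)))" for s
    have d: "(\<phi> has_vector_derivative C * exp (k * (t0 - s))) (at s)" for s
      unfolding \<phi>_def has_real_derivative_iff_has_vector_derivative[symmetric]
      using k by (auto intro!: derivative_eq_intros)
    have "norm (G t0 - G t) \<le> \<phi> t0 - \<phi> t"
    proof (rule differentiable_bound_general[OF 3 cG _ G(1) d])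
      show "continuous_on {t..t0} \<phi>" unfolding \<phi>_def by (intro continuous_intros)
      show "norm (g s) \<le> C * exp (k * (t0 - s))" if "s < t0" for s
        using g[of s] that by simp
    qed
    also have "\<dots> \<le> - \<phi> t" using C k by (simp add: \<phi>_def)
    finally show ?thesis using 3 G(2) by (simp add: \<phi>_def)
  qed
qed

text \<open>The Picard operator contracts the norm \<open>sup t. exp (- 2 L \<bar>t - t0\<bar>) \<bar>z t\<bar>\<close>, so that a
  single application of Banach's theorem gives a solution on the whole line.\<close>

lemma ex_solution_lipschitz:
  fixes F :: "real \<Rightarrow> 'a::euclidean_space \<Rightarrow> 'a"
  assumes cont: "continuous_on UNIV (\<lambda>(t, z). F t z)"
    and bound: "\<And>t z. norm (F t z) \<le> M"
    and lip: "\<And>t. L-lipschitz_on UNIV (F t)" and L: "0 < L"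
  shows "\<exists>z. z t0 = z0 \<and> (\<forall>t. (z has_vector_derivative F t (z t)) (at t))"
proof -
  \<comment> \<open>The unknown is written as \<open>e t\<close> times a bounded continuous
    \<open>u\<close>. This turns the weighted norm into the plain sup norm of
    \<open>bcontfun\<close>, whose completeness is available.\<close>
  define e where "e t = exp (2 * L * \<bar>t - t0\<bar>)" for t
  define rhs where "rhs u s = F s (e s *\<^sub>R apply_bcontfun u s)" for u :: "real \<Rightarrow>\<^sub>C 'a" and s
  have e_pos: "0 < e t" for t by (simp add: e_def)
  have M: "0 \<le> M" using bound[of 0 0] norm_ge_zero by (rule order_trans[rotated])
  have cont_rhs: "continuous_on UNIV (rhs u)" for u
  proof -
    have "continuous_on UNIV (\<lambda>s. (\<lambda>(t, z). F t z) (s, e s *\<^sub>R apply_bcontfun u s))"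
      unfolding e_def by (intro continuous_on_compose2[OF cont] continuous_intros) auto
    then show ?thesis by (simp add: rhs_def[abs_def])
  qed
  have "\<exists>J. \<forall>u. J u t0 = 0 \<and> (\<forall>t. (J u has_vector_derivative rhs u t) (at t))"
    by (rule choice) (use antiderivative_exists[OF cont_rhs] in blast)
  then obtain J where J0: "\<And>u. J u t0 = 0"
    and J: "\<And>u t. (J u has_vector_derivative rhs u t) (at t)" by blast
  define T where "T u t = (1 / e t) *\<^sub>R (z0 + J u t)" for u t
  have T_bcont: "T u \<in> bcontfun" for u
  proof (rule bcontfun_normI)
    have "continuous_on UNIV (J u)"
      using J by (meson continuous_at_imp_continuous_on has_vector_derivative_continuous)
    then show "continuous_on UNIV (T u)"
      unfolding T_def e_def by (intro continuous_intros) auto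
    fix t
    have "norm (J u t) \<le> M / (2 * L) * e t"
      unfolding e_def
    proof (rule norm_le_exp_of_deriv[OF J J0])
      fix t
      have "norm (rhs u t) \<le> M * 1" by (simp add: rhs_def bound)
      also have "\<dots> \<le> M * exp (2 * L * \<bar>t - t0\<bar>)"
        using L M by (intro mult_left_mono) auto
      finally show "norm (rhs u t) \<le> M * exp (2 * L * \<bar>t - t0\<bar>)" .
    qed (use L in simp)
    moreover have "norm z0 \<le> norm z0 * e t"
      using L by (simp add: e_def mult_le_cancel_left1)
    ultimately have "norm (z0 + J u t) \<le> (norm z0 + M / (2 * L)) * e t"
      by (intro order_trans[OF norm_triangle_ineq]) (simp add: algebra_simps)
    then show "norm (T u t) \<le> norm z0 + M / (2 * L)"
      using e_pos[of t] by (simp add: T_def divide_le_eq)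
  qed
  define \<Phi> where "\<Phi> u = Bcontfun (T u)" for u
  have \<Phi>: "apply_bcontfun (\<Phi> u) = T u" for u
    using T_bcont by (simp add: \<Phi>_def Bcontfun_inverse)
  have "dist (\<Phi> u) (\<Phi> v) \<le> 1/2 * dist u v" for u v
  proof (rule dist_bound)
    fix t
    have D: "((\<lambda>t. J u t - J v t) has_vector_derivative rhs u t - rhs v t) (at t)" for t
      by (intro derivative_intros J)
    have "norm (J u t - J v t) \<le> (L * dist u v) / (2 * L) * exp (2 * L * \<bar>t - t0\<bar>)"
    proof (rule norm_le_exp_of_deriv[OF D])
      fix s
      have "norm (rhs u s - rhs v s) \<le> L * dist (e s *\<^sub>R u s) (e s *\<^sub>R v s)"
        using lipschitz_onD[OF lip] by (simp add: rhs_def dist_norm)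
      also have "dist (e s *\<^sub>R u s) (e s *\<^sub>R v s) = e s * dist (u s) (v s)"
        using e_pos[of s] by (simp add: dist_norm flip: scaleR_diff_right)
      also have "\<dots> \<le> e s * dist u v"
        using e_pos[of s] by (intro mult_left_mono dist_bounded) auto
      finally show "norm (rhs u s - rhs v s) \<le> L * dist u v * exp (2 * L * \<bar>s - t0\<bar>)"
        using L by (simp add: e_def mult_ac)
    qed (use L J0 in auto)
    also have "\<dots> = 1/2 * dist u v * e t" using L by (simp add: e_def)
    finally show "dist (\<Phi> u t) (\<Phi> v t) \<le> 1/2 * dist u v"
      using e_pos[of t]
      by (simp add: \<Phi> T_def dist_norm divide_le_eq flip: scaleR_diff_right)
  qed
  then have "\<exists>!u. \<Phi> u = u" by (intro banach_fix_type[of "1/2"]) auto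
  then obtain u where u: "\<Phi> u = u" by blast
  define z where "z t = z0 + J u t" for t
  have "z t = e t *\<^sub>R apply_bcontfun u t" for t
    using e_pos[of t] \<Phi>[of u] by (simp add: u T_def z_def)
  then have "rhs u t = F t (z t)" for t by (simp add: rhs_def)
  moreover have "(z has_vector_derivative rhs u t) (at t)" for t
    unfolding z_def by (auto intro!: derivative_eq_intros J)
  ultimately show ?thesis by (intro exI[of _ z]) (auto simp: z_def J0)
qed

text \<open>Gronwall's argument: the squared distance of the two solutions, damped by
  \<open>exp (- k * s)\<close>, cannot grow from its initial value 0. The segment is rescaled to
  \<open>[0, 1]\<close> so that both time directions are one case.\<close>

lemma solution_unique_lipschitz:
  fixes F :: "real \<Rightarrow> 'a::real_inner \<Rightarrow> 'a"
  assumes seg: "\<And>s. s \<in> closed_segment t0 t \<Longrightarrow> L-lipschitz_on X (F s)"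
    and y: "\<And>s. s \<in> closed_segment t0 t \<Longrightarrow> (y has_vector_derivative F s (y s)) (at s) \<and> y s \<in> X"
    and z: "\<And>s. s \<in> closed_segment t0 t \<Longrightarrow> (z has_vector_derivative F s (z s)) (at s) \<and> z s \<in> X"
    and eq: "y t0 = z t0"
  shows "y t = z t"
proof -
  define h where "h = t - t0"
  define w where "w s = y (t0 + s * h) - z (t0 + s * h)" for s
  define w' where "w' s = h *\<^sub>R (F (t0 + s * h) (y (t0 + s * h)) - F (t0 + s * h) (z (t0 + s * h)))" for s
  \<comment> \<open>The Lipschitz estimate gives
    \<open>norm (w' s) \<le> \<bar>h\<bar> * L * norm (w s)\<close>, and the 2 comes from
    differentiating the square.\<close>
  define k where "k = 2 * \<bar>h\<bar> * L"
  define g where "g s = exp (- k * s) * (w s \<bullet> w s)" for s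
  have seg01: "t0 + s * h \<in> closed_segment t0 t" if "0 \<le> s" "s \<le> 1" for s
    using that by (auto simp: in_segment h_def algebra_simps intro!: exI[of _ s])
  have dw: "(w has_vector_derivative w' s) (at s)" if "0 \<le> s" "s \<le> 1" for s
  proof -
    have *: "((\<lambda>s. t0 + s * h) has_vector_derivative h) (at s)"
      by (auto intro!: derivative_eq_intros)
    have "(y has_vector_derivative F (t0 + s * h) (y (t0 + s * h))) (at (t0 + s * h))"
      "(z has_vector_derivative F (t0 + s * h) (z (t0 + s * h))) (at (t0 + s * h))"
      using y z seg01[OF that] by auto
    from vector_diff_chain_at[OF * this(1)] vector_diff_chain_at[OF * this(2)]
    show ?thesis
      unfolding w_def w'_def o_def by (auto intro!: derivative_eq_intros simp: scaleR_diff_right)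
  qed
  have bound: "2 * (w s \<bullet> w' s) \<le> k * (w s \<bullet> w s)" if "0 \<le> s" "s \<le> 1" for s
  proof -
    have "norm (w' s) \<le> \<bar>h\<bar> * (L * norm (w s))"
      using lipschitz_on_normD[OF seg[OF seg01[OF that]]] y z seg01[OF that]
      by (auto simp: w'_def w_def intro!: mult_left_mono)
    then have "norm (w s) * norm (w' s) \<le> norm (w s) * (\<bar>h\<bar> * (L * norm (w s)))"
      by (intro mult_left_mono) auto
    then have "w s \<bullet> w' s \<le> norm (w s) * (\<bar>h\<bar> * (L * norm (w s)))"
      using norm_cauchy_schwarz order_trans by blast
    then show ?thesis
      by (simp add: k_def power2_norm_eq_inner[symmetric] power2_eq_square mult_ac)
  qed
  have "g 1 \<le> g 0"
  proof (rule DERIV_nonpos_imp_nonincreasing[where f = g])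
    fix s :: real assume s: "0 \<le> s" "s \<le> 1"
    have "((\<lambda>s. w s \<bullet> w s) has_vector_derivative w s \<bullet> w' s + w' s \<bullet> w s) (at s)"
      using bounded_bilinear.has_vector_derivative[OF bounded_bilinear_inner dw dw] s by simp
    then have "((\<lambda>s. w s \<bullet> w s) has_real_derivative 2 * (w s \<bullet> w' s)) (at s)"
      by (simp add: has_real_derivative_iff_has_vector_derivative inner_commute)
    then have "(g has_real_derivative exp (- k * s) * (2 * (w s \<bullet> w' s) - k * (w s \<bullet> w s))) (at s)"
      unfolding g_def by (auto intro!: derivative_eq_intros simp: algebra_simps)
    moreover have "exp (- k * s) * (2 * (w s \<bullet> w' s) - k * (w s \<bullet> w s)) \<le> 0"
      using bound[OF s] by (simp add: mult_le_0_iff)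
    ultimately show "\<exists>y. (g has_real_derivative y) (at s) \<and> y \<le> 0" by blast
  qed simp
  moreover have "g 0 = 0" by (simp add: g_def w_def eq)
  ultimately have "w 1 \<bullet> w 1 \<le> 0" by (simp add: g_def mult_le_0_iff)
  then have "w 1 = 0" by (metis inner_eq_zero_iff inner_ge_zero order_antisym)
  then show ?thesis by (simp add: w_def h_def)
qed

text \<open>The two trajectories over the segment fill a compact set, on which the local Lipschitz
  constants merge into a single one, uniform in time.\<close>

lemma solution_unique:
  fixes F :: "real \<Rightarrow> 'a::{real_inner, heine_borel} \<Rightarrow> 'a"
  assumes cont: "\<And>x. x \<in> X \<Longrightarrow> continuous_on UNIV (\<lambda>t. F t x)"
    and lip: "local_lipschitz UNIV X F"
    and y: "\<And>s. s \<in> closed_segment t0 t \<Longrightarrow> (y has_vector_derivative F s (y s)) (at s) \<and> y s \<in> X"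
    and z: "\<And>s. s \<in> closed_segment t0 t \<Longrightarrow> (z has_vector_derivative F s (z s)) (at s) \<and> z s \<in> X"
    and eq: "y t0 = z t0"
  shows "y t = z t"
proof -
  let ?I = "closed_segment t0 t"
  define Y where "Y = y ` ?I \<union> z ` ?I"
  have "continuous_on ?I y" "continuous_on ?I z"
    using y z by (meson continuous_at_imp_continuous_on has_vector_derivative_continuous)+
  then have "compact Y" unfolding Y_def by (intro compact_Un compact_continuous_image) auto
  moreover have "Y \<subseteq> X" using y z by (auto simp: Y_def)
  then have "local_lipschitz ?I Y F"
    using local_lipschitz_subset[OF lip] by blast
  ultimately obtain L where "\<And>s. s \<in> ?I \<Longrightarrow> L-lipschitz_on Y (F s)"
    using local_lipschitz_compact_implies_lipschitz[of ?I Y F] cont \<open>Y \<subseteq> X\<close>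
      continuous_on_subset by (metis compact_segment subset_UNIV subsetD)
  then show ?thesis
    by (rule solution_unique_lipschitz[of t0 t L Y F]) (use y z eq in \<open>auto simp: Y_def\<close>)
qed

text \<open>Solving the equation with \<open>z\<close> replaced by its closest point in \<open>K\<close> and \<open>t\<close> clamped to
  \<open>[t0 - N, t0 + N]\<close>, the a priori bound shows that the solution never leaves \<open>K\<close>.\<close>

lemma ex_solution_interval:
  fixes F :: "real \<Rightarrow> 'a::euclidean_space \<Rightarrow> 'a"
  assumes cont: "\<And>x. x \<in> X \<Longrightarrow> continuous_on UNIV (\<lambda>t. F t x)"
    and lip: "local_lipschitz UNIV X F"
    and K: "compact K" "convex K" "K \<subseteq> X" "z0 \<in> interior K" and N: "0 \<le> N"
    and apriori: "\<And>z t. \<bar>t - t0\<bar> \<le> N \<Longrightarrow> z t0 = z0 \<Longrightarrow>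
      (\<And>s. s \<in> closed_segment t0 t \<Longrightarrow> (z has_vector_derivative F s (z s)) (at s) \<and> z s \<in> K) \<Longrightarrow>
      z t \<in> interior K"
  shows "\<exists>z. z t0 = z0 \<and>
    (\<forall>t. \<bar>t - t0\<bar> \<le> N \<longrightarrow> (z has_vector_derivative F t (z t)) (at t) \<and> z t \<in> X)"
proof -
  define I where "I = {t0 - N..t0 + N}"
  define cl where "cl t = max (t0 - N) (min (t0 + N) t)" for t
  have cl_I: "cl t \<in> I" for t using N by (auto simp: cl_def I_def)
  have cl: "cl t = t" if "t \<in> I" for t using that by (auto simp: cl_def I_def)
  have KX: "K \<noteq> {}" "closed K" using K interior_subset compact_imp_closed by auto
  define \<pi> where "\<pi> = closest_point K"
  have \<pi>_K: "\<pi> x \<in> K" for x unfolding \<pi>_def by (rule closest_point_in_set) (use KX in auto)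
  have \<pi>: "\<pi> x = x" if "x \<in> K" for x unfolding \<pi>_def by (rule closest_point_self) fact
  have \<pi>_lip: "dist (\<pi> x) (\<pi> y) \<le> dist x y" for x y
    unfolding \<pi>_def by (rule closest_point_lipschitz) (use K KX in auto)
  have contF: "continuous_on (UNIV \<times> X) (\<lambda>(t, z). F t z)"
    by (rule Lipschitz.continuous_on_TimesI[OF lip cont])
  have "local_lipschitz I K F" by (rule local_lipschitz_subset[OF lip]) (use K in auto)
  then obtain L0 where L0: "\<And>t. t \<in> I \<Longrightarrow> L0-lipschitz_on K (F t)"
    using local_lipschitz_compact_implies_lipschitz[of I K F] K(1)
      continuous_on_subset[OF cont] K(3) by (metis I_def compact_Icc subset_UNIV subsetD)
  define L where "L = \<bar>L0\<bar> + 1"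
  have L: "L-lipschitz_on K (F t)" if "t \<in> I" for t
    by (rule lipschitz_on_mono[OF L0[OF that]]) (auto simp: L_def)
  \<comment> \<open>The projection is 1-Lipschitz with values in \<open>K\<close>, and for times in
    \<open>I\<close> the field has one bound and one Lipschitz constant on \<open>K\<close>. So
    \<open>G\<close> has both on the whole space.\<close>
  define G where "G t z = F (cl t) (\<pi> z)" for t z
  have "compact ((\<lambda>(t, z). F t z) ` (I \<times> K))"
    by (intro compact_continuous_image compact_Times K continuous_on_subset[OF contF])
       (use K in \<open>auto simp: I_def\<close>)
  then have "bounded ((\<lambda>(t, z). F t z) ` (I \<times> K))" by (rule compact_imp_bounded)
  then obtain M where M: "\<And>t z. t \<in> I \<Longrightarrow> z \<in> K \<Longrightarrow> norm (F t z) \<le> M"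
    unfolding bounded_iff by fastforce
  have "\<exists>z. z t0 = z0 \<and> (\<forall>t. (z has_vector_derivative G t (z t)) (at t))"
  proof (rule ex_solution_lipschitz)
    have "continuous_on UNIV \<pi>"
      unfolding \<pi>_def by (rule continuous_on_closest_point) (use K KX in auto)
    then have "continuous_on UNIV (\<lambda>p. (\<lambda>(t, z). F t z) (cl (fst p), \<pi> (snd p)))"
      unfolding cl_def
      by (intro continuous_on_compose2[OF contF] continuous_intros
          continuous_on_compose2[of UNIV \<pi> UNIV snd]) (use \<pi>_K K in auto)
    then show "continuous_on UNIV (\<lambda>(t, z). G t z)"
      by (simp add: G_def case_prod_beta)
    show "norm (G t z) \<le> M" for t z by (simp add: G_def M cl_I \<pi>_K)
    show "L-lipschitz_on UNIV (G t)" for t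
    proof (rule lipschitz_onI)
      fix x y
      have "dist (G t x) (G t y) \<le> L * dist (\<pi> x) (\<pi> y)"
        unfolding G_def by (rule lipschitz_onD[OF L]) (auto simp: cl_I \<pi>_K)
      also have "\<dots> \<le> L * dist x y" by (intro mult_left_mono \<pi>_lip) (simp add: L_def)
      finally show "dist (G t x) (G t y) \<le> L * dist x y" .
    qed (simp add: L_def)
    show "0 < L" by (simp add: L_def)
  qed
  then obtain z where z0: "z t0 = z0" and z: "\<And>t. (z has_vector_derivative G t (z t)) (at t)"
    by blast
  have z_sol: "(z has_vector_derivative F t (z t)) (at t)" if "t \<in> I" "z t \<in> K" for t
    using z[of t] that by (simp add: G_def cl \<pi>)
  have cont_z: "continuous_on UNIV z"
    using z by (meson continuous_at_imp_continuous_on has_vector_derivative_continuous)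
  have in_K: "z t \<in> interior K" if t: "t \<in> I" for t
  proof (rule ccontr)
    assume nt: "z t \<notin> interior K"
    \<comment> \<open>A parameter in \<open>[0, 1]\<close> handles times on either side of
      \<open>t0\<close> at once. Below, \<open>r\<close> is the first parameter at which the
      solution is outside the interior of \<open>K\<close>.\<close>
    define p where "p s = t0 + s * (t - t0)" for s
    define S where "S = {s \<in> {0..1}. z (p s) \<in> - interior K}"
    have p_I: "p s \<in> I" if "s \<in> {0..1}" for s
    proof -
      have "\<bar>s * (t - t0)\<bar> \<le> 1 * N" unfolding abs_mult
        by (intro mult_mono) (use that t in \<open>auto simp: I_def\<close>)
      then show ?thesis by (auto simp: p_def I_def)
    qed
    have cp: "continuous_on A (\<lambda>s. z (p s))" for A
      by (rule continuous_on_compose2[OF cont_z]) (auto simp: p_def intro!: continuous_intros)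
    have "S = {0..1} \<inter> (\<lambda>s. z (p s)) -` (- interior K)" by (auto simp: S_def)
    then have "closed S"
      using continuous_closed_preimage[OF cp, of "{0..1}" "- interior K"] by auto
    moreover have "1 \<in> S" using nt by (simp add: S_def p_def)
    moreover have bdd: "bdd_below S" by (auto simp: S_def)
    ultimately have Inf_S: "Inf S \<in> S" by (intro closed_contains_Inf) auto
    define r where "r = Inf S"
    have r: "r \<in> {0..1}" "z (p r) \<notin> interior K" using Inf_S by (auto simp: S_def r_def)
    have before: "z (p s) \<in> interior K" if "0 \<le> s" "s < r" for s
    proof (rule ccontr)
      assume "z (p s) \<notin> interior K"
      then have "s \<in> S" using that r by (auto simp: S_def)
      then show False using cInf_lower[OF _ bdd] that by (force simp: r_def)
    qed
    have "0 < r" using r K(4) z0 by (cases "r = 0") (auto simp: p_def)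
    note before_K = subsetD[OF interior_subset before]
    \<comment> \<open>Up to and including \<open>r\<close> the solution is in \<open>K\<close>, at
      \<open>r\<close> itself because \<open>K\<close> is closed. Hence it solves the original
      equation on that whole segment, and the a priori bound contradicts the choice of
      \<open>r\<close>.\<close>
    have z_K: "z (p s) \<in> K" if s: "s \<in> {0..r}" for s
    proof (cases "s = r")
      case True
      have lim: "((\<lambda>s. z (p s)) \<longlongrightarrow> z (p r)) (at_left r)"
        using cp[of UNIV, unfolded continuous_on_def]
        by (meson UNIV_I subset_UNIV tendsto_within_subset)
      have "\<forall>\<^sub>F s in at_left r. z (p s) \<in> K"
        using eventually_at_left_real[OF \<open>0 < r\<close>]
        by eventually_elim (auto intro: before_K)
      then show ?thesis
        unfolding True by (rule Lim_in_closed_set[OF KX(2) _ trivial_limit_at_left_real lim])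
    qed (use s in \<open>auto intro: before_K\<close>)
    have "\<bar>p r - t0\<bar> \<le> N" using p_I[OF r(1)] unfolding I_def atLeastAtMost_iff by linarith
    then have "z (p r) \<in> interior K"
    proof (rule apriori[of "p r" z, OF _ z0])
      fix s assume "s \<in> closed_segment t0 (p r)"
      then obtain u where u: "0 \<le> u" "u \<le> 1" "s = (1 - u) *\<^sub>R t0 + u *\<^sub>R p r"
        by (auto simp: in_segment)
      have s: "s = p (u * r)" unfolding u(3) p_def by (simp add: algebra_simps)
      have ur: "u * r \<le> r" "0 \<le> u * r" using u r by (simp_all add: mult_left_le_one_le)
      have "z s \<in> K" unfolding s using ur by (intro z_K) simp
      moreover have "s \<in> I" unfolding s using ur r by (intro p_I) simp
      ultimately show "(z has_vector_derivative F s (z s)) (at s) \<and> z s \<in> K"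
        using z_sol by blast
    qed
    then show False using r by blast
  qed
  have "(z has_vector_derivative F t (z t)) (at t) \<and> z t \<in> X" if "\<bar>t - t0\<bar> \<le> N" for t
  proof -
    have "t \<in> I" using that by (auto simp: I_def)
    then show ?thesis using in_K z_sol interior_subset K(3) by blast
  qed
  then show ?thesis using z0 by blast
qed

text \<open>Solutions on the intervals of radius \<open>n\<close> agree by uniqueness and can be
  glued. Since \<open>K\<close> may depend on \<open>N\<close>, a bound that deteriorates with time
  is good enough.\<close>

proposition ex_global_solution:
  fixes F :: "real \<Rightarrow> 'a::euclidean_space \<Rightarrow> 'a"
  assumes cont: "\<And>x. x \<in> X \<Longrightarrow> continuous_on UNIV (\<lambda>t. F t x)"
    and lip: "local_lipschitz UNIV X F"
    and apriori: "\<And>N. 0 \<le> N \<Longrightarrow> \<exists>K. compact K \<and> convex K \<and> K \<subseteq> X \<and> z0 \<in> interior K \<and>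
      (\<forall>z t. \<bar>t - t0\<bar> \<le> N \<longrightarrow> z t0 = z0 \<longrightarrow>
        (\<forall>s \<in> closed_segment t0 t. (z has_vector_derivative F s (z s)) (at s) \<and> z s \<in> K) \<longrightarrow>
        z t \<in> interior K)"
  shows "\<exists>z. z t0 = z0 \<and> (\<forall>t. (z has_vector_derivative F t (z t)) (at t) \<and> z t \<in> X)"
proof -
  have "\<exists>z. z t0 = z0 \<and>
      (\<forall>t. \<bar>t - t0\<bar> \<le> real n \<longrightarrow> (z has_vector_derivative F t (z t)) (at t) \<and> z t \<in> X)" for n
  proof -
    obtain K where K: "compact K" "convex K" "K \<subseteq> X" "z0 \<in> interior K"
      "\<And>z t. \<bar>t - t0\<bar> \<le> real n \<Longrightarrow> z t0 = z0 \<Longrightarrow>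
        (\<And>s. s \<in> closed_segment t0 t \<Longrightarrow> (z has_vector_derivative F s (z s)) (at s) \<and> z s \<in> K) \<Longrightarrow>
        z t \<in> interior K"
      using apriori[of "real n"] by (auto simp: Ball_def)
    show ?thesis by (rule ex_solution_interval[where K = K]) (use cont lip K in auto)
  qed
  then obtain Z where Z0: "\<And>n. Z n t0 = z0"
    and Z: "\<And>n t. \<bar>t - t0\<bar> \<le> real n \<Longrightarrow> (Z n has_vector_derivative F t (Z n t)) (at t) \<and> Z n t \<in> X"
    by metis
  have same: "Z m t = Z n t" if "\<bar>t - t0\<bar> \<le> real m" "\<bar>t - t0\<bar> \<le> real n" for m n t
  proof (rule solution_unique[OF cont lip])
    fix s assume "s \<in> closed_segment t0 t"
    then have "\<bar>s - t0\<bar> \<le> \<bar>t - t0\<bar>"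
      by (auto simp: closed_segment_eq_real_ivl split: if_splits)
    then show "(Z m has_vector_derivative F s (Z m s)) (at s) \<and> Z m s \<in> X"
      "(Z n has_vector_derivative F s (Z n s)) (at s) \<and> Z n s \<in> X"
      using Z that by auto
  qed (simp_all add: Z0)
  define z where "z t = Z (nat \<lceil>\<bar>t - t0\<bar>\<rceil>) t" for t
  have z_eq: "z t = Z n t" if "\<bar>t - t0\<bar> \<le> real n" for n t
    unfolding z_def by (rule same) (use that in linarith)+
  have "(z has_vector_derivative F t (z t)) (at t) \<and> z t \<in> X" for t
  proof -
    \<comment> \<open>One more than the index used in \<open>z t\<close>: then \<open>Z n\<close>
      agrees with \<open>z\<close> on a whole ball around \<open>t\<close>, as is needed to transfer
      the derivative.\<close>
    define n where "n = nat \<lceil>\<bar>t - t0\<bar>\<rceil> + 1"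
    have n: "\<bar>t - t0\<bar> + 1 \<le> real n" unfolding n_def by linarith
    then have "z t = Z n t" by (intro z_eq) auto
    moreover have "(z has_vector_derivative F t (Z n t)) (at t)"
    proof (rule has_vector_derivative_transform_within_open[of "Z n"])
      show "(Z n has_vector_derivative F t (Z n t)) (at t)" using Z n by auto
      show "Z n s = z s" if "s \<in> ball t 1" for s
        using that n by (intro z_eq[symmetric]) (auto simp: dist_real_def)
    qed auto
    moreover have "Z n t \<in> X" using Z n by auto
    ultimately show ?thesis by simp
  qed
  moreover have "z t0 = z0" by (simp add: z_def Z0)
  ultimately show ?thesis by blast
qed

section \<open>Smooth functions of one real variable\<close>

lemma k_differentiable_on_cmult_UNIV:
  fixes f :: "'e::euclidean_space \<Rightarrow> real"
  shows "k_differentiable_on n UNIV f \<Longrightarrow> k_differentiable_on n UNIV (\<lambda>x. f x * v)"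
proof (induction n arbitrary: f)
  case 0
  then show ?case by (auto intro: continuous_intros)
next
  case (Suc n)
  have d: "((\<lambda>x. f x * v) has_derivative (\<lambda>w. frechet_derivative f (at x) w * v)) (at x)" for x
    using Suc.prems by (intro has_derivative_mult_left) (simp add: frechet_derivative_works[symmetric])
  then have "frechet_derivative (\<lambda>x. f x * v) (at x) = (\<lambda>w. frechet_derivative f (at x) w * v)"
    and "(\<lambda>x. f x * v) differentiable at x" for x
    using frechet_derivative_at[OF d] differentiableI[OF d] by auto
  with Suc show ?case by simp
qed

text \<open>In dimension one the derivative in direction \<open>v\<close> is \<open>deriv f\<close>
  times \<open>v\<close>, so the quantifier over directions collapses to
  \<open>v = 1\<close>.\<close>

lemma k_differentiable_on_UNIV_Suc:
  fixes f :: "real \<Rightarrow> real"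
  shows "k_differentiable_on (Suc n) UNIV f \<longleftrightarrow>
    (\<forall>t. (f has_real_derivative deriv f t) (at t)) \<and> k_differentiable_on n UNIV (deriv f)"
proof (cases "\<forall>t. f differentiable at t")
  case True
  have d: "(f has_real_derivative deriv f t) (at t)" for t
    using True by (metis DERIV_deriv_iff_real_differentiable)
  then have "frechet_derivative f (at t) = (\<lambda>v. deriv f t * v)" for t
    using frechet_derivative_at[OF d[unfolded has_field_derivative_def]] by metis
  then have "k_differentiable_on (Suc n) UNIV f \<longleftrightarrow>
      (\<forall>v. k_differentiable_on n UNIV (\<lambda>t. deriv f t * v))"
    using True by simp
  also have "\<dots> \<longleftrightarrow> k_differentiable_on n UNIV (deriv f)"
  proof
    assume "\<forall>v. k_differentiable_on n UNIV (\<lambda>t. deriv f t * v)"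
    from spec[OF this, of 1] show "k_differentiable_on n UNIV (deriv f)" by simp
  qed (blast intro: k_differentiable_on_cmult_UNIV)
  finally show ?thesis using d by blast
next
  case False
  then show ?thesis by (auto simp: real_differentiable_def)
qed

lemma k_differentiable_on_SucI:
  fixes f :: "real \<Rightarrow> real"
  assumes "\<And>t. (f has_real_derivative f' t) (at t)" "k_differentiable_on n UNIV f'"
  shows "k_differentiable_on (Suc n) UNIV f"
proof -
  have "deriv f = f'" using assms(1) by (intro ext DERIV_imp_deriv)
  then show ?thesis using assms unfolding k_differentiable_on_UNIV_Suc by simp
qed

lemma k_differentiable_on_SucD:
  fixes f :: "real \<Rightarrow> real"
  shows "k_differentiable_on (Suc n) UNIV f \<Longrightarrow> k_differentiable_on n UNIV f"
proof (induction n arbitrary: f)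
  case 0
  then show ?case
    by (auto intro!: continuous_at_imp_continuous_on differentiable_imp_continuous_within)
next
  case (Suc n)
  then show ?case unfolding k_differentiable_on_UNIV_Suc by blast
qed

section \<open>Closure rules at each finite order, as an order by order bootstrap requires\<close>

named_theorems smooth_intros

lemma k_differentiable_on_const [smooth_intros]:
  "k_differentiable_on n UNIV (\<lambda>t :: real. c :: real)"
  by (induction n arbitrary: c) (auto simp del: k_differentiable_on.simps(2)
      intro: k_differentiable_on_SucI derivative_eq_intros)

lemma k_differentiable_on_add [smooth_intros]:
  fixes f g :: "real \<Rightarrow> real"
  shows "k_differentiable_on n UNIV f \<Longrightarrow> k_differentiable_on n UNIV g \<Longrightarrow>
    k_differentiable_on n UNIV (\<lambda>t. f t + g t)"
proof (induction n arbitrary: f g)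
  case 0
  then show ?case by (auto intro: continuous_intros)
next
  case (Suc n)
  then show ?case
    by (auto simp only: k_differentiable_on_UNIV_Suc[of _ f] k_differentiable_on_UNIV_Suc[of _ g]
        intro!: k_differentiable_on_SucI[where f' = "\<lambda>t. deriv f t + deriv g t"] DERIV_add)
qed

lemma k_differentiable_on_mult [smooth_intros]:
  fixes f g :: "real \<Rightarrow> real"
  shows "k_differentiable_on n UNIV f \<Longrightarrow> k_differentiable_on n UNIV g \<Longrightarrow>
    k_differentiable_on n UNIV (\<lambda>t. f t * g t)"
proof (induction n arbitrary: f g)
  case 0
  then show ?case by (auto intro: continuous_intros)
next
  case (Suc n)
  \<comment> \<open>The derivative of the product contains \<open>f\<close> and \<open>g\<close>
    again, so their regularity is also recorded at the lower order.\<close>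
  note fg = Suc.prems[THEN k_differentiable_on_SucD] Suc.prems[unfolded k_differentiable_on_UNIV_Suc]
  show ?case
  proof (rule k_differentiable_on_SucI)
    show "((\<lambda>t. f t * g t) has_real_derivative deriv f t * g t + deriv g t * f t) (at t)" for t
      using fg by (intro DERIV_mult) auto
    show "k_differentiable_on n UNIV (\<lambda>t. deriv f t * g t + deriv g t * f t)"
      using fg by (intro k_differentiable_on_add Suc.IH) auto
  qed
qed

lemma k_differentiable_on_minus [smooth_intros]:
  fixes f :: "real \<Rightarrow> real"
  shows "k_differentiable_on n UNIV f \<Longrightarrow> k_differentiable_on n UNIV (\<lambda>t. - f t)"
  using k_differentiable_on_mult[OF k_differentiable_on_const[of n "-1"]] by simp

lemma k_differentiable_on_diff [smooth_intros]:
  fixes f g :: "real \<Rightarrow> real"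
  shows "k_differentiable_on n UNIV f \<Longrightarrow> k_differentiable_on n UNIV g \<Longrightarrow>
    k_differentiable_on n UNIV (\<lambda>t. f t - g t)"
  using k_differentiable_on_add[OF _ k_differentiable_on_minus] by simp

lemma k_differentiable_on_power [smooth_intros]:
  fixes f :: "real \<Rightarrow> real"
  shows "k_differentiable_on n UNIV f \<Longrightarrow> k_differentiable_on n UNIV (\<lambda>t. f t ^ k)"
  by (induction k) (auto intro: smooth_intros)

lemma k_differentiable_on_exp [smooth_intros]:
  fixes f :: "real \<Rightarrow> real"
  shows "k_differentiable_on n UNIV f \<Longrightarrow> k_differentiable_on n UNIV (\<lambda>t. exp (f t))"
proof (induction n arbitrary: f)
  case 0
  then show ?case by (auto intro: continuous_intros)
next
  case (Suc n)
  note f = Suc.prems[THEN k_differentiable_on_SucD] Suc.prems[unfolded k_differentiable_on_UNIV_Suc]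
  show ?case
  proof (rule k_differentiable_on_SucI)
    show "((\<lambda>t. exp (f t)) has_real_derivative exp (f t) * deriv f t) (at t)" for t
      using f by (intro DERIV_chain2[OF DERIV_exp]) auto
    show "k_differentiable_on n UNIV (\<lambda>t. exp (f t) * deriv f t)"
      using f by (intro k_differentiable_on_mult Suc.IH) auto
  qed
qed

lemma k_differentiable_on_inverse [smooth_intros]:
  fixes f :: "real \<Rightarrow> real"
  shows "(\<And>t. f t \<noteq> 0) \<Longrightarrow> k_differentiable_on n UNIV f \<Longrightarrow>
    k_differentiable_on n UNIV (\<lambda>t. inverse (f t))"
proof (induction n arbitrary: f)
  case 0
  then show ?case by (auto intro: continuous_intros)
next
  case (Suc n)
  note f = Suc.prems(2)[THEN k_differentiable_on_SucD]
    Suc.prems(2)[unfolded k_differentiable_on_UNIV_Suc]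
  show ?case
  proof (rule k_differentiable_on_SucI)
    show "((\<lambda>t. inverse (f t)) has_real_derivative
        - (inverse (f t) * deriv f t * inverse (f t))) (at t)" for t
      using f Suc.prems(1) by (intro DERIV_inverse') auto
    show "k_differentiable_on n UNIV (\<lambda>t. - (inverse (f t) * deriv f t * inverse (f t)))"
      using f Suc.prems(1) by (intro smooth_intros Suc.IH) auto
  qed
qed

lemma k_differentiable_on_divide [smooth_intros]:
  fixes f g :: "real \<Rightarrow> real"
  shows "k_differentiable_on n UNIV f \<Longrightarrow> (\<And>t. g t \<noteq> 0) \<Longrightarrow> k_differentiable_on n UNIV g \<Longrightarrow>
    k_differentiable_on n UNIV (\<lambda>t. f t / g t)"
  unfolding divide_inverse by (intro smooth_intros)

lemma k_differentiable_on_ln [smooth_intros]: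
  fixes f :: "real \<Rightarrow> real"
  shows "(\<And>t. 0 < f t) \<Longrightarrow> k_differentiable_on n UNIV f \<Longrightarrow>
    k_differentiable_on n UNIV (\<lambda>t. ln (f t))"
proof (induction n arbitrary: f)
  case 0
  then show ?case by (auto intro!: continuous_intros simp: less_imp_neq[symmetric])
next
  case (Suc n)
  note f = Suc.prems(2)[THEN k_differentiable_on_SucD]
    Suc.prems(2)[unfolded k_differentiable_on_UNIV_Suc]
  show ?case
  proof (rule k_differentiable_on_SucI)
    show "((\<lambda>t. ln (f t)) has_real_derivative deriv f t / f t) (at t)" for t
      using f Suc.prems(1)[of t] by (auto intro!: derivative_eq_intros)
    show "k_differentiable_on n UNIV (\<lambda>t. deriv f t / f t)"
      using f Suc.prems(1) by (intro smooth_intros) (auto simp: less_imp_neq[symmetric])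
  qed
qed

lemma smooth_on_UNIV_deriv:
  fixes f :: "real \<Rightarrow> real"
  assumes "smooth_on UNIV f"
  shows "smooth_on UNIV (deriv f)" "(f has_real_derivative deriv f t) (at t)"
  using assms k_differentiable_on_UNIV_Suc unfolding smooth_on_def by blast+

section \<open>Curves in Riemannian manifolds and warped products\<close>

lemma riemannian_manifoldD:
  assumes "riemannian_manifold A"
  shows riemannian_manifold_cover: "\<exists>c\<in>A. x \<in> chart_dom c"
    and riemannian_manifold_open_dom: "c \<in> A \<Longrightarrow> open (chart_dom c)"
    and riemannian_manifold_homeo:
      "c \<in> A \<Longrightarrow> homeomorphism (chart_dom c) (chart_im c) (chart_map c) (chart_inv c)"
    and riemannian_manifold_transition:
      "c \<in> A \<Longrightarrow> c' \<in> A \<Longrightarrow>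
        smooth_on (chart_map c ` (chart_dom c \<inter> chart_dom c')) (transition c c')"
    and riemannian_manifold_metric_smooth:
      "c \<in> A \<Longrightarrow> smooth_on (chart_im c) (\<lambda>y. chart_metric c y v w)"
    and riemannian_manifold_metric_bilinear:
      "c \<in> A \<Longrightarrow> y \<in> chart_im c \<Longrightarrow> bilinear (chart_metric c y)"
    and riemannian_manifold_metric_pos:
      "c \<in> A \<Longrightarrow> y \<in> chart_im c \<Longrightarrow> v \<noteq> 0 \<Longrightarrow> 0 < chart_metric c y v v"
    and riemannian_manifold_metric_transition:
      "c \<in> A \<Longrightarrow> c' \<in> A \<Longrightarrow> y \<in> chart_map c ` (chart_dom c \<inter> chart_dom c') \<Longrightarrow>
        chart_metric c y v w =
          chart_metric c' (transition c c' y)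
            (frechet_derivative (transition c c') (at y) v)
            (frechet_derivative (transition c c') (at y) w)"
  using assms unfolding riemannian_manifold_def by blast+

lemma chart_metric_nonneg:
  assumes "riemannian_manifold A" "c \<in> A" "y \<in> chart_im c"
  shows "0 \<le> chart_metric c y v v"
proof (cases "v = 0")
  case True
  then show ?thesis
    using bilinear_lzero[OF riemannian_manifold_metric_bilinear[OF assms]] by simp
next
  case False
  then show ?thesis using riemannian_manifold_metric_pos[OF assms] by (simp add: less_imp_le)
qed

text \<open>The chain rule through the transition map carries \<open>v\<close> to the velocity in
  the chart picked by \<open>SOME\<close>, and the transformation law equates the two squared
  lengths.\<close>

lemma curve_speed_chart:
  assumes A: "riemannian_manifold A" and c: "c \<in> A" "\<gamma> t \<in> chart_dom c"
    and cont: "isCont \<gamma> t" and v: "((chart_map c \<circ> \<gamma>) has_vector_derivative v) (at t)"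
  shows "curve_speed A \<gamma> t = sqrt (chart_metric c (chart_map c (\<gamma> t)) v v)"
proof -
  define c' where "c' = (SOME c. c \<in> A \<and> \<gamma> t \<in> chart_dom c)"
  have "\<exists>c. c \<in> A \<and> \<gamma> t \<in> chart_dom c" using c by blast
  then have c': "c' \<in> A" "\<gamma> t \<in> chart_dom c'"
    unfolding c'_def by (metis (mono_tags, lifting) someI_ex)+
  define W where "W = chart_dom c \<inter> chart_dom c'"
  define y where "y = chart_map c (\<gamma> t)"
  have W: "open W" "\<gamma> t \<in> W"
    using c c' riemannian_manifold_open_dom[OF A] by (auto simp: W_def)
  then have y: "y \<in> chart_map c ` W" by (simp add: y_def)
  have inv: "chart_inv c (chart_map c x) = x" if "x \<in> W" for x
    using homeomorphism_apply1[OF riemannian_manifold_homeo[OF A c(1)]] that by (simp add: W_def)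
  have "\<forall>\<^sub>F s in at t. \<gamma> s \<in> W"
    using cont W by (auto simp: isCont_def intro: topological_tendstoD)
  then have "\<forall>\<^sub>F s in nhds t. \<gamma> s \<in> W"
    using W by (simp add: eventually_nhds_conv_at)
  \<comment> \<open>The two coordinate curves are related by the transition map only while the curve
    is in both chart domains. This holds near \<open>t\<close>, which is enough for the
    derivative.\<close>
  then obtain U where U: "open U" "t \<in> U" "\<And>s. s \<in> U \<Longrightarrow> \<gamma> s \<in> W"
    by (auto simp: eventually_nhds)
  have "k_differentiable_on (Suc 0) (chart_map c ` W) (transition c c')"
    using riemannian_manifold_transition[OF A c(1) c'(1)] by (simp only: smooth_on_def W_def)
  then have "(transition c c' has_derivative frechet_derivative (transition c c') (at y)) (at y)"
    using y unfolding k_differentiable_on.simps frechet_derivative_works by blast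
  then have "(transition c c' has_derivative frechet_derivative (transition c c') (at y))
      (at ((chart_map c \<circ> \<gamma>) t) within range (chart_map c \<circ> \<gamma>))"
    unfolding y_def by (simp add: has_derivative_at_withinI)
  from vector_derivative_diff_chain_within[OF v this]
  have "((transition c c' \<circ> (chart_map c \<circ> \<gamma>)) has_vector_derivative
      frechet_derivative (transition c c') (at y) v) (at t)" .
  then have "((chart_map c' \<circ> \<gamma>) has_vector_derivative
      frechet_derivative (transition c c') (at y) v) (at t)"
    by (rule has_vector_derivative_transform_within_open[OF _ U(1,2)])
      (simp add: transition_def inv U(3))
  then have "vector_derivative (chart_map c' \<circ> \<gamma>) (at t) =
      frechet_derivative (transition c c') (at y) v"
    by (rule vector_derivative_at)
  moreover have "transition c c' y = chart_map c' (\<gamma> t)"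
    using W by (simp add: transition_def y_def inv)
  ultimately show ?thesis
    using riemannian_manifold_metric_transition[OF A c(1) c'(1) y[unfolded W_def], of v v]
    unfolding curve_speed_def c'_def[symmetric] Let_def y_def by simp
qed

lemma curve_speed_nonneg:
  assumes "riemannian_manifold A"
  shows "0 \<le> curve_speed A \<gamma> t"
proof -
  define c where "c = (SOME c. c \<in> A \<and> \<gamma> t \<in> chart_dom c)"
  have "c \<in> A" "\<gamma> t \<in> chart_dom c"
    using riemannian_manifold_cover[OF assms, of "\<gamma> t"]
    unfolding c_def by (metis (mono_tags, lifting) someI_ex)+
  then have "0 \<le> chart_metric c (chart_map c (\<gamma> t)) v v" for v
    by (intro chart_metric_nonneg[OF assms]) (auto simp: chart_im_def)
  then show ?thesis unfolding curve_speed_def c_def[symmetric] Let_def by simp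
qed

lemma C1_differentiable_on_open_UN:
  assumes "\<And>i. i \<in> I \<Longrightarrow> open (U i)" "\<And>i. i \<in> I \<Longrightarrow> f C1_differentiable_on U i"
  shows "f C1_differentiable_on (\<Union>i\<in>I. U i)"
  using assms unfolding C1_differentiable_on_eq by (auto intro: continuous_on_open_UN)

lemma C1_differentiable_on_bounded_linear:
  assumes "bounded_linear h" "f C1_differentiable_on S"
  shows "(\<lambda>x. h (f x)) C1_differentiable_on S"
proof -
  obtain D where D: "\<And>x. x \<in> S \<Longrightarrow> (f has_vector_derivative D x) (at x)" "continuous_on S D"
    using assms(2) unfolding C1_differentiable_on_def by blast
  then have "\<forall>x\<in>S. ((\<lambda>x. h (f x)) has_vector_derivative h (D x)) (at x)"
    using bounded_linear.has_vector_derivative[OF assms(1)] by blast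
  moreover have "continuous_on S (\<lambda>x. h (D x))"
    by (rule bounded_linear.continuous_on[OF assms(1) D(2)])
  ultimately show ?thesis
    unfolding C1_differentiable_on_def by (intro exI[of _ "\<lambda>x. h (D x)"] conjI)
qed

lemma C1_differentiable_on_Pair:
  assumes "f C1_differentiable_on S" "g C1_differentiable_on S"
  shows "(\<lambda>x. (f x, g x)) C1_differentiable_on S"
proof -
  obtain D E where
    "\<forall>x\<in>S. (f has_vector_derivative D x) (at x)" "continuous_on S D"
    "\<forall>x\<in>S. (g has_vector_derivative E x) (at x)" "continuous_on S E"
    using assms unfolding C1_differentiable_on_def by blast
  then have "(\<forall>x\<in>S. ((\<lambda>x. (f x, g x)) has_vector_derivative (D x, E x)) (at x)) \<and>
      continuous_on S (\<lambda>x. (D x, E x))"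
    by (auto intro: has_vector_derivative_Pair continuous_on_Pair)
  then show ?thesis
    unfolding C1_differentiable_on_def by (intro exI[of _ "\<lambda>x. (D x, E x)"])
qed

text \<open>Dropping the endpoints makes the good parameters an open set, on which derivatives and
  chart changes can be treated locally. Allowing a larger exceptional set \<open>S'\<close> lets the
  exceptional sets of two curves be merged.\<close>

lemma piecewise_C1_curveD:
  assumes "piecewise_C1_curve A \<gamma>"
  shows "path \<gamma> \<and> (\<exists>S. finite S \<and> (\<forall>c\<in>A. \<forall>S'. S \<subseteq> S' \<longrightarrow>
    (chart_map c \<circ> \<gamma>) C1_differentiable_on (({0<..<1} - S') \<inter> \<gamma> -` chart_dom c)))"
proof -
  obtain S where S: "finite S" "path \<gamma>"
    "\<And>c. c \<in> A \<Longrightarrow> (chart_map c \<circ> \<gamma>) C1_differentiable_on ({0..1} \<inter> \<gamma> -` chart_dom c - S)"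
    using assms unfolding piecewise_C1_curve_def by blast
  have "(chart_map c \<circ> \<gamma>) C1_differentiable_on (({0<..<1} - S') \<inter> \<gamma> -` chart_dom c)"
    if "c \<in> A" "S \<subseteq> S'" for c S'
    using that by (intro C1_differentiable_on_subset[OF S(3)]) auto
  then show ?thesis using S(1,2) by blast
qed

lemma piecewise_C1_curveI:
  assumes "finite S" "path \<gamma>"
    "\<And>c. c \<in> A \<Longrightarrow> (chart_map c \<circ> \<gamma>) C1_differentiable_on (({0<..<1} - S) \<inter> \<gamma> -` chart_dom c)"
  shows "piecewise_C1_curve A \<gamma>"
  unfolding piecewise_C1_curve_def
proof (intro conjI exI ballI)
  show "finite (S \<union> {0, 1})" using assms by simp
  fix c assume "c \<in> A"
  then show "(chart_map c \<circ> \<gamma>) C1_differentiable_on ({0..1} \<inter> \<gamma> -` chart_dom c - (S \<union> {0, 1}))"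
    by (intro C1_differentiable_on_subset[OF assms(3)]) auto
qed (rule assms)

lemma isCont_path:
  assumes "path \<gamma>" "t \<in> {0<..<1}"
  shows "isCont \<gamma> t"
  using assms continuous_on_interior[of "{0..1}" \<gamma> t] by (simp add: path_def)

lemma open_path_vimage:
  assumes "path \<gamma>" "finite S" "open W"
  shows "open (({0<..<1} - S) \<inter> \<gamma> -` W)"
proof (rule continuous_open_preimage)
  show "continuous_on ({0<..<1} - S) \<gamma>"
    using assms(1) unfolding path_def by (rule continuous_on_subset) auto
qed (use assms in \<open>auto intro: open_Diff finite_imp_closed\<close>)

text \<open>Smoothness of the metric is given for fixed vectors only. Expanding the moving vector in
  \<open>Basis\<close> reduces joint continuity to finitely many such coefficients.\<close>

lemma continuous_on_chart_metric:
  assumes A: "riemannian_manifold A" "c \<in> A"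
    and u: "continuous_on U u" "u ` U \<subseteq> chart_im c" and v: "continuous_on U v"
  shows "continuous_on U (\<lambda>s. chart_metric c (u s) (v s) (v s))"
proof -
  have "continuous_on (chart_im c) (\<lambda>y. chart_metric c y i j)" for i j
    using riemannian_manifold_metric_smooth[OF A]
    unfolding smooth_on_def by (metis k_differentiable_on.simps(1))
  then have m: "continuous_on U (\<lambda>s. chart_metric c (u s) i j)" for i j
    using continuous_on_compose2 u by blast
  have "chart_metric c (u s) (v s) (v s) =
      (\<Sum>(i, j)\<in>Basis \<times> Basis. (v s \<bullet> i) * (v s \<bullet> j) * chart_metric c (u s) i j)"
    if "s \<in> U" for s
  proof -
    have b: "bilinear (chart_metric c (u s))"
      using riemannian_manifold_metric_bilinear[OF A] u that by blast
    have "chart_metric c (u s) (v s) (v s) =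
        chart_metric c (u s) (\<Sum>i\<in>Basis. (v s \<bullet> i) *\<^sub>R i) (\<Sum>i\<in>Basis. (v s \<bullet> i) *\<^sub>R i)"
      by (simp add: euclidean_representation)
    then show ?thesis
      unfolding bilinear_sum[OF b]
      by (simp add: bilinear_lmul[OF b] bilinear_rmul[OF b] mult.assoc mult.left_commute case_prod_beta)
  qed
  moreover have "continuous_on U
      (\<lambda>s. \<Sum>(i, j)\<in>Basis \<times> Basis. (v s \<bullet> i) * (v s \<bullet> j) * chart_metric c (u s) i j)"
    unfolding case_prod_beta by (intro continuous_intros m v)
  ultimately show ?thesis by (subst continuous_on_cong) auto
qed

text \<open>Supplies the measurability of the speed. The selected chart may jump with the parameter,
  but on the open set of parameters belonging to one chart the speed is given by the formula in that
  chart.\<close>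

lemma continuous_on_curve_speed:
  fixes A :: "('a::{t2_space,second_countable_topology}, 'e::euclidean_space) rchart set"
  assumes A: "riemannian_manifold A" and \<gamma>: "path \<gamma>" and S: "finite S"
    and C1: "\<And>c. c \<in> A \<Longrightarrow>
      (chart_map c \<circ> \<gamma>) C1_differentiable_on (({0<..<1} - S) \<inter> \<gamma> -` chart_dom c)"
  shows "continuous_on ({0<..<1} - S) (curve_speed A \<gamma>)"
proof -
  define U where "U c = ({0<..<1} - S) \<inter> \<gamma> -` chart_dom c" for c :: "('a, 'e) rchart"
  have "continuous_on (\<Union>c\<in>A. U c) (curve_speed A \<gamma>)"
  proof (rule continuous_on_open_UN)
    fix c assume c: "c \<in> A"
    show "open (U c)"
      unfolding U_def by (intro open_path_vimage \<gamma> S riemannian_manifold_open_dom[OF A c])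
    obtain D where D: "\<And>x. x \<in> U c \<Longrightarrow> ((chart_map c \<circ> \<gamma>) has_vector_derivative D x) (at x)"
      "continuous_on (U c) D"
      using C1[OF c] unfolding C1_differentiable_on_def U_def by blast
    have "curve_speed A \<gamma> s = sqrt (chart_metric c ((chart_map c \<circ> \<gamma>) s) (D s) (D s))"
      if "s \<in> U c" for s
      using curve_speed_chart[OF A c _ _ D(1)[OF that]] that isCont_path[OF \<gamma>]
      by (auto simp: U_def)
    moreover have "continuous_on (U c) (chart_map c \<circ> \<gamma>)"
      using D(1) by (meson continuous_at_imp_continuous_on has_vector_derivative_continuous)
    then have "continuous_on (U c) (\<lambda>s. sqrt (chart_metric c ((chart_map c \<circ> \<gamma>) s) (D s) (D s)))"
      by (intro continuous_on_real_sqrt continuous_on_chart_metric[OF A c] D(2))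
        (auto simp: U_def chart_im_def)
    ultimately show "continuous_on (U c) (curve_speed A \<gamma>)"
      by (subst continuous_on_cong) auto
  qed
  moreover have "(\<Union>c\<in>A. U c) = {0<..<1} - S"
    using riemannian_manifold_cover[OF A] by (auto simp: U_def)
  ultimately show ?thesis by simp
qed

lemma nn_set_integral_01_diff_finite:
  assumes "finite S"
  shows "(\<integral>\<^sup>+t\<in>{0..1::real}. f t \<partial>lborel) = (\<integral>\<^sup>+t\<in>{0<..<1} - S. f t \<partial>lborel)"
proof (rule nn_integral_cong_AE)
  have "AE t in lborel. t \<notin> S \<union> {0, 1 :: real}"
    by (rule AE_not_in[OF finite_imp_null_set_lborel]) (use assms in simp)
  then show "AE t in lborel. f t * indicator {0..1} t = f t * indicator ({0<..<1} - S) t"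
    by eventually_elim (auto simp: indicator_def)
qed

lemma borel_measurable_indicator_ennreal:
  assumes "continuous_on U f" "open U"
  shows "(\<lambda>t. ennreal (f t) * indicator U t) \<in> borel_measurable (lborel :: real measure)"
proof -
  have "(\<lambda>t. ennreal (indicator U t *\<^sub>R f t)) \<in> borel_measurable borel"
    by (intro measurable_compose[OF borel_measurable_continuous_on_indicator])
      (use assms in auto)
  also have "(\<lambda>t. ennreal (indicator U t *\<^sub>R f t)) = (\<lambda>t. ennreal (f t) * indicator U t)"
    by (auto simp: indicator_def)
  finally show ?thesis by simp
qed

subsection \<open>Curves in a warped product\<close>

lemma warped_metricE:
  assumes "c \<in> warped_metric l1 l2 A1 A2"
  obtains c1 c2 where "c = warped_chart l1 l2 c1 c2" "c1 \<in> A1" "c2 \<in> A2"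
  using assms unfolding warped_metric_def by blast

lemma chart_dom_warped [simp]:
  "chart_dom (warped_chart l1 l2 c1 c2) = UNIV \<times> chart_dom c1 \<times> chart_dom c2"
  by (simp add: warped_chart_def)

lemma chart_map_warped_comp:
  "chart_map (warped_chart l1 l2 c1 c2) \<circ> (\<lambda>s. (\<tau> s, \<gamma>1 s, \<gamma>2 s)) =
    (\<lambda>s. (\<tau> s, (chart_map c1 \<circ> \<gamma>1) s, (chart_map c2 \<circ> \<gamma>2) s))"
  by (auto simp: warped_chart_def)

lemma path_triple:
  "path (\<lambda>s. (\<tau> s, \<gamma>1 s, \<gamma>2 s)) \<longleftrightarrow> path \<tau> \<and> path \<gamma>1 \<and> path \<gamma>2"
proof
  assume "path (\<lambda>s. (\<tau> s, \<gamma>1 s, \<gamma>2 s))"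
  note * = this[unfolded path_def]
  show "path \<tau> \<and> path \<gamma>1 \<and> path \<gamma>2"
    using continuous_on_fst[OF *] continuous_on_fst[OF continuous_on_snd[OF *]]
      continuous_on_snd[OF continuous_on_snd[OF *]] by (simp add: path_def)
qed (auto simp: path_def intro: continuous_on_Pair)

text \<open>A product chart controls a component only at parameters where both of its factors apply.
  Taking the union of these open sets over all charts of the other factor, which cover it, removes
  that restriction.\<close>

lemma piecewise_C1_curve_warpedD:
  fixes A1 :: "('a::{t2_space,second_countable_topology}, 'e::euclidean_space) rchart set"
    and A2 :: "('b::{t2_space,second_countable_topology}, 'f::euclidean_space) rchart set"
  assumes A: "riemannian_manifold A1" "riemannian_manifold A2"
    and \<gamma>: "piecewise_C1_curve (warped_metric l1 l2 A1 A2) (\<lambda>s. (\<tau> s, \<gamma>1 s, \<gamma>2 s))"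
  shows "path \<tau> \<and> path \<gamma>1 \<and> path \<gamma>2 \<and>
    (\<exists>S. finite S \<and> \<tau> C1_differentiable_on ({0<..<1} - S) \<and>
      (\<forall>c\<in>A1. (chart_map c \<circ> \<gamma>1) C1_differentiable_on (({0<..<1} - S) \<inter> \<gamma>1 -` chart_dom c)) \<and>
      (\<forall>c\<in>A2. (chart_map c \<circ> \<gamma>2) C1_differentiable_on (({0<..<1} - S) \<inter> \<gamma>2 -` chart_dom c)))"
proof -
  let ?\<gamma> = "\<lambda>s. (\<tau> s, \<gamma>1 s, \<gamma>2 s)"
  obtain S where S: "finite S" "path ?\<gamma>"
    "\<And>c S'. c \<in> warped_metric l1 l2 A1 A2 \<Longrightarrow> S \<subseteq> S' \<Longrightarrow>
      (chart_map c \<circ> ?\<gamma>) C1_differentiable_on (({0<..<1} - S') \<inter> ?\<gamma> -` chart_dom c)"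
    using piecewise_C1_curveD[OF \<gamma>] by blast
  define U where "U c1 c2 = ({0<..<1} - S) \<inter> ?\<gamma> -` (UNIV \<times> chart_dom c1 \<times> chart_dom c2)"
    for c1 :: "('a, 'e) rchart" and c2 :: "('b, 'f) rchart"
  have C1: "(\<lambda>s. (\<tau> s, (chart_map c1 \<circ> \<gamma>1) s, (chart_map c2 \<circ> \<gamma>2) s)) C1_differentiable_on U c1 c2"
    if "c1 \<in> A1" "c2 \<in> A2" for c1 c2
  proof -
    have "warped_chart l1 l2 c1 c2 \<in> warped_metric l1 l2 A1 A2"
      using that by (auto simp: warped_metric_def)
    from S(3)[OF this order_refl] show ?thesis
      by (simp only: chart_map_warped_comp U_def chart_dom_warped)
  qed
  have U_open: "open (U c1 c2)" if "c1 \<in> A1" "c2 \<in> A2" for c1 c2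
    unfolding U_def using that riemannian_manifold_open_dom[OF A(1)] riemannian_manifold_open_dom[OF A(2)]
    by (intro open_path_vimage S open_Times) auto
  note cover = riemannian_manifold_cover[OF A(1)] riemannian_manifold_cover[OF A(2)]
  show ?thesis
  proof (intro conjI exI[of _ S] ballI)
    show "finite S" "path \<tau>" "path \<gamma>1" "path \<gamma>2" using S(1,2) by (auto simp: path_triple)
    have "\<tau> C1_differentiable_on (\<Union>(c1, c2)\<in>A1 \<times> A2. U c1 c2)"
      using C1_differentiable_on_bounded_linear[OF bounded_linear_fst C1] U_open
      by (intro C1_differentiable_on_open_UN) auto
    also have "(\<Union>(c1, c2)\<in>A1 \<times> A2. U c1 c2) = {0<..<1} - S"
      using cover by (fastforce simp: U_def)
    finally show "\<tau> C1_differentiable_on ({0<..<1} - S)" .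
  next
    fix c assume c: "c \<in> A1"
    have "(\<lambda>s. (chart_map c \<circ> \<gamma>1) s) C1_differentiable_on (\<Union>c2\<in>A2. U c c2)"
      using C1_differentiable_on_bounded_linear[OF
          bounded_linear_compose[OF bounded_linear_fst bounded_linear_snd] C1[OF c]] U_open[OF c]
      by (intro C1_differentiable_on_open_UN) auto
    also have "(\<Union>c2\<in>A2. U c c2) = ({0<..<1} - S) \<inter> \<gamma>1 -` chart_dom c"
      using cover by (fastforce simp: U_def)
    finally show "(chart_map c \<circ> \<gamma>1) C1_differentiable_on (({0<..<1} - S) \<inter> \<gamma>1 -` chart_dom c)"
      by (simp add: o_def)
  next
    fix c assume c: "c \<in> A2"
    have "(\<lambda>s. (chart_map c \<circ> \<gamma>2) s) C1_differentiable_on (\<Union>c1\<in>A1. U c1 c)"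
      using C1_differentiable_on_bounded_linear[OF
          bounded_linear_compose[OF bounded_linear_snd bounded_linear_snd] C1[OF _ c]] U_open[OF _ c]
      by (intro C1_differentiable_on_open_UN) auto
    also have "(\<Union>c1\<in>A1. U c1 c) = ({0<..<1} - S) \<inter> \<gamma>2 -` chart_dom c"
      using cover by (fastforce simp: U_def)
    finally show "(chart_map c \<circ> \<gamma>2) C1_differentiable_on (({0<..<1} - S) \<inter> \<gamma>2 -` chart_dom c)"
      by (simp add: o_def)
  qed
qed

text \<open>Whatever product chart \<open>SOME\<close> selects, its factors are charts of
  \<open>A1\<close> and \<open>A2\<close>. Chart independence of the speeds in the factors then
  turns the metric of that product chart into the stated expression.\<close>

lemma curve_speed_warped:
  fixes A1 :: "('a::{t2_space,second_countable_topology}, 'e::euclidean_space) rchart set"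
    and A2 :: "('b::{t2_space,second_countable_topology}, 'f::euclidean_space) rchart set"
  assumes A: "riemannian_manifold A1" "riemannian_manifold A2"
    and cont: "isCont \<gamma>1 t" "isCont \<gamma>2 t" and \<tau>: "(\<tau> has_vector_derivative \<tau>') (at t)"
    and 1: "\<And>c. c \<in> A1 \<Longrightarrow> \<gamma>1 t \<in> chart_dom c \<Longrightarrow> (chart_map c \<circ> \<gamma>1) differentiable at t"
    and 2: "\<And>c. c \<in> A2 \<Longrightarrow> \<gamma>2 t \<in> chart_dom c \<Longrightarrow> (chart_map c \<circ> \<gamma>2) differentiable at t"
  shows "curve_speed (warped_metric l1 l2 A1 A2) (\<lambda>s. (\<tau> s, \<gamma>1 s, \<gamma>2 s)) t =
    sqrt (\<tau>'\<^sup>2 + (l1 (\<tau> t) * curve_speed A1 \<gamma>1 t)\<^sup>2 + (l2 (\<tau> t) * curve_speed A2 \<gamma>2 t)\<^sup>2)"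
proof -
  let ?\<gamma> = "\<lambda>s. (\<tau> s, \<gamma>1 s, \<gamma>2 s)" and ?W = "warped_metric l1 l2 A1 A2"
  define c where "c = (SOME c. c \<in> ?W \<and> ?\<gamma> t \<in> chart_dom c)"
  have "\<exists>c. c \<in> ?W \<and> ?\<gamma> t \<in> chart_dom c"
  proof -
    obtain c1 c2 where "c1 \<in> A1" "\<gamma>1 t \<in> chart_dom c1" "c2 \<in> A2" "\<gamma>2 t \<in> chart_dom c2"
      using riemannian_manifold_cover[OF A(1)] riemannian_manifold_cover[OF A(2)] by metis
    then have "warped_chart l1 l2 c1 c2 \<in> ?W" "?\<gamma> t \<in> chart_dom (warped_chart l1 l2 c1 c2)"
      by (auto simp: warped_metric_def)
    then show ?thesis by blast
  qed
  then have c: "c \<in> ?W" "?\<gamma> t \<in> chart_dom c"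
    unfolding c_def by (metis (mono_tags, lifting) someI_ex)+
  from c(1) obtain c1 c2 where c12: "c = warped_chart l1 l2 c1 c2" "c1 \<in> A1" "c2 \<in> A2"
    by (rule warped_metricE)
  then have dom: "\<gamma>1 t \<in> chart_dom c1" "\<gamma>2 t \<in> chart_dom c2" using c(2) by auto
  obtain v1 where v1: "((chart_map c1 \<circ> \<gamma>1) has_vector_derivative v1) (at t)"
    using 1[OF c12(2) dom(1)] vector_derivative_works by blast
  obtain v2 where v2: "((chart_map c2 \<circ> \<gamma>2) has_vector_derivative v2) (at t)"
    using 2[OF c12(3) dom(2)] vector_derivative_works by blast
  have v: "vector_derivative (chart_map c \<circ> ?\<gamma>) (at t) = (\<tau>', v1, v2)"
    unfolding c12(1) chart_map_warped_comp
    by (intro vector_derivative_at has_vector_derivative_Pair \<tau> v1 v2)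
  note s1 = curve_speed_chart[OF A(1) c12(2) dom(1) cont(1) v1]
  note s2 = curve_speed_chart[OF A(2) c12(3) dom(2) cont(2) v2]
  have "0 \<le> chart_metric c1 (chart_map c1 (\<gamma>1 t)) v1 v1" "0 \<le> chart_metric c2 (chart_map c2 (\<gamma>2 t)) v2 v2"
    by (rule chart_metric_nonneg[OF A(1) c12(2)] chart_metric_nonneg[OF A(2) c12(3)];
        use dom in \<open>simp add: chart_im_def\<close>)+
  then show ?thesis
    unfolding curve_speed_def[of ?W] c_def[symmetric] Let_def v s1 s2 power_mult_distrib
    by (simp add: c12(1) warped_chart_def power2_eq_square)
qed

text \<open>The derivative may be unbounded near the exceptional parameters. Either its integral is
  infinite and the claim is void, or it is integrable and the fundamental theorem with finitely many
  exceptions applies.\<close>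

lemma abs_diff_le_nn_integral_deriv:
  fixes \<tau> :: "real \<Rightarrow> real"
  assumes S: "finite S" and \<tau>: "path \<tau>" "\<tau> C1_differentiable_on ({0<..<1} - S)"
    and uv: "0 \<le> u" "u \<le> v" "v \<le> 1"
  shows "ennreal \<bar>\<tau> v - \<tau> u\<bar> \<le> (\<integral>\<^sup>+s\<in>{0<..<1} - S. ennreal \<bar>vector_derivative \<tau> (at s)\<bar> \<partial>lborel)"
    (is "_ \<le> ?I")
proof (cases "?I = \<infinity>")
  case False
  define U where "U = {0<..<1} - S"
  define f where "f s = indicator U s *\<^sub>R vector_derivative \<tau> (at s)" for s
  have U: "open U" unfolding U_def using S by (intro open_Diff finite_imp_closed) auto
  have D: "(\<tau> has_vector_derivative vector_derivative \<tau> (at s)) (at s)" if "s \<in> U" for s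
    using \<tau>(2) that vector_derivative_works[of \<tau> "at s"] unfolding C1_differentiable_on_eq U_def by blast
  have "continuous_on U (\<lambda>s. vector_derivative \<tau> (at s))"
    using \<tau>(2) by (simp add: C1_differentiable_on_eq U_def)
  then have "f \<in> borel_measurable borel"
    unfolding f_def by (rule borel_measurable_continuous_on_indicator[OF borel_open[OF U]])
  then have meas [measurable]: "f \<in> borel_measurable lborel" by simp
  have norm_f: "(\<integral>\<^sup>+s. ennreal (norm (f s)) \<partial>lborel) = ?I"
    by (intro nn_integral_cong) (auto simp: f_def U_def indicator_def)
  then have "integrable lborel f"
    using False by (intro integrableI_bounded) (auto simp: less_top)
  then have int: "set_integrable lborel {u..v} f"
    unfolding set_integrable_def by (intro integrable_mult_indicator) auto
  have "(f has_integral \<tau> v - \<tau> u) {u..v}"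
  proof (rule fundamental_theorem_of_calculus_strong)
    show "finite (S \<union> {0, 1})" using S by simp
    show "continuous_on {u..v} \<tau>"
      using \<tau>(1) unfolding path_def by (rule continuous_on_subset) (use uv in auto)
    fix s assume "s \<in> {u..v} - (S \<union> {0, 1})"
    then have "s \<in> U" using uv by (auto simp: U_def)
    then show "(\<tau> has_vector_derivative f s) (at s)" using D by (simp add: f_def)
  qed (rule uv)
  then have "\<tau> v - \<tau> u = (LINT s:{u..v}|lborel. f s)"
    using set_borel_integral_eq_integral(2)[OF int] by (simp add: integral_unique)
  also have "ennreal \<bar>\<dots>\<bar> \<le> (\<integral>\<^sup>+s. ennreal (norm (indicator {u..v} s *\<^sub>R f s)) \<partial>lborel)"
    using integral_norm_bound_ennreal[OF int[unfolded set_integrable_def]]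
    by (simp add: set_lebesgue_integral_def)
  also have "\<dots> \<le> (\<integral>\<^sup>+s. ennreal (norm (f s)) \<partial>lborel)"
    by (intro nn_integral_mono) (auto simp: indicator_def)
  finally show ?thesis using norm_f by simp
qed simp

text \<open>Each bound keeps one of the three squares under the root in the warped speed. The time
  estimate is stated for every \<open>s\<close>, not only the endpoint, because it must confine the
  whole curve to times at which the warps are controlled.\<close>

lemma curve_length_warped_lower:
  fixes A1 :: "('a::{t2_space,second_countable_topology}, 'e::euclidean_space) rchart set"
    and A2 :: "('b::{t2_space,second_countable_topology}, 'f::euclidean_space) rchart set"
  assumes A: "riemannian_manifold A1" "riemannian_manifold A2"
    and \<gamma>: "piecewise_C1_curve (warped_metric l1 l2 A1 A2) (\<lambda>s. (\<tau> s, \<gamma>1 s, \<gamma>2 s))"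
  defines "len \<equiv> curve_length (warped_metric l1 l2 A1 A2) (\<lambda>s. (\<tau> s, \<gamma>1 s, \<gamma>2 s))"
  shows "s \<in> {0..1} \<Longrightarrow> ennreal \<bar>\<tau> s - \<tau> 0\<bar> \<le> len"
    and "piecewise_C1_curve A1 \<gamma>1" and "piecewise_C1_curve A2 \<gamma>2"
    and "0 < \<delta> \<Longrightarrow> (\<And>s. s \<in> {0..1} \<Longrightarrow> \<delta> \<le> l1 (\<tau> s)) \<Longrightarrow> ennreal \<delta> * curve_length A1 \<gamma>1 \<le> len"
    and "0 < \<delta> \<Longrightarrow> (\<And>s. s \<in> {0..1} \<Longrightarrow> \<delta> \<le> l2 (\<tau> s)) \<Longrightarrow> ennreal \<delta> * curve_length A2 \<gamma>2 \<le> len"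
proof -
  let ?\<gamma> = "\<lambda>s. (\<tau> s, \<gamma>1 s, \<gamma>2 s)" and ?W = "warped_metric l1 l2 A1 A2"
  obtain S where S: "finite S" and path: "path \<tau>" "path \<gamma>1" "path \<gamma>2"
    and \<tau>: "\<tau> C1_differentiable_on ({0<..<1} - S)"
    and C1: "\<And>c. c \<in> A1 \<Longrightarrow>
      (chart_map c \<circ> \<gamma>1) C1_differentiable_on (({0<..<1} - S) \<inter> \<gamma>1 -` chart_dom c)"
    and C2: "\<And>c. c \<in> A2 \<Longrightarrow>
      (chart_map c \<circ> \<gamma>2) C1_differentiable_on (({0<..<1} - S) \<inter> \<gamma>2 -` chart_dom c)"
    using piecewise_C1_curve_warpedD[OF A \<gamma>] by blast
  show "piecewise_C1_curve A1 \<gamma>1" "piecewise_C1_curve A2 \<gamma>2"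
    using S path C1 C2 by (auto intro: piecewise_C1_curveI)
  define U where "U = {0<..<1} - S"
  have U: "open U" unfolding U_def using S by (intro open_Diff finite_imp_closed) auto
  note interior = nn_set_integral_01_diff_finite[OF S, folded U_def]
  have speed: "curve_speed ?W ?\<gamma> s = sqrt ((vector_derivative \<tau> (at s))\<^sup>2 +
      (l1 (\<tau> s) * curve_speed A1 \<gamma>1 s)\<^sup>2 + (l2 (\<tau> s) * curve_speed A2 \<gamma>2 s)\<^sup>2)" if "s \<in> U" for s
  proof (rule curve_speed_warped[OF A])
    show "isCont \<gamma>1 s" "isCont \<gamma>2 s" using isCont_path path that by (auto simp: U_def)
    show "(\<tau> has_vector_derivative vector_derivative \<tau> (at s)) (at s)"
      using \<tau> that vector_derivative_works[of \<tau> "at s"] unfolding C1_differentiable_on_eq U_def by blast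
  qed (use C1 C2 that in \<open>auto simp: C1_differentiable_on_eq U_def\<close>)
  have len: "len = (\<integral>\<^sup>+s\<in>U. ennreal (curve_speed ?W ?\<gamma> s) \<partial>lborel)"
    unfolding len_def curve_length_def by (rule interior)
  show "ennreal \<bar>\<tau> s - \<tau> 0\<bar> \<le> len" if "s \<in> {0..1}"
  proof -
    have "ennreal \<bar>\<tau> s - \<tau> 0\<bar> \<le> (\<integral>\<^sup>+s\<in>U. ennreal \<bar>vector_derivative \<tau> (at s)\<bar> \<partial>lborel)"
      unfolding U_def by (rule abs_diff_le_nn_integral_deriv[OF S path(1) \<tau>]) (use that in auto)
    also have "\<dots> \<le> len"
      unfolding len
      by (intro nn_integral_mono) (auto simp: indicator_def speed intro!: ennreal_leI real_le_rsqrt)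
    finally show ?thesis .
  qed
  show "ennreal \<delta> * curve_length A1 \<gamma>1 \<le> len" if "0 < \<delta>" "\<And>s. s \<in> {0..1} \<Longrightarrow> \<delta> \<le> l1 (\<tau> s)"
  proof -
    have "(\<lambda>s. ennreal (curve_speed A1 \<gamma>1 s) * indicator U s) \<in> borel_measurable lborel"
      using continuous_on_curve_speed[OF A(1) path(2) S C1] U
      by (intro borel_measurable_indicator_ennreal) (auto simp: U_def)
    then have "ennreal \<delta> * curve_length A1 \<gamma>1 =
        (\<integral>\<^sup>+s. ennreal \<delta> * (ennreal (curve_speed A1 \<gamma>1 s) * indicator U s) \<partial>lborel)"
      unfolding curve_length_def interior by (simp add: nn_integral_cmult)
    also have "\<dots> \<le> len"
      unfolding len
    proof (intro nn_integral_mono)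
      fix s
      show "ennreal \<delta> * (ennreal (curve_speed A1 \<gamma>1 s) * indicator U s)
        \<le> ennreal (curve_speed ?W ?\<gamma> s) * indicator U s"
      proof (cases "s \<in> U \<and> 0 \<le> curve_speed A1 \<gamma>1 s")
        case True
        then have "\<delta> * curve_speed A1 \<gamma>1 s \<le> l1 (\<tau> s) * curve_speed A1 \<gamma>1 s"
          using that(2)[of s] by (intro mult_right_mono) (auto simp: U_def)
        also have "\<dots> \<le> curve_speed ?W ?\<gamma> s"
          using True by (simp add: speed real_le_rsqrt)
        finally show ?thesis
          using True that(1) by (simp add: ennreal_leI flip: ennreal_mult)
      qed (auto simp: indicator_def ennreal_neg)
    qed
    finally show ?thesis .
  qed
  show "ennreal \<delta> * curve_length A2 \<gamma>2 \<le> len" if "0 < \<delta>" "\<And>s. s \<in> {0..1} \<Longrightarrow> \<delta> \<le> l2 (\<tau> s)"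
  proof -
    have "(\<lambda>s. ennreal (curve_speed A2 \<gamma>2 s) * indicator U s) \<in> borel_measurable lborel"
      using continuous_on_curve_speed[OF A(2) path(3) S C2] U
      by (intro borel_measurable_indicator_ennreal) (auto simp: U_def)
    then have "ennreal \<delta> * curve_length A2 \<gamma>2 =
        (\<integral>\<^sup>+s. ennreal \<delta> * (ennreal (curve_speed A2 \<gamma>2 s) * indicator U s) \<partial>lborel)"
      unfolding curve_length_def interior by (simp add: nn_integral_cmult)
    also have "\<dots> \<le> len"
      unfolding len
    proof (intro nn_integral_mono)
      fix s
      show "ennreal \<delta> * (ennreal (curve_speed A2 \<gamma>2 s) * indicator U s)
        \<le> ennreal (curve_speed ?W ?\<gamma> s) * indicator U s"
      proof (cases "s \<in> U \<and> 0 \<le> curve_speed A2 \<gamma>2 s")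
        case True
        then have "\<delta> * curve_speed A2 \<gamma>2 s \<le> l2 (\<tau> s) * curve_speed A2 \<gamma>2 s"
          using that(2)[of s] by (intro mult_right_mono) (auto simp: U_def)
        also have "\<dots> \<le> curve_speed ?W ?\<gamma> s"
          using True by (simp add: speed real_le_rsqrt)
        finally show ?thesis
          using True that(1) by (simp add: ennreal_leI flip: ennreal_mult)
      qed (auto simp: indicator_def ennreal_neg)
    qed
    finally show ?thesis .
  qed
qed

lemma sqrt_sum3_squares_le:
  assumes "0 \<le> x" "0 \<le> y" "0 \<le> z"
  shows "sqrt (x\<^sup>2 + y\<^sup>2 + z\<^sup>2) \<le> x + y + z"
  by (rule real_le_lsqrt) (use assms in \<open>auto simp: power2_eq_square algebra_simps\<close>)

text \<open>Time moves affinely while both factor curves run simultaneously. The root of a sum of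
  squares is at most the sum, which separates the three lengths.\<close>

lemma curve_length_warped_upper:
  fixes A1 :: "('a::{t2_space,second_countable_topology}, 'e::euclidean_space) rchart set"
    and A2 :: "('b::{t2_space,second_countable_topology}, 'f::euclidean_space) rchart set"
  assumes A: "riemannian_manifold A1" "riemannian_manifold A2"
    and \<gamma>: "piecewise_C1_curve A1 \<gamma>1" "piecewise_C1_curve A2 \<gamma>2"
    and l: "\<And>t. t \<in> closed_segment u v \<Longrightarrow> 0 < l1 t \<and> l1 t \<le> L \<and> 0 < l2 t \<and> l2 t \<le> L"
  defines "\<gamma> \<equiv> \<lambda>s. (u + s * (v - u), \<gamma>1 s, \<gamma>2 s)"
  shows "piecewise_C1_curve (warped_metric l1 l2 A1 A2) \<gamma>"
    and "curve_length (warped_metric l1 l2 A1 A2) \<gamma> \<le>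
      ennreal \<bar>v - u\<bar> + ennreal L * curve_length A1 \<gamma>1 + ennreal L * curve_length A2 \<gamma>2"
proof -
  let ?W = "warped_metric l1 l2 A1 A2"
  obtain S1 where S1: "finite S1" "path \<gamma>1"
    "\<And>c S'. c \<in> A1 \<Longrightarrow> S1 \<subseteq> S' \<Longrightarrow>
      (chart_map c \<circ> \<gamma>1) C1_differentiable_on (({0<..<1} - S') \<inter> \<gamma>1 -` chart_dom c)"
    using piecewise_C1_curveD[OF \<gamma>(1)] by blast
  obtain S2 where S2: "finite S2" "path \<gamma>2"
    "\<And>c S'. c \<in> A2 \<Longrightarrow> S2 \<subseteq> S' \<Longrightarrow>
      (chart_map c \<circ> \<gamma>2) C1_differentiable_on (({0<..<1} - S') \<inter> \<gamma>2 -` chart_dom c)"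
    using piecewise_C1_curveD[OF \<gamma>(2)] by blast
  define S where "S = S1 \<union> S2"
  have S: "finite S" using S1 S2 by (simp add: S_def)
  have C1: "(chart_map c \<circ> \<gamma>1) C1_differentiable_on (({0<..<1} - S) \<inter> \<gamma>1 -` chart_dom c)"
    if "c \<in> A1" for c using S1(3)[OF that] by (simp add: S_def)
  have C2: "(chart_map c \<circ> \<gamma>2) C1_differentiable_on (({0<..<1} - S) \<inter> \<gamma>2 -` chart_dom c)"
    if "c \<in> A2" for c using S2(3)[OF that] by (simp add: S_def)
  have \<tau>': "((\<lambda>s. u + s * (v - u)) has_vector_derivative v - u) (at s)" for s
    by (auto intro!: derivative_eq_intros)
  show "piecewise_C1_curve ?W \<gamma>"
  proof (rule piecewise_C1_curveI[OF S])
    show "path \<gamma>"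
      unfolding \<gamma>_def path_triple using S1 S2 by (auto simp: path_def intro!: continuous_intros)
    fix c assume "c \<in> ?W"
    then obtain c1 c2 where c: "c = warped_chart l1 l2 c1 c2" "c1 \<in> A1" "c2 \<in> A2"
      by (rule warped_metricE)
    show "(chart_map c \<circ> \<gamma>) C1_differentiable_on (({0<..<1} - S) \<inter> \<gamma> -` chart_dom c)"
      unfolding c(1) \<gamma>_def chart_map_warped_comp chart_dom_warped
    proof (intro C1_differentiable_on_Pair)
      show "(\<lambda>s. u + s * (v - u)) C1_differentiable_on X" for X
        unfolding C1_differentiable_on_def using \<tau>' by (intro exI[of _ "\<lambda>_. v - u"]) auto
      show "(\<lambda>s. (chart_map c1 \<circ> \<gamma>1) s) C1_differentiable_on
          (({0<..<1} - S) \<inter> (\<lambda>s. (u + s * (v - u), \<gamma>1 s, \<gamma>2 s)) -`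
            (UNIV \<times> chart_dom c1 \<times> chart_dom c2))"
        by (rule C1_differentiable_on_subset[OF C1[OF c(2)]]) auto
      show "(\<lambda>s. (chart_map c2 \<circ> \<gamma>2) s) C1_differentiable_on
          (({0<..<1} - S) \<inter> (\<lambda>s. (u + s * (v - u), \<gamma>1 s, \<gamma>2 s)) -`
            (UNIV \<times> chart_dom c1 \<times> chart_dom c2))"
        by (rule C1_differentiable_on_subset[OF C2[OF c(3)]]) auto
    qed
  qed
  define U where "U = {0<..<1} - S"
  have U: "open U" unfolding U_def using S by (intro open_Diff finite_imp_closed) auto
  note interior = nn_set_integral_01_diff_finite[OF S, folded U_def]
  have meas1: "(\<lambda>s. ennreal (curve_speed A1 \<gamma>1 s) * indicator U s) \<in> borel_measurable lborel"
    using continuous_on_curve_speed[OF A(1) S1(2) S C1] U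
    by (intro borel_measurable_indicator_ennreal) (auto simp: U_def)
  have meas2: "(\<lambda>s. ennreal (curve_speed A2 \<gamma>2 s) * indicator U s) \<in> borel_measurable lborel"
    using continuous_on_curve_speed[OF A(2) S2(2) S C2] U
    by (intro borel_measurable_indicator_ennreal) (auto simp: U_def)
  have speed_le: "ennreal (curve_speed ?W \<gamma> s) * indicator U s \<le>
      ennreal \<bar>v - u\<bar> * indicator U s + ennreal L * (ennreal (curve_speed A1 \<gamma>1 s) * indicator U s) +
        ennreal L * (ennreal (curve_speed A2 \<gamma>2 s) * indicator U s)" for s
  proof (cases "s \<in> U")
    case True
    define \<tau> where "\<tau> = u + s * (v - u)"
    have "\<tau> \<in> closed_segment u v"
      using True by (auto simp: in_segment \<tau>_def U_def algebra_simps intro!: exI[of _ s])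
    note l = l[OF this]
    note nonneg = curve_speed_nonneg[OF A(1), of \<gamma>1 s] curve_speed_nonneg[OF A(2), of \<gamma>2 s]
    have "curve_speed ?W \<gamma> s = sqrt ((v - u)\<^sup>2 + (l1 \<tau> * curve_speed A1 \<gamma>1 s)\<^sup>2 +
        (l2 \<tau> * curve_speed A2 \<gamma>2 s)\<^sup>2)"
      unfolding \<gamma>_def \<tau>_def
      by (rule curve_speed_warped[OF A _ _ \<tau>'])
        (use True C1 C2 S1(2) S2(2) in \<open>auto simp: C1_differentiable_on_eq U_def intro: isCont_path\<close>)
    also have "\<dots> = sqrt (\<bar>v - u\<bar>\<^sup>2 + (l1 \<tau> * curve_speed A1 \<gamma>1 s)\<^sup>2 +
        (l2 \<tau> * curve_speed A2 \<gamma>2 s)\<^sup>2)" by simp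
    also have "\<dots> \<le> \<bar>v - u\<bar> + l1 \<tau> * curve_speed A1 \<gamma>1 s + l2 \<tau> * curve_speed A2 \<gamma>2 s"
      by (rule sqrt_sum3_squares_le) (use l nonneg in auto)
    also have "\<dots> \<le> \<bar>v - u\<bar> + L * curve_speed A1 \<gamma>1 s + L * curve_speed A2 \<gamma>2 s"
      by (intro add_mono mult_right_mono) (use l nonneg in auto)
    finally have "ennreal (curve_speed ?W \<gamma> s) \<le>
        ennreal (\<bar>v - u\<bar> + L * curve_speed A1 \<gamma>1 s + L * curve_speed A2 \<gamma>2 s)"
      by (rule ennreal_leI)
    also have "\<dots> = ennreal \<bar>v - u\<bar> + ennreal L * ennreal (curve_speed A1 \<gamma>1 s) +
        ennreal L * ennreal (curve_speed A2 \<gamma>2 s)"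
      using l nonneg by (simp add: ennreal_plus ennreal_mult)
    finally show ?thesis using True by simp
  qed simp
  have "curve_length ?W \<gamma> \<le>
      (\<integral>\<^sup>+s. ennreal \<bar>v - u\<bar> * indicator U s + ennreal L * (ennreal (curve_speed A1 \<gamma>1 s) * indicator U s) +
        ennreal L * (ennreal (curve_speed A2 \<gamma>2 s) * indicator U s) \<partial>lborel)"
    unfolding curve_length_def interior by (intro nn_integral_mono speed_le)
  also have "\<dots> = ennreal \<bar>v - u\<bar> * emeasure lborel U +
      ennreal L * curve_length A1 \<gamma>1 + ennreal L * curve_length A2 \<gamma>2"
    using meas1 meas2 U unfolding curve_length_def interior
    by (subst nn_integral_add; simp add: nn_integral_add nn_integral_cmult nn_integral_cmult_indicator)
  also have "\<dots> \<le> ennreal \<bar>v - u\<bar> * 1 + ennreal L * curve_length A1 \<gamma>1 + ennreal L * curve_length A2 \<gamma>2"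
  proof (intro add_right_mono mult_left_mono)
    have "emeasure lborel U \<le> emeasure lborel {0..1::real}"
      by (rule emeasure_mono) (auto simp: U_def)
    then show "emeasure lborel U \<le> 1" by simp
  qed auto
  finally show "curve_length ?W \<gamma> \<le>
      ennreal \<bar>v - u\<bar> + ennreal L * curve_length A1 \<gamma>1 + ennreal L * curve_length A2 \<gamma>2"
    by simp
qed

section \<open>Completeness of warped products\<close>

lemma riemannian_dist_less:
  assumes "riemannian_dist A x y < e"
  obtains \<gamma> where "piecewise_C1_curve A \<gamma>" "\<gamma> 0 = x" "\<gamma> 1 = y" "curve_length A \<gamma> < e"
proof -
  have "\<exists>\<gamma>. piecewise_C1_curve A \<gamma> \<and> pathstart \<gamma> = x \<and> pathfinish \<gamma> = y \<and> curve_length A \<gamma> < e"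
    using assms unfolding riemannian_dist_def INF_less_iff by blast
  then show thesis using that by (auto simp: pathstart_def pathfinish_def)
qed

lemma riemannian_dist_le:
  assumes "piecewise_C1_curve A \<gamma>"
  shows "riemannian_dist A (\<gamma> 0) (\<gamma> 1) \<le> curve_length A \<gamma>"
  unfolding riemannian_dist_def
  by (rule INF_lower) (use assms in \<open>auto simp: pathstart_def pathfinish_def\<close>)

text \<open>A strict bound on the infimum gives a curve of length less than \<open>e\<close>. Its
  time component stays within \<open>e\<close> of \<open>t\<close>, so lower bounds for the warps
  are needed only there.\<close>

lemma warped_dist_less:
  fixes A1 :: "('a::{t2_space,second_countable_topology}, 'e::euclidean_space) rchart set"
    and A2 :: "('b::{t2_space,second_countable_topology}, 'f::euclidean_space) rchart set"
  assumes A: "riemannian_manifold A1" "riemannian_manifold A2"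
    and less: "riemannian_dist (warped_metric l1 l2 A1 A2) (t, x1, x2) (t', x1', x2') < e"
  shows "ennreal \<bar>t' - t\<bar> < e"
    and "0 < \<delta> \<Longrightarrow> (\<And>s. ennreal \<bar>s - t\<bar> < e \<Longrightarrow> \<delta> \<le> l1 s \<and> \<delta> \<le> l2 s) \<Longrightarrow>
      ennreal \<delta> * riemannian_dist A1 x1 x1' < e \<and> ennreal \<delta> * riemannian_dist A2 x2 x2' < e"
proof -
  let ?W = "warped_metric l1 l2 A1 A2"
  obtain \<gamma> where \<gamma>: "piecewise_C1_curve ?W \<gamma>" "\<gamma> 0 = (t, x1, x2)" "\<gamma> 1 = (t', x1', x2')"
    "curve_length ?W \<gamma> < e"
    by (rule riemannian_dist_less[OF less])
  define \<tau> \<gamma>1 \<gamma>2 where "\<tau> = fst \<circ> \<gamma>" "\<gamma>1 = fst \<circ> snd \<circ> \<gamma>" "\<gamma>2 = snd \<circ> snd \<circ> \<gamma>"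
  note comps = this
  have \<gamma>_eq: "\<gamma> = (\<lambda>s. (\<tau> s, \<gamma>1 s, \<gamma>2 s))" by (simp add: comps)
  note low = curve_length_warped_lower[OF A \<gamma>(1)[unfolded \<gamma>_eq]]
  note len = \<gamma>(4)[unfolded \<gamma>_eq]
  have ends: "\<tau> 0 = t" "\<tau> 1 = t'" "\<gamma>1 0 = x1" "\<gamma>1 1 = x1'" "\<gamma>2 0 = x2" "\<gamma>2 1 = x2'"
    using \<gamma>(2,3) by (simp_all add: comps)
  have stay: "ennreal \<bar>\<tau> s - t\<bar> < e" if "s \<in> {0..1}" for s
    using low(1)[OF that] len ends by (simp add: le_less_trans)
  from stay[of 1] show "ennreal \<bar>t' - t\<bar> < e" using ends by simp
  assume \<delta>: "0 < \<delta>" and l: "\<And>s. ennreal \<bar>s - t\<bar> < e \<Longrightarrow> \<delta> \<le> l1 s \<and> \<delta> \<le> l2 s"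
  have "ennreal \<delta> * riemannian_dist A1 x1 x1' \<le> ennreal \<delta> * curve_length A1 \<gamma>1"
    using riemannian_dist_le[OF low(2)] ends by (intro mult_left_mono) auto
  also have "\<dots> < e" using low(4)[OF \<delta>] l[OF stay] len by (meson le_less_trans)
  finally have 1: "ennreal \<delta> * riemannian_dist A1 x1 x1' < e" .
  have "ennreal \<delta> * riemannian_dist A2 x2 x2' \<le> ennreal \<delta> * curve_length A2 \<gamma>2"
    using riemannian_dist_le[OF low(3)] ends by (intro mult_left_mono) auto
  also have "\<dots> < e" using low(5)[OF \<delta>] l[OF stay] len by (meson le_less_trans)
  finally show "ennreal \<delta> * riemannian_dist A1 x1 x1' < e \<and> ennreal \<delta> * riemannian_dist A2 x2 x2' < e"
    using 1 by simp
qed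

lemma warped_dist_le:
  fixes A1 :: "('a::{t2_space,second_countable_topology}, 'e::euclidean_space) rchart set"
    and A2 :: "('b::{t2_space,second_countable_topology}, 'f::euclidean_space) rchart set"
  assumes A: "riemannian_manifold A1" "riemannian_manifold A2"
    and l: "\<And>s. s \<in> closed_segment t t' \<Longrightarrow> 0 < l1 s \<and> l1 s \<le> L \<and> 0 < l2 s \<and> l2 s \<le> L"
    and d: "riemannian_dist A1 x1 x1' < ennreal e" "riemannian_dist A2 x2 x2' < ennreal e"
  shows "riemannian_dist (warped_metric l1 l2 A1 A2) (t, x1, x2) (t', x1', x2') \<le>
    ennreal (\<bar>t' - t\<bar> + 2 * L * e)"
proof -
  have L: "0 < L" using l[of t] by auto
  obtain \<gamma>1 where \<gamma>1: "piecewise_C1_curve A1 \<gamma>1" "\<gamma>1 0 = x1" "\<gamma>1 1 = x1'"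
    "curve_length A1 \<gamma>1 < ennreal e"
    by (rule riemannian_dist_less[OF d(1)])
  obtain \<gamma>2 where \<gamma>2: "piecewise_C1_curve A2 \<gamma>2" "\<gamma>2 0 = x2" "\<gamma>2 1 = x2'"
    "curve_length A2 \<gamma>2 < ennreal e"
    by (rule riemannian_dist_less[OF d(2)])
  have e: "0 < e" using d(1) by (metis ennreal_neg linorder_not_le not_less_zero)
  note up = curve_length_warped_upper[OF A \<gamma>1(1) \<gamma>2(1) l]
  have "riemannian_dist (warped_metric l1 l2 A1 A2) (t, x1, x2) (t', x1', x2') \<le>
      ennreal \<bar>t' - t\<bar> + ennreal L * curve_length A1 \<gamma>1 + ennreal L * curve_length A2 \<gamma>2"
    using order_trans[OF riemannian_dist_le[OF up(1)] up(2)] \<gamma>1 \<gamma>2 by simp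
  also have "\<dots> \<le> ennreal \<bar>t' - t\<bar> + ennreal L * ennreal e + ennreal L * ennreal e"
    using \<gamma>1(4) \<gamma>2(4) by (intro add_mono mult_left_mono) auto
  also have "\<dots> = ennreal (\<bar>t' - t\<bar> + 2 * L * e)"
    using L e by (simp flip: ennreal_mult ennreal_plus)
  finally show ?thesis .
qed

lemma continuous_pos_bounds:
  fixes l :: "real \<Rightarrow> real"
  assumes "continuous_on UNIV l" "\<And>t. 0 < l t"
  obtains \<delta> L where "0 < \<delta>" "\<And>t. t \<in> {a..b} \<Longrightarrow> \<delta> \<le> l t \<and> l t \<le> L"
proof (cases "a \<le> b")
  case True
  have c: "continuous_on {a..b} l" using assms(1) continuous_on_subset by blast
  obtain u where "u \<in> {a..b}" "\<forall>t\<in>{a..b}. l u \<le> l t"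
    using continuous_attains_inf[OF _ _ c] True by auto
  moreover obtain v where "v \<in> {a..b}" "\<forall>t\<in>{a..b}. l t \<le> l v"
    using continuous_attains_sup[OF _ _ c] True by auto
  ultimately show thesis using that[of "l u" "l v"] assms(2) by blast
qed (use that[of 1 1] in auto)

text \<open>Lower bounds for the warps near the limit time take a Cauchy sequence to the factors,
  and upper bounds there carry the limits back.\<close>

proposition riemannian_complete_warped:
  fixes A1 :: "('a::{t2_space,second_countable_topology}, 'e::euclidean_space) rchart set"
    and A2 :: "('b::{t2_space,second_countable_topology}, 'f::euclidean_space) rchart set"
  assumes A: "riemannian_manifold A1" "riemannian_manifold A2"
    and complete: "riemannian_complete A1" "riemannian_complete A2"
    and l1: "continuous_on UNIV l1" "\<And>t. 0 < l1 t" and l2: "continuous_on UNIV l2" "\<And>t. 0 < l2 t"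
  shows "riemannian_complete (warped_metric l1 l2 A1 A2)"
  unfolding riemannian_complete_def
proof (intro allI impI)
  let ?W = "warped_metric l1 l2 A1 A2"
  fix X :: "nat \<Rightarrow> real \<times> 'a \<times> 'b"
  assume Cauchy: "\<forall>e>0. \<exists>N. \<forall>m\<ge>N. \<forall>n\<ge>N. riemannian_dist ?W (X m) (X n) < e"
  define T Y Z where "T n = fst (X n)" "Y n = fst (snd (X n))" "Z n = snd (snd (X n))" for n
  have X: "X n = (T n, Y n, Z n)" for n by (simp add: T_Y_Z_def)
  have "Cauchy T"
  proof (rule metric_CauchyI)
    fix e :: real assume "0 < e"
    then obtain N where N: "\<And>m n. N \<le> m \<Longrightarrow> N \<le> n \<Longrightarrow> riemannian_dist ?W (X m) (X n) < ennreal e"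
      using Cauchy by (metis ennreal_less_zero_iff)
    have "dist (T m) (T n) < e" if "N \<le> m" "N \<le> n" for m n
      using warped_dist_less(1)[OF A N[OF that, unfolded X]]
      by (simp add: dist_real_def abs_minus_commute ennreal_less_iff)
    then show "\<exists>N. \<forall>m\<ge>N. \<forall>n\<ge>N. dist (T m) (T n) < e" by blast
  qed
  then obtain t where t: "T \<longlonglongrightarrow> t" using Cauchy_convergent convergent_def by blast
  define I where "I = {t - 1..t + 1}"
  obtain \<delta>1 L1 where 1: "0 < \<delta>1" "\<And>s. s \<in> I \<Longrightarrow> \<delta>1 \<le> l1 s \<and> l1 s \<le> L1"
    unfolding I_def using continuous_pos_bounds[OF l1] by blast
  obtain \<delta>2 L2 where 2: "0 < \<delta>2" "\<And>s. s \<in> I \<Longrightarrow> \<delta>2 \<le> l2 s \<and> l2 s \<le> L2"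
    unfolding I_def using continuous_pos_bounds[OF l2] by blast
  define \<delta> where "\<delta> = min \<delta>1 \<delta>2"
  define L where "L = max L1 L2"
  have \<delta>: "0 < \<delta>" "\<And>s. s \<in> I \<Longrightarrow> \<delta> \<le> l1 s \<and> \<delta> \<le> l2 s"
    using 1 2 by (force simp: \<delta>_def)+
  have L: "\<And>s. s \<in> I \<Longrightarrow> 0 < l1 s \<and> l1 s \<le> L \<and> 0 < l2 s \<and> l2 s \<le> L"
    using 1 2 l1 l2 by (force simp: L_def)
  have "t \<in> I" by (simp add: I_def)
  then have L_pos: "0 < L" using L by force
  obtain N0 where N0: "\<And>n. N0 \<le> n \<Longrightarrow> \<bar>T n - t\<bar> < 1/2"
    using LIMSEQ_D[OF t, of "1/2"] by auto
  have "\<exists>N. \<forall>m\<ge>N. \<forall>n\<ge>N. riemannian_dist A1 (Y m) (Y n) < e \<and> riemannian_dist A2 (Z m) (Z n) < e"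
    if "0 < e" for e
  proof -
    \<comment> \<open>The first entry leaves room for division by \<open>\<delta>\<close>. The
      second, together with \<open>\<bar>T m - t\<bar> < 1/2\<close>, keeps all relevant times in
      \<open>I\<close>, even when \<open>e\<close> is infinite.\<close>
    define e' where "e' = min (ennreal \<delta> * e) (ennreal (1/2))"
    have "0 < ennreal (1/2)" by (rule ennreal_less_zero_iff[THEN iffD2]) simp
    then have "0 < e'"
      using that \<delta>(1) unfolding e'_def min_less_iff_conj by (simp add: ennreal_zero_less_mult_iff)
    then obtain N1 where N1: "\<And>m n. N1 \<le> m \<Longrightarrow> N1 \<le> n \<Longrightarrow> riemannian_dist ?W (X m) (X n) < e'"
      using Cauchy by metis
    have "riemannian_dist A1 (Y m) (Y n) < e \<and> riemannian_dist A2 (Z m) (Z n) < e"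
      if mn: "max N0 N1 \<le> m" "max N0 N1 \<le> n" for m n
    proof -
      have "\<delta> \<le> l1 s \<and> \<delta> \<le> l2 s" if "ennreal \<bar>s - T m\<bar> < e'" for s
      proof -
        have "ennreal \<bar>s - T m\<bar> < ennreal (1/2)" using that unfolding e'_def min_less_iff_conj by blast
        then have "\<bar>s - T m\<bar> < 1/2" by (subst (asm) ennreal_less_iff) auto
        moreover have "\<bar>T m - t\<bar> < 1/2" using mn by (intro N0) simp
        ultimately have "s \<in> I" unfolding I_def atLeastAtMost_iff by linarith
        then show ?thesis by (rule \<delta>(2))
      qed
      from warped_dist_less(2)[OF A N1[of m n, unfolded X] \<delta>(1) this] mn
      have "ennreal \<delta> * riemannian_dist A1 (Y m) (Y n) < ennreal \<delta> * e"
        "ennreal \<delta> * riemannian_dist A2 (Z m) (Z n) < ennreal \<delta> * e"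
        by (auto simp: e'_def)
      then show ?thesis by (meson linorder_not_le mult_left_mono zero_le)
    qed
    then show ?thesis by blast
  qed
  then have "\<forall>e>0. \<exists>N. \<forall>m\<ge>N. \<forall>n\<ge>N. riemannian_dist A1 (Y m) (Y n) < e"
    "\<forall>e>0. \<exists>N. \<forall>m\<ge>N. \<forall>n\<ge>N. riemannian_dist A2 (Z m) (Z n) < e" by blast+
  then obtain y z where y: "(\<lambda>n. riemannian_dist A1 (Y n) y) \<longlonglongrightarrow> 0"
    and z: "(\<lambda>n. riemannian_dist A2 (Z n) z) \<longlonglongrightarrow> 0"
    using complete unfolding riemannian_complete_def by metis
  have "(\<lambda>n. riemannian_dist ?W (X n) (t, y, z)) \<longlonglongrightarrow> 0"
  proof (rule tendsto_zero_ennreal)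
    fix r :: real assume r: "0 < r"
    \<comment> \<open>Chosen so that \<open>2 * L * e = r / 2\<close>. The time difference
      contributes less than the other half.\<close>
    define e where "e = r / (4 * L)"
    have e: "0 < ennreal e" using r L_pos by (simp add: e_def)
    have "\<forall>\<^sub>F n in sequentially. \<bar>T n - t\<bar> < min (r / 2) 1"
      using tendstoD[OF t, of "min (r / 2) 1"] r by (simp add: dist_real_def)
    moreover note order_tendstoD(2)[OF y e] order_tendstoD(2)[OF z e]
    ultimately show "\<forall>\<^sub>F n in sequentially. riemannian_dist ?W (X n) (t, y, z) < ennreal r"
    proof eventually_elim
      case (elim n)
      have "closed_segment (T n) t \<subseteq> I"
        using elim(1) by (auto simp: closed_segment_eq_real_ivl I_def split: if_splits)
      then have "riemannian_dist ?W (X n) (t, y, z) \<le> ennreal (\<bar>t - T n\<bar> + 2 * L * e)"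
        unfolding X using L elim(2,3) by (intro warped_dist_le[OF A]) auto
      also have "\<bar>t - T n\<bar> + 2 * L * e < r"
        using elim(1) L_pos by (simp add: e_def abs_minus_commute[of t])
      then have "ennreal (\<bar>t - T n\<bar> + 2 * L * e) < ennreal r"
        by (rule ennreal_lessI[OF r])
      finally show ?case .
    qed
  qed
  then show "\<exists>x. (\<lambda>n. riemannian_dist ?W (X n) x) \<longlonglongrightarrow> 0" by blast
qed

section \<open>The profile equation\<close>

text \<open>Tailored to \<open>c1_implies_local_lipschitz\<close>: the derivative in the state is
  jointly continuous, while time enters only continuously. As a predicate with closure rules it lets
  local Lipschitz continuity be read off from the formula of the field.\<close>

definition C1_family :: "'a::real_normed_vector set \<Rightarrow> (real \<Rightarrow> 'a \<Rightarrow> 'b::real_normed_vector) \<Rightarrow> bool" where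
  "C1_family X f \<longleftrightarrow> continuous_on (UNIV \<times> X) (\<lambda>z. f (fst z) (snd z)) \<and>
    (\<exists>f'. continuous_on (UNIV \<times> X) f' \<and>
      (\<forall>t. \<forall>x\<in>X. (f t has_derivative blinfun_apply (f' (t, x))) (at x)))"

lemma C1_familyI:
  assumes "continuous_on (UNIV \<times> X) (\<lambda>z. f (fst z) (snd z))" "continuous_on (UNIV \<times> X) f'"
    "\<And>t x. x \<in> X \<Longrightarrow> (f t has_derivative blinfun_apply (f' (t, x))) (at x)"
  shows "C1_family X f"
  using assms unfolding C1_family_def by blast

lemma C1_family_imp_local_lipschitz:
  fixes f :: "real \<Rightarrow> 'a::{banach, heine_borel} \<Rightarrow> 'a"
  assumes "C1_family X f" "open X"
  shows "local_lipschitz UNIV X f"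
proof -
  obtain f' where "continuous_on (UNIV \<times> X) f'"
    "\<And>t x. x \<in> X \<Longrightarrow> (f t has_derivative blinfun_apply (f' (t, x))) (at x)"
    using assms(1) unfolding C1_family_def by blast
  then show ?thesis using assms(2) by (intro c1_implies_local_lipschitz[of UNIV X f f']) auto
qed

lemma C1_family_time:
  assumes "continuous_on UNIV g"
  shows "C1_family X (\<lambda>t x. g t)"
proof (rule C1_familyI)
  show "continuous_on (UNIV \<times> X) (\<lambda>z. g (fst z))"
    by (rule continuous_on_compose2[OF assms]) (auto intro: continuous_intros)
  show "continuous_on (UNIV \<times> X) (\<lambda>_. 0 :: 'b \<Rightarrow>\<^sub>L 'a)" by simp
qed (simp add: zero_blinfun.rep_eq)

lemma C1_family_bounded_linear:
  assumes "bounded_linear h"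
  shows "C1_family X (\<lambda>t x. h x)"
proof (rule C1_familyI)
  show "continuous_on (UNIV \<times> X) (\<lambda>z. h (snd z))"
    by (intro bounded_linear.continuous_on[OF assms] continuous_intros)
  show "continuous_on (UNIV \<times> X) (\<lambda>_. Blinfun h)" by simp
  show "(h has_derivative blinfun_apply (Blinfun h)) (at x)" for x
    using assms by (simp add: bounded_linear_Blinfun_apply bounded_linear_imp_has_derivative)
qed

lemma C1_family_add:
  assumes "C1_family X f" "C1_family X g"
  shows "C1_family X (\<lambda>t x. f t x + g t x)"
proof -
  obtain f' where f: "continuous_on (UNIV \<times> X) (\<lambda>z. f (fst z) (snd z))" "continuous_on (UNIV \<times> X) f'"
    "\<And>t x. x \<in> X \<Longrightarrow> (f t has_derivative blinfun_apply (f' (t, x))) (at x)"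
    using assms(1) unfolding C1_family_def by blast
  obtain g' where g: "continuous_on (UNIV \<times> X) (\<lambda>z. g (fst z) (snd z))" "continuous_on (UNIV \<times> X) g'"
    "\<And>t x. x \<in> X \<Longrightarrow> (g t has_derivative blinfun_apply (g' (t, x))) (at x)"
    using assms(2) unfolding C1_family_def by blast
  show ?thesis
  proof (rule C1_familyI)
    show "continuous_on (UNIV \<times> X) (\<lambda>z. f' z + g' z)" using f g by (intro continuous_intros)
    show "((\<lambda>x. f t x + g t x) has_derivative blinfun_apply (f' (t, x) + g' (t, x))) (at x)"
      if "x \<in> X" for t x
      using has_derivative_add[OF f(3)[OF that] g(3)[OF that]]
      by (simp add: plus_blinfun.rep_eq)
  qed (use f g in \<open>auto intro: continuous_intros\<close>)
qed

lemma C1_family_mult: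
  fixes f g :: "real \<Rightarrow> 'a::real_normed_vector \<Rightarrow> real"
  assumes "C1_family X f" "C1_family X g"
  shows "C1_family X (\<lambda>t x. f t x * g t x)"
proof -
  obtain f' where f: "continuous_on (UNIV \<times> X) (\<lambda>z. f (fst z) (snd z))" "continuous_on (UNIV \<times> X) f'"
    "\<And>t x. x \<in> X \<Longrightarrow> (f t has_derivative blinfun_apply (f' (t, x))) (at x)"
    using assms(1) unfolding C1_family_def by blast
  obtain g' where g: "continuous_on (UNIV \<times> X) (\<lambda>z. g (fst z) (snd z))" "continuous_on (UNIV \<times> X) g'"
    "\<And>t x. x \<in> X \<Longrightarrow> (g t has_derivative blinfun_apply (g' (t, x))) (at x)"
    using assms(2) unfolding C1_family_def by blast
  show ?thesis
  proof (rule C1_familyI)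
    show "continuous_on (UNIV \<times> X) (\<lambda>z. f (fst z) (snd z) *\<^sub>R g' z + g (fst z) (snd z) *\<^sub>R f' z)"
      using f g by (intro continuous_intros)
    show "((\<lambda>x. f t x * g t x) has_derivative blinfun_apply
        (f (fst (t, x)) (snd (t, x)) *\<^sub>R g' (t, x) + g (fst (t, x)) (snd (t, x)) *\<^sub>R f' (t, x))) (at x)"
      if "x \<in> X" for t x
      using has_derivative_mult[OF f(3)[OF that] g(3)[OF that]]
      by (rule has_derivative_eq_rhs) (auto simp: blinfun.add_left blinfun.scaleR_left)
  qed (use f g in \<open>auto intro: continuous_intros\<close>)
qed

lemma C1_family_compose:
  fixes f :: "real \<Rightarrow> 'a::real_normed_vector \<Rightarrow> real"
  assumes "C1_family X f" and Y: "\<And>t x. x \<in> X \<Longrightarrow> f t x \<in> Y"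
    and \<phi>: "\<And>y. y \<in> Y \<Longrightarrow> (\<phi> has_real_derivative \<phi>' y) (at y)" "continuous_on Y \<phi>'"
  shows "C1_family X (\<lambda>t x. \<phi> (f t x))"
proof -
  obtain f' where f: "continuous_on (UNIV \<times> X) (\<lambda>z. f (fst z) (snd z))" "continuous_on (UNIV \<times> X) f'"
    "\<And>t x. x \<in> X \<Longrightarrow> (f t has_derivative blinfun_apply (f' (t, x))) (at x)"
    using assms(1) unfolding C1_family_def by blast
  have "continuous_on Y \<phi>"
    using \<phi>(1) by (meson DERIV_isCont continuous_at_imp_continuous_on)
  show ?thesis
  proof (rule C1_familyI)
    show "continuous_on (UNIV \<times> X) (\<lambda>z. \<phi> (f (fst z) (snd z)))"
      by (rule continuous_on_compose2[OF \<open>continuous_on Y \<phi>\<close> f(1)]) (use Y in auto)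
    show "continuous_on (UNIV \<times> X) (\<lambda>z. \<phi>' (f (fst z) (snd z)) *\<^sub>R f' z)"
      using f Y by (intro continuous_on_scaleR continuous_on_compose2[OF \<phi>(2) f(1)]) auto
    show "((\<lambda>x. \<phi> (f t x)) has_derivative blinfun_apply (\<phi>' (f (fst (t, x)) (snd (t, x))) *\<^sub>R f' (t, x))) (at x)"
      if "x \<in> X" for t x
      using has_derivative_compose[OF f(3)[OF that] \<phi>(1)[OF Y[OF that], unfolded has_field_derivative_def]]
      by (rule has_derivative_eq_rhs) (auto simp: blinfun.scaleR_left)
  qed
qed

lemma C1_family_scaleR_const:
  assumes "C1_family X f"
  shows "C1_family X (\<lambda>t x. f t x *\<^sub>R v)"
proof -
  obtain f' where f: "continuous_on (UNIV \<times> X) (\<lambda>z. f (fst z) (snd z))" "continuous_on (UNIV \<times> X) f'"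
    "\<And>t x. x \<in> X \<Longrightarrow> (f t has_derivative blinfun_apply (f' (t, x))) (at x)"
    using assms unfolding C1_family_def by blast
  show ?thesis
  proof (rule C1_familyI)
    show "continuous_on (UNIV \<times> X) (\<lambda>z. f (fst z) (snd z) *\<^sub>R v)" using f by (intro continuous_intros)
    show "continuous_on (UNIV \<times> X) (\<lambda>z. blinfun_scaleR_left v o\<^sub>L f' z)"
      by (rule bounded_bilinear.continuous_on[OF bounded_bilinear_blinfun_compose]) (use f in auto)
    show "((\<lambda>x. f t x *\<^sub>R v) has_derivative blinfun_apply (blinfun_scaleR_left v o\<^sub>L f' (t, x))) (at x)"
      if "x \<in> X" for t x
      by (rule has_derivative_eq_rhs[OF
            bounded_linear.has_derivative[OF bounded_linear_scaleR_left f(3)[OF that]]])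
        (simp add: fun_eq_iff)
  qed
qed

section \<open>The functions \<open>Q\<close> and \<open>W\<close> on the plane of pairs
  \<open>(a, a')\<close>\<close>

definition profile_Q :: "real \<Rightarrow> real \<Rightarrow> real" where
  "profile_Q c a = 1 + (c\<^sup>2 - 1) * a\<^sup>2"

definition profile_W :: "real \<Rightarrow> real \<times> real \<Rightarrow> real" where
  "profile_W c z = (fst z)\<^sup>2 * (1 - (fst z)\<^sup>2 - (snd z)\<^sup>2) / profile_Q c (fst z)"

lemma profile_domainD:
  assumes "z \<in> profile_domain"
  shows "0 < fst z" "fst z < 1" "0 < 1 - (fst z)\<^sup>2 - (snd z)\<^sup>2"
  using assms by (auto simp: profile_domain_def)

lemma profile_domain_eq:
  "profile_domain = {z. 0 < fst z} \<inter> {z. fst z < 1} \<inter> {z. 0 < 1 - (fst z)\<^sup>2 - (snd z)\<^sup>2}"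
  by (auto simp: profile_domain_def)

lemma open_profile_domain: "open profile_domain"
  unfolding profile_domain_eq by (intro open_Int open_Collect_less continuous_intros)

text \<open>Writing \<open>Q = (1 - a^2) * 1 + a^2 * c^2\<close> shows a convex combination of 1 and
  \<open>c^2\<close>.\<close>

lemma profile_Q_ge:
  assumes "0 < a" "a < 1"
  shows "min 1 (c\<^sup>2) \<le> profile_Q c a"
proof -
  have "a\<^sup>2 \<le> 1" using assms by (simp add: power_le_one)
  then have "min 1 (c\<^sup>2) * (1 - a\<^sup>2) \<le> 1 * (1 - a\<^sup>2)" "min 1 (c\<^sup>2) * a\<^sup>2 \<le> c\<^sup>2 * a\<^sup>2"
    by (intro mult_right_mono; simp)+
  then show ?thesis by (simp add: profile_Q_def algebra_simps)
qed

context
  fixes c :: real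
  assumes c: "c \<noteq> 0"
begin

lemma min_1_square_pos: "0 < min 1 (c\<^sup>2)" using c by simp

lemma profile_Q_pos: "z \<in> profile_domain \<Longrightarrow> 0 < profile_Q c (fst z)"
  using profile_Q_ge[of "fst z" c] profile_domainD[of z] min_1_square_pos by linarith

lemma profile_W_pos: "z \<in> profile_domain \<Longrightarrow> 0 < profile_W c z"
  using profile_Q_pos[of z] profile_domainD[of z] by (simp add: profile_W_def)

lemma profile_W_le:
  assumes z: "z \<in> profile_domain"
  shows "profile_W c z \<le> 1 / min 1 (c\<^sup>2)"
proof -
  note D = profile_domainD[OF z]
  have "(fst z)\<^sup>2 * (1 - (fst z)\<^sup>2 - (snd z)\<^sup>2) \<le> 1 * 1"
    using D by (intro mult_mono) (auto simp: power_le_one)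
  then show ?thesis
    unfolding profile_W_def using profile_Q_ge[OF D(1,2)] min_1_square_pos D by (intro frac_le) auto
qed

end

text \<open>In \<open>profile_acc\<close> the last factor of the product is \<open>(a + a'') / (a R)\<close>, read off from the
  equation for \<open>T\<close>. The exponential is \<open>1 / l2^2\<close>, where \<open>l2\<close> has been eliminated with \<open>l1^k1 * l2^k2 = F\<close> and
  \<open>F^2 = \<epsilon> / W\<close>.\<close>

definition inv_l2_sq ::
  "nat \<Rightarrow> nat \<Rightarrow> real \<Rightarrow> real \<Rightarrow> real \<Rightarrow> real" where
  "inv_l2_sq k1 k2 \<epsilon> l W = exp ((2 * real k1 * ln l + ln W - ln \<epsilon>) / real k2)"

definition profile_acc ::
  "nat \<Rightarrow> nat \<Rightarrow> real \<Rightarrow> real \<Rightarrow> real \<Rightarrow> real \<Rightarrow> (real \<Rightarrow> real) \<Rightarrow> real \<Rightarrow> real \<times> real \<Rightarrow> real" where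
  "profile_acc k1 k2 d1 d2 c \<epsilon> l t z =
    fst z * (1 - (fst z)\<^sup>2 - (snd z)\<^sup>2) *
      (1 / ((fst z)\<^sup>2 * profile_Q c (fst z)) + d1 / (l t)\<^sup>2
        - d2 * inv_l2_sq k1 k2 \<epsilon> (l t) (profile_W c z)) - fst z"

definition profile_field ::
  "nat \<Rightarrow> nat \<Rightarrow> real \<Rightarrow> real \<Rightarrow> real \<Rightarrow> real \<Rightarrow> (real \<Rightarrow> real) \<Rightarrow> real \<Rightarrow> real \<times> real \<Rightarrow> real \<times> real" where
  "profile_field k1 k2 d1 d2 c \<epsilon> l t z = (snd z, profile_acc k1 k2 d1 d2 c \<epsilon> l t z)"

lemma C1_family_inverse:
  fixes f :: "real \<Rightarrow> 'a::real_normed_vector \<Rightarrow> real"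
  assumes "C1_family X f" "\<And>t x. x \<in> X \<Longrightarrow> 0 < f t x"
  shows "C1_family X (\<lambda>t x. inverse (f t x))"
  by (rule C1_family_compose[OF assms(1), of "{0<..}" inverse "\<lambda>y. - (inverse y)\<^sup>2"])
    (use assms(2) in \<open>auto intro!: derivative_eq_intros continuous_intros simp: power2_eq_square\<close>)

lemma C1_family_ln:
  fixes f :: "real \<Rightarrow> 'a::real_normed_vector \<Rightarrow> real"
  assumes "C1_family X f" "\<And>t x. x \<in> X \<Longrightarrow> 0 < f t x"
  shows "C1_family X (\<lambda>t x. ln (f t x))"
  by (rule C1_family_compose[OF assms(1), of "{0<..}" ln "\<lambda>y. 1 / y"])
    (use assms(2) in \<open>auto intro!: derivative_eq_intros continuous_intros\<close>)

lemma C1_family_exp: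
  fixes f :: "real \<Rightarrow> 'a::real_normed_vector \<Rightarrow> real"
  assumes "C1_family X f"
  shows "C1_family X (\<lambda>t x. exp (f t x))"
  by (rule C1_family_compose[OF assms, of UNIV exp exp]) (auto intro: continuous_intros)

lemma C1_family_diff:
  fixes f g :: "real \<Rightarrow> 'a::real_normed_vector \<Rightarrow> real"
  assumes "C1_family X f" "C1_family X g"
  shows "C1_family X (\<lambda>t x. f t x - g t x)"
  using C1_family_add[OF assms(1) C1_family_mult[OF C1_family_time[of "\<lambda>_. -1"] assms(2)]] by simp

lemmas C1_family_intros = C1_family_add C1_family_diff C1_family_mult C1_family_inverse
  C1_family_ln C1_family_exp C1_family_time
  C1_family_bounded_linear[OF bounded_linear_fst] C1_family_bounded_linear[OF bounded_linear_snd]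

lemma C1_family_profile_field:
  assumes c: "c \<noteq> 0" and l: "continuous_on UNIV l" "\<And>t. 0 < l t"
  shows "C1_family profile_domain (profile_field k1 k2 d1 d2 c \<epsilon> l)"
proof -
  let ?D = profile_domain
  have Q: "C1_family ?D (\<lambda>t z. profile_Q c (fst z))"
    unfolding profile_Q_def power2_eq_square by (intro C1_family_intros continuous_intros)
  have R: "C1_family ?D (\<lambda>t z. 1 - (fst z)\<^sup>2 - (snd z)\<^sup>2)"
    unfolding power2_eq_square by (intro C1_family_intros continuous_intros)
  have W: "C1_family ?D (\<lambda>t z. profile_W c z)"
    unfolding profile_W_def divide_inverse power2_eq_square[of "fst _"]
    by (intro C1_family_intros R[unfolded power2_eq_square[of "fst _"]] Q profile_Q_pos[OF c])
  have l2: "continuous_on UNIV (\<lambda>t. (2 * real k1 * ln (l t) - ln \<epsilon>) / real k2)"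
    using l by (auto intro!: continuous_intros simp: less_imp_neq[symmetric] divide_inverse)
  \<comment> \<open>The exponent is split into a part depending on time alone, where continuity
    suffices, and a multiple of \<open>ln W\<close>, which depends on the state alone.\<close>
  have "inv_l2_sq k1 k2 \<epsilon> (l t) (profile_W c z) =
      exp ((2 * real k1 * ln (l t) - ln \<epsilon>) / real k2 + inverse (real k2) * ln (profile_W c z))" for t z
    by (simp add: inv_l2_sq_def diff_divide_distrib add_divide_distrib divide_inverse algebra_simps)
  moreover have "C1_family ?D (\<lambda>t z.
      exp ((2 * real k1 * ln (l t) - ln \<epsilon>) / real k2 + inverse (real k2) * ln (profile_W c z)))"
    by (intro C1_family_intros W l2 profile_W_pos[OF c] continuous_intros)
  ultimately have E: "C1_family ?D (\<lambda>t z. inv_l2_sq k1 k2 \<epsilon> (l t) (profile_W c z))"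
    by simp
  have aQ: "C1_family ?D (\<lambda>t z. inverse ((fst z)\<^sup>2 * profile_Q c (fst z)))"
    unfolding power2_eq_square
    by (intro C1_family_intros Q) (simp add: profile_domainD profile_Q_pos[OF c])
  have dl: "continuous_on UNIV (\<lambda>t. d1 / (l t)\<^sup>2)"
    using l by (auto intro!: continuous_intros simp: less_imp_neq[symmetric])
  have "C1_family ?D (profile_acc k1 k2 d1 d2 c \<epsilon> l)"
    unfolding profile_acc_def[abs_def] divide_inverse[of 1] mult_1_left
    by (intro C1_family_intros R E aQ dl continuous_intros)
  then have "C1_family ?D (\<lambda>t z. snd z *\<^sub>R (1 :: real, 0 :: real) + profile_acc k1 k2 d1 d2 c \<epsilon> l t z *\<^sub>R (0, 1))"
    by (intro C1_family_add C1_family_scaleR_const C1_family_intros)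
  then show ?thesis unfolding profile_field_def[abs_def] by simp
qed

text \<open>Convex, as the closest point projection requires. For small \<open>\<eta>\<close> the
  half plane keeps \<open>a\<close> away from 0 and the disc keeps \<open>1 - a^2 - a'^2\<close>
  away from 0, so these sets exhaust \<open>profile_domain\<close>.\<close>

definition profile_region :: "real \<Rightarrow> (real \<times> real) set" where
  "profile_region \<eta> = {z. \<eta> \<le> fst z} \<inter> cball 0 (sqrt (1 - \<eta>))"

lemma compact_profile_region: "compact (profile_region \<eta>)"
  unfolding profile_region_def
  by (intro closed_Int_compact compact_cball closed_Collect_le continuous_intros)

lemma convex_profile_region: "convex (profile_region \<eta>)"
proof -
  have "{z :: real \<times> real. \<eta> \<le> fst z} = {z. inner (1, 0) z \<ge> \<eta>}" by auto
  then show ?thesis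
    unfolding profile_region_def by (intro convex_Int convex_cball) (simp add: convex_halfspace_ge)
qed

lemma profile_region_subset:
  assumes "0 < \<eta>"
  shows "profile_region \<eta> \<subseteq> profile_domain"
proof
  fix z assume z: "z \<in> profile_region \<eta>"
  then have "sqrt ((fst z)\<^sup>2 + (snd z)\<^sup>2) \<le> sqrt (1 - \<eta>)" and a: "\<eta> \<le> fst z"
    by (simp_all add: profile_region_def norm_prod_def)
  then have "(fst z)\<^sup>2 + (snd z)\<^sup>2 \<le> 1 - \<eta>" by simp
  then have *: "(fst z)\<^sup>2 + (snd z)\<^sup>2 < 1" using assms by simp
  then have "(fst z)\<^sup>2 < 1" using zero_le_power2[of "snd z"] by linarith
  then have "fst z < 1" using power_less_imp_less_base[of "fst z" 2 1] by simp
  then show "z \<in> profile_domain"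
    using * a assms by (cases z) (simp add: profile_domain_def)
qed

text \<open>With \<open>\<eta>\<close> the parameter of the region,
  \<open>a^2 * R = W * Q \<ge> 2 * \<eta>\<close>. Since \<open>a^2 \<le> 1\<close>, this bounds
  \<open>R\<close> below; since \<open>R \<le> 1\<close> and \<open>a^2 \<le> a\<close>, it bounds
  \<open>a\<close> below. The factor 1/2 makes both bounds strict, which gives the interior.\<close>

lemma profile_region_interior:
  assumes c: "c \<noteq> 0" and z: "z \<in> profile_domain" and \<omega>: "0 < \<omega>" "\<omega> \<le> profile_W c z"
  shows "z \<in> interior (profile_region (\<omega> * min 1 (c\<^sup>2) / 2))"
proof -
  define a R q where "a = fst z" "R = 1 - (fst z)\<^sup>2 - (snd z)\<^sup>2" "q = min 1 (c\<^sup>2)"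
  note D = profile_domainD[OF z, folded a_R_q_def]
  have R_eq: "R = 1 - a\<^sup>2 - (snd z)\<^sup>2" by (simp add: a_R_q_def)
  define \<eta> where "\<eta> = \<omega> * q / 2"
  have q: "0 < q" "q \<le> profile_Q c a"
    using min_1_square_pos[OF c] profile_Q_ge[OF D(1,2)] by (auto simp: a_R_q_def)
  have \<eta>: "0 < \<eta>" using \<omega> q by (simp add: \<eta>_def)
  have "\<omega> * q \<le> profile_W c z * profile_Q c a"
    using \<omega> q by (intro mult_mono) auto
  also have "\<dots> = a\<^sup>2 * R"
    using q by (simp add: profile_W_def R_eq flip: a_R_q_def(1))
  finally have aR: "2 * \<eta> \<le> a\<^sup>2 * R" by (simp add: \<eta>_def)
  have a2: "a\<^sup>2 \<le> 1" using D by (simp add: power_le_one)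
  have "a\<^sup>2 * R \<le> 1 * R" using a2 D by (intro mult_right_mono) auto
  then have R: "\<eta> < R" using aR \<eta> by linarith
  have "R \<le> 1" by (simp add: a_R_q_def)
  then have "a\<^sup>2 * R \<le> a\<^sup>2 * 1" by (intro mult_left_mono) auto
  also have "a\<^sup>2 \<le> a" using D mult_left_mono[of a 1 a] by (simp add: power2_eq_square)
  finally have a: "\<eta> < a" using aR \<eta> by simp
  have "{z. \<eta> < fst z} \<inter> ball 0 (sqrt (1 - \<eta>)) \<subseteq> interior (profile_region \<eta>)"
    by (rule interior_maximal)
      (auto simp: profile_region_def intro!: open_Int open_Collect_less continuous_intros)
  moreover have "norm z < sqrt (1 - \<eta>)"
    using R by (simp add: norm_prod_def a_R_q_def)
  ultimately show ?thesis using a by (auto simp: \<eta>_def a_R_q_def)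
qed

text \<open>Differentiate \<open>2 * ln a + ln R - ln Q\<close>. In \<open>R'\<close> the summand
  \<open>- a\<close> of the acceleration cancels the derivative of \<open>a^2\<close>, so
  \<open>R' / R\<close> is \<open>- 2 * a * a'\<close> times the bracket of
  \<open>profile_acc\<close>. Its part \<open>1 / (a^2 * Q)\<close> combines with
  \<open>2 * a' / a\<close> and \<open>Q' / Q\<close> to a multiple of
  \<open>Q - 1 - (c^2 - 1) * a^2\<close>, which is 0.\<close>

lemma ln_profile_W_deriv:
  fixes a :: "real \<Rightarrow> real"
  assumes c: "c \<noteq> 0" and D: "(a t, p t) \<in> profile_domain"
    and a: "(a has_real_derivative p t) (at t)"
    and p: "(p has_real_derivative profile_acc k1 k2 d1 d2 c \<epsilon> l t (a t, p t)) (at t)"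
  shows "((\<lambda>t. ln (profile_W c (a t, p t))) has_real_derivative
    - 2 * a t * p t * (d1 / (l t)\<^sup>2 - d2 * inv_l2_sq k1 k2 \<epsilon> (l t) (profile_W c (a t, p t)))) (at t)"
proof -
  note D' = profile_domainD[OF D, simplified]
  have Q: "0 < profile_Q c (a t)" using profile_Q_pos[OF c D] by simp
  define S where "S = d1 / (l t)\<^sup>2 - d2 * inv_l2_sq k1 k2 \<epsilon> (l t) (profile_W c (a t, p t))"
  define R where "R = 1 - (a t)\<^sup>2 - (p t)\<^sup>2"
  define q where "q = profile_Q c (a t)"
  define b where "b = profile_acc k1 k2 d1 d2 c \<epsilon> l t (a t, p t)"
  have b: "b = a t * R * (1 / ((a t)\<^sup>2 * q) + S) - a t"
    by (simp add: b_def profile_acc_def S_def R_def q_def add_diff_eq)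
  have "((\<lambda>t. 2 * ln (a t) + ln (1 - (a t)\<^sup>2 - (p t)\<^sup>2) - ln (profile_Q c (a t))) has_real_derivative
      2 * (p t / a t) + (- 2 * a t * p t - 2 * p t * b) / R - (c\<^sup>2 - 1) * (2 * a t * p t) / q) (at t)"
    unfolding profile_Q_def
    using D' Q a p
    by (auto intro!: derivative_eq_intros simp: R_def q_def b_def profile_Q_def mult_ac)
  also have "2 * (p t / a t) + (- 2 * a t * p t - 2 * p t * b) / R - (c\<^sup>2 - 1) * (2 * a t * p t) / q
      = - 2 * a t * p t * S"
  proof -
    have R: "R > 0" and q: "q > 0" using D' Q by (auto simp: R_def q_def)
    define V where "V = 2 * p t * a t * (1 / ((a t)\<^sup>2 * q))"
    have 1: "(- 2 * a t * p t - 2 * p t * b) / R = - V - 2 * a t * p t * S"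
      using R by (simp add: b V_def field_simps)
    have "2 * (p t / a t) - V - (c\<^sup>2 - 1) * (2 * a t * p t) / q
        = 2 * p t / (a t * q) * (q - 1 - (c\<^sup>2 - 1) * (a t)\<^sup>2)"
      using D' q by (simp add: V_def field_simps power2_eq_square)
    also have "q - 1 - (c\<^sup>2 - 1) * (a t)\<^sup>2 = 0" by (simp add: q_def profile_Q_def)
    finally show ?thesis unfolding 1 by simp
  qed
  finally have d: "((\<lambda>t. 2 * ln (a t) + ln (1 - (a t)\<^sup>2 - (p t)\<^sup>2) - ln (profile_Q c (a t)))
      has_real_derivative - 2 * a t * p t * S) (at t)" .
  \<comment> \<open>Splitting the logarithm of \<open>W\<close> needs positive factors. Openness of
    the domain provides them near \<open>t\<close>.\<close>
  have "\<forall>\<^sub>F s in nhds t. (a s, p s) \<in> profile_domain"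
  proof -
    have "isCont (\<lambda>s. (a s, p s)) t"
      using a p by (intro isCont_Pair DERIV_isCont)
    then have "\<forall>\<^sub>F s in at t. (a s, p s) \<in> profile_domain"
      unfolding isCont_def using open_profile_domain D by (rule topological_tendstoD)
    then show ?thesis using D by (simp add: eventually_nhds_conv_at)
  qed
  then have "\<forall>\<^sub>F s in nhds t. 2 * ln (a s) + ln (1 - (a s)\<^sup>2 - (p s)\<^sup>2) - ln (profile_Q c (a s))
      = ln (profile_W c (a s, p s))"
  proof eventually_elim
    case (elim s)
    then show ?case
      using profile_domainD[OF elim] profile_Q_pos[OF c elim]
      by (simp add: profile_W_def ln_div ln_mult ln_realpow)
  qed
  from DERIV_cong_ev[OF refl this refl] d show ?thesis unfolding S_def by blast
qed

text \<open>In the derivative of \<open>ln W\<close> the terms without \<open>l1\<close> and \<open>l2\<close> cancel, and what remains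
  is bounded because \<open>\<bar>2 a a'\<bar> \<le> 1\<close> and \<open>1 / l2^2\<close> is an increasing function of \<open>W \<le> 1 / min 1 (c^2)\<close>.\<close>

lemma ln_profile_W_bound:
  fixes z :: "real \<Rightarrow> real \<times> real"
  assumes c: "c \<noteq> 0" and d: "0 < d1" "0 < d2" 
    and z: "\<And>s. s \<in> closed_segment t0 t \<Longrightarrow>
      (z has_vector_derivative profile_field k1 k2 d1 d2 c \<epsilon> l s (z s)) (at s) \<and> z s \<in> profile_domain"
    and C: "\<And>s. s \<in> closed_segment t0 t \<Longrightarrow>
      d1 / (l s)\<^sup>2 + d2 * inv_l2_sq k1 k2 \<epsilon> (l s) (1 / min 1 (c\<^sup>2)) \<le> C"
  shows "\<bar>ln (profile_W c (z t)) - ln (profile_W c (z t0))\<bar> \<le> C * \<bar>t - t0\<bar>"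
proof -
  let ?I = "closed_segment t0 t"
  define a p where "a = fst \<circ> z" "p = snd \<circ> z"
  have z_eq: "z s = (a s, p s)" for s by (simp add: a_p_def)
  define E where "E s = d1 / (l s)\<^sup>2 - d2 * inv_l2_sq k1 k2 \<epsilon> (l s) (profile_W c (z s))" for s
  have deriv: "((\<lambda>s. ln (profile_W c (z s))) has_real_derivative - 2 * a s * p s * E s) (at s)"
    if s: "s \<in> ?I" for s
  proof -
    note zs = z[OF s]
    have "(a has_vector_derivative p s) (at s)"
      using bounded_linear.has_vector_derivative[OF bounded_linear_fst conjunct1[OF zs]]
      by (simp add: a_p_def o_def profile_field_def)
    moreover have "(p has_vector_derivative profile_acc k1 k2 d1 d2 c \<epsilon> l s (a s, p s)) (at s)"
      using bounded_linear.has_vector_derivative[OF bounded_linear_snd conjunct1[OF zs]]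
      by (simp add: a_p_def o_def profile_field_def)
    ultimately show ?thesis
      unfolding E_def z_eq using zs
      by (intro ln_profile_W_deriv[OF c]) (auto simp: z_eq has_real_derivative_iff_has_vector_derivative)
  qed
  have bound: "\<bar>- 2 * a s * p s * E s\<bar> \<le> C" if s: "s \<in> ?I" for s
  proof -
    have D: "z s \<in> profile_domain" using z[OF s] by simp
    have "\<bar>2 * a s * p s\<bar> \<le> (a s)\<^sup>2 + (p s)\<^sup>2"
      using sum_squares_bound[of "\<bar>a s\<bar>" "\<bar>p s\<bar>"] by (simp add: abs_mult)
    also have "\<dots> \<le> 1" using profile_domainD[OF D] by (simp add: a_p_def)
    finally have ap: "\<bar>2 * a s * p s\<bar> \<le> 1" .
    have "inv_l2_sq k1 k2 \<epsilon> (l s) (profile_W c (z s)) \<le> inv_l2_sq k1 k2 \<epsilon> (l s) (1 / min 1 (c\<^sup>2))"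
      unfolding inv_l2_sq_def
      using profile_W_pos[OF c D] profile_W_le[OF c D] min_1_square_pos[OF c]
      by (auto intro!: divide_right_mono)
    then have le: "d2 * inv_l2_sq k1 k2 \<epsilon> (l s) (profile_W c (z s)) \<le>
        d2 * inv_l2_sq k1 k2 \<epsilon> (l s) (1 / min 1 (c\<^sup>2))"
      using d by (intro mult_left_mono) auto
    have "0 \<le> d1 / (l s)\<^sup>2" "0 \<le> d2 * inv_l2_sq k1 k2 \<epsilon> (l s) (profile_W c (z s))"
      using d by (simp_all add: inv_l2_sq_def)
    then have E: "\<bar>E s\<bar> \<le> C" using le C[OF s] by (simp add: E_def abs_le_iff)
    have "\<bar>- 2 * a s * p s * E s\<bar> = \<bar>2 * a s * p s\<bar> * \<bar>E s\<bar>" by (simp add: abs_mult)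
    also have "\<dots> \<le> 1 * C" using ap E by (intro mult_mono) auto
    finally show ?thesis by simp
  qed
  have "norm (ln (profile_W c (z t)) - ln (profile_W c (z t0))) \<le> C * norm (t - t0)"
    by (rule field_differentiable_bound[of ?I "\<lambda>s. ln (profile_W c (z s))" "\<lambda>s. - 2 * a s * p s * E s"])
      (use deriv bound in \<open>auto intro: has_field_derivative_at_within\<close>)
  then show ?thesis by simp
qed

lemma continuous_on_profile_field:
  assumes "c \<noteq> 0" "continuous_on UNIV l" "\<And>t. 0 < l t" "x \<in> profile_domain"
  shows "continuous_on UNIV (\<lambda>t. profile_field k1 k2 d1 d2 c \<epsilon> l t x)"
proof -
  have "continuous_on (UNIV \<times> profile_domain)
      (\<lambda>z. profile_field k1 k2 d1 d2 c \<epsilon> l (fst z) (snd z))"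
    using C1_family_profile_field[OF assms(1-3)] by (simp add: C1_family_def)
  then have "continuous_on UNIV (\<lambda>t. profile_field k1 k2 d1 d2 c \<epsilon> l (fst (t, x)) (snd (t, x)))"
    by (rule continuous_on_compose2) (use assms(4) in \<open>auto intro: continuous_intros\<close>)
  then show ?thesis by simp
qed

lemma ex_profile_solution:
  fixes l :: "real \<Rightarrow> real"
  assumes c: "c \<noteq> 0" and d: "0 < d1" "0 < d2"
    and l: "continuous_on UNIV l" "\<And>t. 0 < l t" and z0: "z0 \<in> profile_domain"
  shows "\<exists>z. z t0 = z0 \<and> (\<forall>t.
    (z has_vector_derivative profile_field k1 k2 d1 d2 c \<epsilon> l t (z t)) (at t) \<and> z t \<in> profile_domain)"
proof (rule ex_global_solution)
  note C1 = C1_family_profile_field[OF c l, of k1 k2 d1 d2 \<epsilon>]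
  show "local_lipschitz UNIV profile_domain (profile_field k1 k2 d1 d2 c \<epsilon> l)"
    by (rule C1_family_imp_local_lipschitz[OF C1 open_profile_domain])
  show "continuous_on UNIV (\<lambda>t. profile_field k1 k2 d1 d2 c \<epsilon> l t x)" if "x \<in> profile_domain" for x
    by (rule continuous_on_profile_field[OF c l that])
  fix N :: real assume N: "0 \<le> N"
  \<comment> \<open>Here \<open>W\<close> is replaced by its upper bound, so the rate depends on
    time alone and attains a maximum on the interval.\<close>
  define G where "G s = d1 / (l s)\<^sup>2 + d2 * inv_l2_sq k1 k2 \<epsilon> (l s) (1 / min 1 (c\<^sup>2))" for s
  have "continuous_on {t0 - N..t0 + N} G"
    unfolding G_def inv_l2_sq_def divide_inverse using l
    by (auto intro!: continuous_intros continuous_on_subset[OF l(1)] simp: less_imp_neq[symmetric])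
  then obtain u where C: "\<And>s. s \<in> {t0 - N..t0 + N} \<Longrightarrow> G s \<le> G u"
    using continuous_attains_sup[of "{t0 - N..t0 + N}" G] N by force
  define C where "C = G u"
  have C0: "0 \<le> C" unfolding C_def G_def using d by (simp add: inv_l2_sq_def)
  \<comment> \<open>The least value \<open>W\<close> can reach within time \<open>N\<close> when
    \<open>ln W\<close> changes at rate at most \<open>C\<close>. Neither constant involves
    \<open>K\<close>, so \<open>K\<close> can be chosen from \<open>\<omega>\<close>
    afterwards.\<close>
  define \<omega> where "\<omega> = profile_W c z0 * exp (- C * N)"
  have \<omega>: "0 < \<omega>" using profile_W_pos[OF c z0] by (simp add: \<omega>_def)
  define K where "K = profile_region (\<omega> * min 1 (c\<^sup>2) / 2)"
  have pos: "0 < \<omega> * min 1 (c\<^sup>2) / 2" using \<omega> min_1_square_pos[OF c] by simp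
  note K_sub = profile_region_subset[OF pos, folded K_def]
  have "z t \<in> interior K" if t: "\<bar>t - t0\<bar> \<le> N" and init: "z t0 = z0"
    and sol: "\<forall>s\<in>closed_segment t0 t.
      (z has_vector_derivative profile_field k1 k2 d1 d2 c \<epsilon> l s (z s)) (at s) \<and> z s \<in> K" for z t
  proof -
    have "\<bar>ln (profile_W c (z t)) - ln (profile_W c (z t0))\<bar> \<le> C * \<bar>t - t0\<bar>"
    proof (rule ln_profile_W_bound[OF c d])
      fix s assume s: "s \<in> closed_segment t0 t"
      then show "(z has_vector_derivative profile_field k1 k2 d1 d2 c \<epsilon> l s (z s)) (at s) \<and>
          z s \<in> profile_domain" using sol K_sub by blast
      have "s \<in> {t0 - N..t0 + N}"
        using s t by (auto simp: closed_segment_eq_real_ivl split: if_splits)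
      from C[OF this] show "d1 / (l s)\<^sup>2 + d2 * inv_l2_sq k1 k2 \<epsilon> (l s) (1 / min 1 (c\<^sup>2)) \<le> C"
        by (simp add: C_def G_def)
    qed
    also have "\<dots> \<le> C * N" using t C0 by (intro mult_left_mono) auto
    finally have *: "ln (profile_W c z0) - C * N \<le> ln (profile_W c (z t))" by (simp add: init abs_le_iff)
    have D: "z t \<in> profile_domain" using sol K_sub by auto
    have "ln \<omega> \<le> ln (profile_W c (z t))"
      using * profile_W_pos[OF c z0] by (simp add: \<omega>_def ln_mult)
    then have "\<omega> \<le> profile_W c (z t)" using \<omega> profile_W_pos[OF c D] by simp
    then show ?thesis unfolding K_def by (rule profile_region_interior[OF c D \<omega>])
  qed
  moreover have "\<omega> \<le> profile_W c z0"
    using profile_W_pos[OF c z0] C0 N by (simp add: \<omega>_def mult_le_cancel_left1)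
  then have "z0 \<in> interior K" unfolding K_def by (rule profile_region_interior[OF c z0 \<omega>])
  moreover have "compact K" "convex K" by (simp_all add: K_def compact_profile_region convex_profile_region)
  ultimately show "\<exists>K. compact K \<and> convex K \<and> K \<subseteq> profile_domain \<and> z0 \<in> interior K \<and>
      (\<forall>z t. \<bar>t - t0\<bar> \<le> N \<longrightarrow> z t0 = z0 \<longrightarrow>
        (\<forall>s\<in>closed_segment t0 t. (z has_vector_derivative profile_field k1 k2 d1 d2 c \<epsilon> l s (z s)) (at s)
          \<and> z s \<in> K) \<longrightarrow> z t \<in> interior K)"
    using K_sub by blast
qed

section \<open>Warps and phases\<close>

text \<open>The product equation solved for the second warp in logarithmic form:
  \<open>k2 * ln l2 = (ln \<epsilon> - ln W) / 2 - k1 * ln l1\<close>.\<close>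

definition l2_of :: "nat \<Rightarrow> nat \<Rightarrow> real \<Rightarrow> real \<Rightarrow> real \<Rightarrow> real" where
  "l2_of k1 k2 \<epsilon> l W = exp ((ln \<epsilon> - ln W - 2 * real k1 * ln l) / (2 * real k2))"

lemma inv_l2_sq_eq:
  assumes "0 < k2"
  shows "1 / (l2_of k1 k2 \<epsilon> l W)\<^sup>2 = inv_l2_sq k1 k2 \<epsilon> l W"
proof -
  have "1 / (l2_of k1 k2 \<epsilon> l W)\<^sup>2 = exp (- (2 * ((ln \<epsilon> - ln W - 2 * real k1 * ln l) / (2 * real k2))))"
    unfolding l2_of_def exp_minus exp_double by (simp only: inverse_eq_divide)
  also have "- (2 * ((ln \<epsilon> - ln W - 2 * real k1 * ln l) / (2 * real k2))) =
      (2 * real k1 * ln l + ln W - ln \<epsilon>) / real k2"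
    using assms by (simp add: field_simps)
  finally show ?thesis by (simp add: inv_l2_sq_def)
qed

lemma rec_F_eq:
  assumes c: "c \<noteq> 0" and \<epsilon>: "0 < \<epsilon>" and D: "(a t, deriv a t) \<in> profile_domain"
  shows "rec_F c \<epsilon> a t = exp ((ln \<epsilon> - ln (profile_W c (a t, deriv a t))) / 2)"
proof -
  define W where "W = profile_W c (a t, deriv a t)"
  have W: "0 < W" unfolding W_def by (rule profile_W_pos[OF c D])
  have "\<epsilon> * rec_Q c a t / ((a t)\<^sup>2 * rec_R a t) = \<epsilon> / W"
    by (simp add: W_def profile_W_def rec_Q_def rec_R_def profile_Q_def)
  also have "\<dots> = exp (ln \<epsilon> - ln W)" using W \<epsilon> by (simp add: exp_diff)
  also have "\<dots> = (exp ((ln \<epsilon> - ln W) / 2))\<^sup>2" by (simp flip: exp_double)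
  finally show ?thesis by (simp add: rec_F_def W_def)
qed

text \<open>For fixed positive \<open>l\<close> the product equation has one positive solution
  \<open>m\<close>. The difference equation is affine in the second derivative of \<open>a\<close>
  with nonzero coefficient, hence equivalent to the equation solved for that derivative.\<close>

lemma warp_pair_eq_iff:
  assumes k: "0 < k1" "0 < k2" and c: "c \<noteq> 0" and \<epsilon>: "0 < \<epsilon>"
    and D: "\<And>t. (a t, deriv a t) \<in> profile_domain" and l: "\<And>t. 0 < l t"
  shows "warp_pair k1 k2 d1 d2 (rec_F c \<epsilon> a) (rec_T c a) (l, m) \<longleftrightarrow>
    m = (\<lambda>t. l2_of k1 k2 \<epsilon> (l t) (profile_W c (a t, deriv a t))) \<and>
    (\<forall>t. deriv (deriv a) t = profile_acc k1 k2 d1 d2 c \<epsilon> l t (a t, deriv a t))"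
proof -
  define W where "W t = profile_W c (a t, deriv a t)" for t
  define l2 where "l2 t = l2_of k1 k2 \<epsilon> (l t) (W t)" for t
  have l2_pos: "0 < l2 t" for t by (simp add: l2_def l2_of_def)
  have prod: "l t ^ k1 * l2 t ^ k2 = rec_F c \<epsilon> a t" for t
  proof -
    have "l t ^ k1 = exp (real k1 * ln (l t))"
      using l[of t] by (simp add: exp_of_nat_mult)
    moreover have "l2 t ^ k2 =
        exp (real k2 * ((ln \<epsilon> - ln (W t) - 2 * real k1 * ln (l t)) / (2 * real k2)))"
      by (simp only: l2_def l2_of_def exp_of_nat_mult)
    ultimately have "l t ^ k1 * l2 t ^ k2 =
        exp (real k1 * ln (l t) + real k2 * ((ln \<epsilon> - ln (W t) - 2 * real k1 * ln (l t)) / (2 * real k2)))"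
      by (simp only: exp_add)
    also have "real k1 * ln (l t) + real k2 * ((ln \<epsilon> - ln (W t) - 2 * real k1 * ln (l t)) / (2 * real k2))
        = (ln \<epsilon> - ln (W t)) / 2"
      using k by (simp add: field_simps)
    finally show ?thesis using rec_F_eq[OF c \<epsilon> D, of t] by (simp add: W_def)
  qed
  have power_iff: "l t ^ k1 * y ^ k2 = rec_F c \<epsilon> a t \<longleftrightarrow> y = l2 t" if "0 < y" for t y
  proof
    assume "l t ^ k1 * y ^ k2 = rec_F c \<epsilon> a t"
    then have "y ^ k2 = l2 t ^ k2" using l[of t] by (simp flip: prod)
    then show "y = l2 t"
      using power_eq_imp_eq_base[of y k2 "l2 t"] that l2_pos[of t] k by simp
  qed (simp add: prod)
  have ode: "d2 / (l2 t)\<^sup>2 - d1 / (l t)\<^sup>2 = rec_T c a t \<longleftrightarrow>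
      deriv (deriv a) t = profile_acc k1 k2 d1 d2 c \<epsilon> l t (a t, deriv a t)" for t
  proof -
    note D' = profile_domainD[OF D[of t], simplified]
    define E where "E = inv_l2_sq k1 k2 \<epsilon> (l t) (W t)"
    define R where "R = 1 - (a t)\<^sup>2 - (deriv a t)\<^sup>2"
    define S where "S = 1 / ((a t)\<^sup>2 * profile_Q c (a t))"
    have R: "0 < R" using D' by (simp add: R_def)
    have "d2 / (l2 t)\<^sup>2 = d2 * E"
      using inv_l2_sq_eq[OF k(2), of k1 \<epsilon> "l t" "W t"] by (simp add: l2_def E_def divide_inverse)
    moreover have "rec_T c a t = S - (a t + deriv (deriv a) t) / (a t * R)"
      by (simp add: rec_T_def S_def R_def rec_R_def rec_Q_def profile_Q_def)
    moreover have "profile_acc k1 k2 d1 d2 c \<epsilon> l t (a t, deriv a t) =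
        a t * R * (S + d1 / (l t)\<^sup>2 - d2 * E) - a t"
      by (simp add: profile_acc_def S_def R_def E_def W_def)
    moreover have "(d2 * E - d1 / (l t)\<^sup>2 = S - (a t + x) / (a t * R)) \<longleftrightarrow>
        x = a t * R * (S + d1 / (l t)\<^sup>2 - d2 * E) - a t" for x
    proof -
      have "(d2 * E - d1 / (l t)\<^sup>2 = S - (a t + x) / (a t * R)) \<longleftrightarrow>
          (a t + x) / (a t * R) = S + d1 / (l t)\<^sup>2 - d2 * E" by linarith
      also have "\<dots> \<longleftrightarrow> a t + x = (S + d1 / (l t)\<^sup>2 - d2 * E) * (a t * R)"
        using R D' by (intro nonzero_divide_eq_eq) simp
      finally show ?thesis by (auto simp: mult.commute)
    qed
    ultimately show ?thesis by simp
  qed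
  show ?thesis
  proof
    assume wp: "warp_pair k1 k2 d1 d2 (rec_F c \<epsilon> a) (rec_T c a) (l, m)"
    then have "m t = l2 t" for t using power_iff[of "m t" t] by (auto simp: warp_pair_def)
    moreover have "d2 / (m t)\<^sup>2 - d1 / (l t)\<^sup>2 = rec_T c a t" for t
      using wp by (auto simp: warp_pair_def)
    ultimately show "m = (\<lambda>t. l2_of k1 k2 \<epsilon> (l t) (profile_W c (a t, deriv a t))) \<and>
        (\<forall>t. deriv (deriv a) t = profile_acc k1 k2 d1 d2 c \<epsilon> l t (a t, deriv a t))"
      using ode by (auto simp: l2_def W_def)
  next
    assume *: "m = (\<lambda>t. l2_of k1 k2 \<epsilon> (l t) (profile_W c (a t, deriv a t))) \<and>
      (\<forall>t. deriv (deriv a) t = profile_acc k1 k2 d1 d2 c \<epsilon> l t (a t, deriv a t))"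
    then have "m = l2" by (auto simp: l2_def W_def)
    with * show "warp_pair k1 k2 d1 d2 (rec_F c \<epsilon> a) (rec_T c a) (l, m)"
      using ode prod l l2_pos by (simp add: warp_pair_def)
  qed
qed

text \<open>The warps are a definite description. \<open>F\<close> is positive, so by
  \<open>ex1_warp_pair\<close> any pair satisfying the two equations is the described one; this
  gives both directions.\<close>

lemma first_warp_eq_iff:
  assumes k: "0 < k1" "0 < k2" and d: "0 < d1" "0 < d2" and c: "c \<noteq> 0" and \<epsilon>: "0 < \<epsilon>"
    and D: "\<And>t. (a t, deriv a t) \<in> profile_domain" and l: "\<And>t. 0 < l t"
  shows "first_warp k1 k2 d1 d2 c \<epsilon> a = l \<longleftrightarrow>
      (\<forall>t. deriv (deriv a) t = profile_acc k1 k2 d1 d2 c \<epsilon> l t (a t, deriv a t))"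
    and "first_warp k1 k2 d1 d2 c \<epsilon> a = l \<Longrightarrow> second_warp k1 k2 d1 d2 c \<epsilon> a =
      (\<lambda>t. l2_of k1 k2 \<epsilon> (l t) (profile_W c (a t, deriv a t)))"
proof -
  note iff = warp_pair_eq_iff[where a = a and l = l, OF k c \<epsilon> D l, of d1 d2]
  let ?w = "warps k1 k2 d1 d2 c \<epsilon> a" and ?wp = "warp_pair k1 k2 d1 d2 (rec_F c \<epsilon> a) (rec_T c a)"
  have ex1: "\<exists>!w. ?wp w"
    by (rule ex1_warp_pair[OF k d]) (simp add: rec_F_eq[OF c \<epsilon> D])
  then have w: "?wp ?w" unfolding warps_def by (rule theI')
  then have "?wp (first_warp k1 k2 d1 d2 c \<epsilon> a, second_warp k1 k2 d1 d2 c \<epsilon> a)"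
    by (simp add: first_warp_def second_warp_def)
  then show second: "first_warp k1 k2 d1 d2 c \<epsilon> a = l \<Longrightarrow> second_warp k1 k2 d1 d2 c \<epsilon> a =
      (\<lambda>t. l2_of k1 k2 \<epsilon> (l t) (profile_W c (a t, deriv a t)))"
    using iff by simp
  show "first_warp k1 k2 d1 d2 c \<epsilon> a = l \<longleftrightarrow>
      (\<forall>t. deriv (deriv a) t = profile_acc k1 k2 d1 d2 c \<epsilon> l t (a t, deriv a t))"
  proof
    assume "first_warp k1 k2 d1 d2 c \<epsilon> a = l"
    then have "?w = (l, second_warp k1 k2 d1 d2 c \<epsilon> a)" by (auto simp: first_warp_def second_warp_def)
    then show "\<forall>t. deriv (deriv a) t = profile_acc k1 k2 d1 d2 c \<epsilon> l t (a t, deriv a t)"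
      using w iff by simp
  next
    assume "\<forall>t. deriv (deriv a) t = profile_acc k1 k2 d1 d2 c \<epsilon> l t (a t, deriv a t)"
    then obtain m where "?wp (l, m)" using iff by blast
    then have "?w = (l, m)" using ex1 w by blast
    then show "first_warp k1 k2 d1 d2 c \<epsilon> a = l" by (simp add: first_warp_def)
  qed
qed

section \<open>Smoothness of solutions of the profile equation\<close>

lemma k_differentiable_profile_W:
  fixes a p :: "real \<Rightarrow> real"
  assumes "c \<noteq> 0" "\<And>t. (a t, p t) \<in> profile_domain"
    "k_differentiable_on n UNIV a" "k_differentiable_on n UNIV p"
  shows "k_differentiable_on n UNIV (\<lambda>t. profile_W c (a t, p t))"
proof -
  have "profile_Q c (a t) \<noteq> 0" for t using profile_Q_pos[OF assms(1,2), of t] by simp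
  note Q = this[unfolded profile_Q_def]
  show ?thesis
    unfolding profile_W_def profile_Q_def fst_conv snd_conv
    by (intro smooth_intros assms(3,4) Q)
qed

text \<open>Bootstrap: if \<open>a\<close> and \<open>a'\<close> are regular of order
  \<open>n\<close>, so is the acceleration, a smooth expression in \<open>a\<close>,
  \<open>a'\<close> and \<open>l\<close>; being derivatives of \<open>a\<close> and
  \<open>a'\<close>, the functions \<open>a'\<close> and \<open>a''\<close> then raise their order
  by one.\<close>

lemma smooth_on_profile:
  assumes c: "c \<noteq> 0" and l: "smooth_on UNIV l" "\<And>t. 0 < l t"
    and z: "\<And>t. (z has_vector_derivative profile_field k1 k2 d1 d2 c \<epsilon> l t (z t)) (at t)"
      "\<And>t. z t \<in> profile_domain"
  shows "\<And>t. (fst (z t), deriv (\<lambda>t. fst (z t)) t) = z t"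
    and "deriv (deriv (\<lambda>t. fst (z t))) t = profile_acc k1 k2 d1 d2 c \<epsilon> l t (z t)"
    and "smooth_on UNIV (\<lambda>t. fst (z t))"
proof -
  define a p where "a t = fst (z t)" "p t = snd (z t)" for t
  have z_eq: "z t = (a t, p t)" for t by (simp add: a_p_def)
  have a: "(a has_real_derivative p t) (at t)" for t
    using bounded_linear.has_vector_derivative[OF bounded_linear_fst z(1)[of t]]
    by (simp add: a_p_def[abs_def] profile_field_def has_real_derivative_iff_has_vector_derivative)
  have p: "(p has_real_derivative profile_acc k1 k2 d1 d2 c \<epsilon> l t (a t, p t)) (at t)" for t
    using bounded_linear.has_vector_derivative[OF bounded_linear_snd z(1)[of t]]
    by (simp add: a_p_def[abs_def] profile_field_def has_real_derivative_iff_has_vector_derivative)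
  have da: "deriv a = p" using a by (intro ext DERIV_imp_deriv)
  then show "(fst (z t), deriv (\<lambda>t. fst (z t)) t) = z t" for t by (simp add: a_p_def[abs_def])
  show "deriv (deriv (\<lambda>t. fst (z t))) t = profile_acc k1 k2 d1 d2 c \<epsilon> l t (z t)"
    using DERIV_imp_deriv[OF p, of t] da by (simp add: a_p_def[abs_def])
  have D: "(a t, p t) \<in> profile_domain" for t using z(2)[of t] by (simp add: z_eq)
  have "k_differentiable_on n UNIV a \<and> k_differentiable_on n UNIV p" for n
  proof (induction n)
    case 0
    then show ?case using a p by (auto intro: continuous_at_imp_continuous_on DERIV_isCont)
  next
    case (Suc n)
    then have IH: "k_differentiable_on n UNIV a" "k_differentiable_on n UNIV p" by auto
    have l': "k_differentiable_on n UNIV l" using l by (simp add: smooth_on_def)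
    have Q: "profile_Q c (a t) \<noteq> 0" "a t \<noteq> 0" "l t \<noteq> 0" for t
      using profile_Q_pos[OF c D, of t] profile_domainD[OF D, of t] l(2)[of t] by auto
    have "k_differentiable_on n UNIV (\<lambda>t. profile_acc k1 k2 d1 d2 c \<epsilon> l t (a t, p t))"
      unfolding profile_acc_def inv_l2_sq_def fst_conv snd_conv divide_inverse[of _ "real k2"]
      by (intro smooth_intros k_differentiable_profile_W[OF c D IH] IH l' l(2) profile_W_pos[OF c D])
        (use Q in \<open>auto simp: profile_Q_def intro!: smooth_intros IH\<close>)
    with IH show ?case
      using k_differentiable_on_SucI[OF a] k_differentiable_on_SucI[OF p] by blast
  qed
  then show "smooth_on UNIV (\<lambda>t. fst (z t))" by (simp add: smooth_on_def a_p_def[abs_def])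
qed

lemma profile_solution_of_deriv:
  assumes "smooth_on UNIV a"
    and "\<And>t. deriv (deriv a) t = profile_acc k1 k2 d1 d2 c \<epsilon> l t (a t, deriv a t)"
  shows "((\<lambda>t. (a t, deriv a t)) has_vector_derivative
    profile_field k1 k2 d1 d2 c \<epsilon> l t (a t, deriv a t)) (at t)"
proof -
  note a = smooth_on_UNIV_deriv[OF assms(1)]
  show ?thesis
    unfolding profile_field_def snd_conv
    using a(2)[of t] smooth_on_UNIV_deriv(2)[OF a(1), of t] assms(2)[of t]
    by (intro has_vector_derivative_Pair) (simp_all add: has_real_derivative_iff_has_vector_derivative)
qed

section \<open>Existence of the phases and their uniqueness up to constants\<close>

lemma phases_iff:
  assumes "phases c \<epsilon> \<sigma> a s1 s2"
  shows "phases c \<epsilon> \<sigma> a r1 r2 \<longleftrightarrow> (\<exists>C1 C2. (\<forall>t. r1 t = s1 t + C1) \<and> (\<forall>t. r2 t = s2 t + C2))"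
proof
  assume r: "phases c \<epsilon> \<sigma> a r1 r2"
  have "((\<lambda>t. r1 t - s1 t) has_real_derivative 0) (at t)"
    "((\<lambda>t. r2 t - s2 t) has_real_derivative 0) (at t)" for t
    using DERIV_diff r assms unfolding phases_def by (metis diff_self)+
  then have "r1 t - s1 t = r1 0 - s1 0" "r2 t - s2 t = r2 0 - s2 0" for t
    using DERIV_isconst_all[of "\<lambda>t. r1 t - s1 t" t 0] DERIV_isconst_all[of "\<lambda>t. r2 t - s2 t" t 0]
    by auto
  then show "\<exists>C1 C2. (\<forall>t. r1 t = s1 t + C1) \<and> (\<forall>t. r2 t = s2 t + C2)"
    by (intro exI[of _ "r1 0 - s1 0"] exI[of _ "r2 0 - s2 0"]) (simp add: algebra_simps)
next
  assume "\<exists>C1 C2. (\<forall>t. r1 t = s1 t + C1) \<and> (\<forall>t. r2 t = s2 t + C2)"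
  then obtain C1 C2 where "r1 = (\<lambda>t. s1 t + C1)" "r2 = (\<lambda>t. s2 t + C2)" by blast
  then show "phases c \<epsilon> \<sigma> a r1 r2"
    using assms unfolding phases_def by (auto intro!: derivative_eq_intros)
qed

lemma ex_phases:
  assumes c: "c \<noteq> 0" and \<epsilon>: "0 < \<epsilon>" and a: "smooth_on UNIV a"
    and D: "\<And>t. (a t, deriv a t) \<in> profile_domain"
  shows "\<exists>s1 s2. phases c \<epsilon> \<sigma> a s1 s2"
proof -
  \<comment> \<open>Order 0 is continuity, so the closure rules also serve to show that the
    prescribed phase derivatives are continuous.\<close>
  have kd: "k_differentiable_on 0 UNIV a" "k_differentiable_on 0 UNIV (deriv a)"
    using a smooth_on_UNIV_deriv(1)[OF a] unfolding smooth_on_def by blast+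
  have "rec_F c \<epsilon> a = (\<lambda>t. exp ((ln \<epsilon> - ln (profile_W c (a t, deriv a t))) / 2))"
    using rec_F_eq[OF c \<epsilon> D] by (rule ext)
  then have F: "k_differentiable_on 0 UNIV (rec_F c \<epsilon> a)"
    unfolding divide_inverse
    by (simp only:) (intro smooth_intros k_differentiable_profile_W[OF c D kd] profile_W_pos[OF c D])
  have F_pos: "rec_F c \<epsilon> a t \<noteq> 0" for t using rec_F_eq[OF c \<epsilon> D, of t] by simp
  have a01: "0 < a t" "(a t)\<^sup>2 < 1" for t
    using profile_domainD[OF D, of t] zero_le_power2[of "deriv a t"] by (simp_all, linarith)
  have "k_differentiable_on 0 UNIV (\<lambda>t. \<sigma> * sqrt \<epsilon> / (rec_F c \<epsilon> a t * (a t)\<^sup>2))"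
    by (intro smooth_intros F kd) (use F_pos a01 in \<open>simp add: less_imp_neq[symmetric]\<close>)
  then obtain s1 where s1: "\<And>t. (s1 has_vector_derivative \<sigma> * sqrt \<epsilon> / (rec_F c \<epsilon> a t * (a t)\<^sup>2)) (at t)"
    using antiderivative_exists[of "\<lambda>t. \<sigma> * sqrt \<epsilon> / (rec_F c \<epsilon> a t * (a t)\<^sup>2)"] by auto
  have b: "(rec_b a t)\<^sup>2 = 1 - (a t)\<^sup>2" for t using a01(2)[of t] by (simp add: rec_b_def)
  have "k_differentiable_on 0 UNIV (\<lambda>t. \<sigma> * c * sqrt \<epsilon> / (rec_F c \<epsilon> a t * (rec_b a t)\<^sup>2))"
    unfolding b
    by (intro smooth_intros F kd) (use F_pos a01(2) in \<open>simp add: less_imp_neq\<close>)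
  then obtain s2 where s2: "\<And>t. (s2 has_vector_derivative \<sigma> * c * sqrt \<epsilon> / (rec_F c \<epsilon> a t * (rec_b a t)\<^sup>2)) (at t)"
    using antiderivative_exists[of "\<lambda>t. \<sigma> * c * sqrt \<epsilon> / (rec_F c \<epsilon> a t * (rec_b a t)\<^sup>2)"] by auto
  show ?thesis
    using s1 s2 unfolding phases_def has_real_derivative_iff_has_vector_derivative by blast
qed

theorem theorem4p5:
  fixes A\<^sub>1 :: "('a::{t2_space,second_countable_topology}, real^'k) rchart set"
    and A\<^sub>2 :: "('b::{t2_space,second_countable_topology}, real^'l) rchart set"
    and f\<^sub>1 :: "'a \<Rightarrow> complex^'n" and f\<^sub>2 :: "'b \<Rightarrow> complex^'m"
    and d\<^sub>1 d\<^sub>2 c \<epsilon> \<sigma> t\<^sub>0 a\<^sub>0 p\<^sub>0 :: real and l\<^sub>1 :: "real \<Rightarrow> real"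
  assumes "riemannian_manifold A\<^sub>1" and "riemannian_manifold A\<^sub>2"
    and "eigenmap A\<^sub>1 f\<^sub>1 d\<^sub>1" and "eigenmap A\<^sub>2 f\<^sub>2 d\<^sub>2"
    and "smooth_on UNIV l\<^sub>1" and "\<And>t. 0 < l\<^sub>1 t"
    and "c \<noteq> 0" and "0 < \<epsilon>" and "\<sigma> \<in> {-1, 1}" and "(a\<^sub>0, p\<^sub>0) \<in> profile_domain"
  defines "admissible \<equiv> \<lambda>a :: real \<Rightarrow> real.
      smooth_on UNIV a \<and> a t\<^sub>0 = a\<^sub>0 \<and> deriv a t\<^sub>0 = p\<^sub>0 \<and>
      (\<forall>t. (a t, deriv a t) \<in> profile_domain) \<and>
      first_warp CARD('k) CARD('l) d\<^sub>1 d\<^sub>2 c \<epsilon> a = l\<^sub>1"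
  shows "(\<exists>!a. admissible a) \<and>
    (\<forall>a. admissible a \<longrightarrow>
      (\<forall>t. 0 < second_warp CARD('k) CARD('l) d\<^sub>1 d\<^sub>2 c \<epsilon> a t) \<and>
      smooth_on UNIV (second_warp CARD('k) CARD('l) d\<^sub>1 d\<^sub>2 c \<epsilon> a) \<and>
      (\<exists>s\<^sub>1 s\<^sub>2. phases c \<epsilon> \<sigma> a s\<^sub>1 s\<^sub>2 \<and>
        (\<forall>r\<^sub>1 r\<^sub>2. phases c \<epsilon> \<sigma> a r\<^sub>1 r\<^sub>2 \<longleftrightarrow>
          (\<exists>C\<^sub>1 C\<^sub>2. (\<forall>t. r\<^sub>1 t = s\<^sub>1 t + C\<^sub>1) \<and> (\<forall>t. r\<^sub>2 t = s\<^sub>2 t + C\<^sub>2)))) \<and>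
      (riemannian_complete A\<^sub>1 \<and> riemannian_complete A\<^sub>2 \<longrightarrow>
        (\<forall>(G, A) \<in> reconstructions A\<^sub>1 f\<^sub>1 d\<^sub>1 A\<^sub>2 f\<^sub>2 d\<^sub>2 c \<epsilon> \<sigma> a. riemannian_complete A)))"
proof -
  note A = assms(1,2) and l = assms(5,6) and c = assms(7) and \<epsilon> = assms(8) and z0 = assms(10)
  have d: "0 < d\<^sub>1" "0 < d\<^sub>2" using assms(3,4) by (auto simp: eigenmap_def)
  have k: "0 < CARD('k)" "0 < CARD('l)" by simp_all
  have "k_differentiable_on 0 UNIV l\<^sub>1" using l(1) unfolding smooth_on_def by blast
  then have l_cont: "continuous_on UNIV l\<^sub>1" by simp
  define field where "field = profile_field CARD('k) CARD('l) d\<^sub>1 d\<^sub>2 c \<epsilon> l\<^sub>1"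
  have lip: "local_lipschitz UNIV profile_domain field"
    unfolding field_def
    by (rule C1_family_imp_local_lipschitz[OF C1_family_profile_field[OF c l_cont l(2)] open_profile_domain])
  have field_cont: "continuous_on UNIV (\<lambda>t. field t x)" if "x \<in> profile_domain" for x
    unfolding field_def by (rule continuous_on_profile_field[OF c l_cont l(2) that])
  \<comment> \<open>Prescribing the first warp amounts to solving the equation for
    \<open>field\<close>, so uniqueness of \<open>a\<close> reduces to uniqueness for an initial
    value problem.\<close>
  have sol: "((\<lambda>t. (a t, deriv a t)) has_vector_derivative field t (a t, deriv a t)) (at t)"
    if "admissible a" for a t
  proof -
    have "smooth_on UNIV a" and D: "\<And>t. (a t, deriv a t) \<in> profile_domain"
      and "first_warp CARD('k) CARD('l) d\<^sub>1 d\<^sub>2 c \<epsilon> a = l\<^sub>1"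
      using that by (auto simp: admissible_def)
    then show ?thesis
      unfolding field_def using first_warp_eq_iff(1)[where a = a and l = l\<^sub>1, OF k d c \<epsilon> D l(2)]
      by (intro profile_solution_of_deriv) auto
  qed
  have unique: "a = a'" if "admissible a" "admissible a'" for a a'
  proof
    fix t
    have "(a t, deriv a t) = (a' t, deriv a' t)"
      by (rule solution_unique[OF field_cont lip, of t\<^sub>0 t "\<lambda>t. (a t, deriv a t)" "\<lambda>t. (a' t, deriv a' t)"])
        (use that sol in \<open>auto simp: admissible_def\<close>)
    then show "a t = a' t" by simp
  qed
  obtain z where z: "z t\<^sub>0 = (a\<^sub>0, p\<^sub>0)" "\<And>t. (z has_vector_derivative field t (z t)) (at t)"
    "\<And>t. z t \<in> profile_domain"
    using ex_profile_solution[OF c d l_cont l(2) z0, of t\<^sub>0 "CARD('k)" "CARD('l)" \<epsilon>]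
    unfolding field_def by blast
  \<comment> \<open>The first component of \<open>field\<close> is \<open>snd\<close>, so the other
    component of the solution is \<open>deriv a\<close>.\<close>
  define a where "a t = fst (z t)" for t
  note smooth = smooth_on_profile[OF c l z(2)[unfolded field_def] z(3), folded a_def[abs_def]]
  have z_a: "(a t, deriv a t) = z t" for t using smooth(1)[of t] by (simp add: a_def)
  have "first_warp CARD('k) CARD('l) d\<^sub>1 d\<^sub>2 c \<epsilon> a = l\<^sub>1"
    by (subst first_warp_eq_iff(1)[where a = a and l = l\<^sub>1, OF k d c \<epsilon> _ l(2)]) (use z(3) smooth(2) in \<open>auto simp: z_a\<close>)
  moreover have "a t\<^sub>0 = a\<^sub>0" "deriv a t\<^sub>0 = p\<^sub>0" using z_a[of t\<^sub>0] z(1) by auto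
  ultimately have "admissible a"
    unfolding admissible_def using smooth(3) z(3) by (auto simp: z_a)
  then have ex1: "\<exists>!a. admissible a" using unique by blast
  have "(\<forall>t. 0 < second_warp CARD('k) CARD('l) d\<^sub>1 d\<^sub>2 c \<epsilon> a t) \<and>
      smooth_on UNIV (second_warp CARD('k) CARD('l) d\<^sub>1 d\<^sub>2 c \<epsilon> a) \<and>
      (\<exists>s\<^sub>1 s\<^sub>2. phases c \<epsilon> \<sigma> a s\<^sub>1 s\<^sub>2 \<and>
        (\<forall>r\<^sub>1 r\<^sub>2. phases c \<epsilon> \<sigma> a r\<^sub>1 r\<^sub>2 \<longleftrightarrow>
          (\<exists>C\<^sub>1 C\<^sub>2. (\<forall>t. r\<^sub>1 t = s\<^sub>1 t + C\<^sub>1) \<and> (\<forall>t. r\<^sub>2 t = s\<^sub>2 t + C\<^sub>2)))) \<and>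
      (riemannian_complete A\<^sub>1 \<and> riemannian_complete A\<^sub>2 \<longrightarrow>
        (\<forall>(G, A) \<in> reconstructions A\<^sub>1 f\<^sub>1 d\<^sub>1 A\<^sub>2 f\<^sub>2 d\<^sub>2 c \<epsilon> \<sigma> a. riemannian_complete A))"
    if adm: "admissible a" for a
  proof -
    have a: "smooth_on UNIV a" and D: "\<And>t. (a t, deriv a t) \<in> profile_domain"
      and first: "first_warp CARD('k) CARD('l) d\<^sub>1 d\<^sub>2 c \<epsilon> a = l\<^sub>1"
      using adm by (auto simp: admissible_def)
    define l\<^sub>2 where "l\<^sub>2 = second_warp CARD('k) CARD('l) d\<^sub>1 d\<^sub>2 c \<epsilon> a"
    have l2: "l\<^sub>2 = (\<lambda>t. l2_of CARD('k) CARD('l) \<epsilon> (l\<^sub>1 t) (profile_W c (a t, deriv a t)))"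
      unfolding l\<^sub>2_def by (rule first_warp_eq_iff(2)[where a = a and l = l\<^sub>1, OF k d c \<epsilon> D l(2) first])
    have l2_pos: "0 < l\<^sub>2 t" for t by (simp add: l2 l2_of_def)
    have "k_differentiable_on n UNIV l\<^sub>2" for n
    proof -
      have "k_differentiable_on n UNIV a" "k_differentiable_on n UNIV (deriv a)"
        "k_differentiable_on n UNIV l\<^sub>1"
        using a smooth_on_UNIV_deriv(1)[OF a] l(1) unfolding smooth_on_def by blast+
      then show ?thesis
        unfolding l2 l2_of_def divide_inverse
        by (intro smooth_intros k_differentiable_profile_W[OF c D] profile_W_pos[OF c D] l(2))
    qed
    then have l2_smooth: "smooth_on UNIV l\<^sub>2" by (simp add: smooth_on_def)
    then have l2_cont: "continuous_on UNIV l\<^sub>2"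
      unfolding smooth_on_def by (metis k_differentiable_on.simps(1))
    have "riemannian_complete A"
      if "riemannian_complete A\<^sub>1" "riemannian_complete A\<^sub>2"
        "(G, A) \<in> reconstructions A\<^sub>1 f\<^sub>1 d\<^sub>1 A\<^sub>2 f\<^sub>2 d\<^sub>2 c \<epsilon> \<sigma> a" for G A
    proof -
      \<comment> \<open>The phases enter only the map \<open>G\<close>, so all reconstructions from
        \<open>a\<close> share this one metric.\<close>
      have "A = warped_metric l\<^sub>1 l\<^sub>2 A\<^sub>1 A\<^sub>2"
        using that(3) by (auto simp: reconstructions_def first l\<^sub>2_def)
      then show ?thesis
        using riemannian_complete_warped[OF A that(1,2) l_cont l(2) l2_cont l2_pos] by simp
    qed
    moreover obtain s\<^sub>1 s\<^sub>2 where "phases c \<epsilon> \<sigma> a s\<^sub>1 s\<^sub>2" using ex_phases[OF c \<epsilon> a D] by blast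
    ultimately show ?thesis
      using l2_pos l2_smooth phases_iff unfolding l\<^sub>2_def by blast
  qed
  with ex1 show ?thesis by blast
qed

end
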